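(* Let $z_1,z_2\in\mathbb{C}\setminus(-\infty,1]$ and $\lambda,\alpha\in\mathbb{C}^\ast$, such that $\Re(\lambda+2\alpha)>0$. Then $$C_\lambda^\alpha(z_1)C_\lambda^\alpha(z_2)=\frac{\cos(\pi(\lambda+\alpha))\Gamma(\lambda+\alpha+\frac12)}{2^{\alpha-\frac12}\sqrt{\pi}\,\Gamma(\lambda+1)\Gamma(\alpha)(z_1z_2)^{\lambda+\alpha+\frac12}(z_1^2-1)^{\frac12\alpha-\frac14}(z_2^2-1)^{\frac12\alpha-\frac14}}\int_{1}^{\frac{z_1z_2+1}{z_1+z_2}}C_\lambda^\alpha(z_3)\frac{(z_3^2-1)^{\frac12\alpha-\frac54}}{z_3^{\lambda+\alpha+\frac12}}(C-1)^{-\lambda-\alpha-\frac12}\,dz_3 ,$$ where $$C=C(z_1,z_2,z_3)=\frac{1-z_1^2z_2^2-z_1^2z_3^2-z_2^2z_3^2+2z_1^2z_2^2z_3^2}{2z_1z_2z_3\sqrt{(z_1^2-1)(z_2^2-1)(z_3^2-1)}}.$$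
   Context: $\mathbb{C}^\ast=\mathbb{C}\setminus\{0\}$. The Gegenbauer function of the first kind (written with indices) is $C_\lambda^\alpha(z)=\frac{\sqrt\pi\,\Gamma(2\alpha+\lambda)}{2^{2\alpha-1}\Gamma(\alpha)\Gamma(\lambda+1)}\mathbf{F}\big(-\lambda,2\alpha+\lambda;\alpha+\frac12;\frac{1-z}{2}\big)$, where $\mathbf{F}(a,b;c;z)=\sum_{n\ge0}\frac{(a)_n(b)_n}{\Gamma(c+n)}\frac{z^n}{n!}$ (continued analytically) is the regularized Gauss hypergeometric function. The unindexed $C$ is the algebraic expression in the claim.
   Formalization: Literal formula only if Re(λ+α)<1/2 (else the integral diverges), λ+α+1/2≠0,−1,−2,…, z1+z2≠0 and upper limit not in (−∞,−1]; otherwise the right side means its analytic continuation. Powers and roots are branches continued from real z1,z2>1 along a circular arc. *)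

theory Defs
  imports "HOL-Analysis.Analysis"
begin

text \<open>
  The regularized Gauss hypergeometric function on the plane cut along \<open>[1, \<infinity>)\<close>. Since
  \<^const>\<open>rGamma\<close> is \<open>1/\<Gamma>\<close> extended by \<open>0\<close> to the poles of \<open>\<Gamma>\<close>, there is no restriction
  on \<open>c\<close>.
\<close>

definition hypergeo_reg :: "complex \<Rightarrow> complex \<Rightarrow> complex \<Rightarrow> complex \<Rightarrow> complex" where
  "hypergeo_reg a b c z = (THE w. \<exists>f.
      f holomorphic_on - (of_real ` {1..}) \<and>
      (\<forall>x. norm x < 1 \<longrightarrow>
        f x = (\<Sum>n. pochhammer a n * pochhammer b n * rGamma (c + of_nat n) * x ^ n / fact n)) \<and>
      w = f z)"

definition gegenbauer :: "complex \<Rightarrow> complex \<Rightarrow> complex \<Rightarrow> complex" where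
  "gegenbauer l a z =
     of_real (sqrt pi) * Gamma (2 * a + l) / 2 powr (2 * a - 1) * rGamma a * rGamma (l + 1)
     * hypergeo_reg (- l) (2 * a + l) (a + 1/2) ((1 - z) / 2)"

definition cut_plane :: "complex set" where
  "cut_plane = - (of_real ` {..1})"

text \<open>
  Powers of \<open>z\<^sup>2 - 1\<close> and its square root for \<open>z\<close> in \<^const>\<open>cut_plane\<close>: the branches that are
  holomorphic there and positive for real exponents and \<open>z > 1\<close>. The principal power of \<open>z\<^sup>2 - 1\<close> is
  discontinuous across the imaginary axis.
\<close>

definition sq1_powr :: "complex \<Rightarrow> complex \<Rightarrow> complex" where
  "sq1_powr z p = (z - 1) powr p * (z + 1) powr p"

definition sq1_sqrt :: "complex \<Rightarrow> complex" where
  "sq1_sqrt z = csqrt (z - 1) * csqrt (z + 1)"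

definition upper_limit :: "complex \<Rightarrow> complex \<Rightarrow> complex" where
  "upper_limit z1 z2 = (z1 * z2 + 1) / (z1 + z2)"

text \<open>
  The path of integration from \<open>1\<close> to \<^const>\<open>upper_limit\<close>: the circular arc (for real
  \<open>z1, z2 > 1\<close>, the segment) whose image under \<open>z \<mapsto> (z - 1) / (z + 1)\<close> is the segment from \<open>0\<close> to
  \<open>w = (z1 - 1) / (z1 + 1) * ((z2 - 1) / (z2 + 1))\<close>.
\<close>

definition arc3 :: "complex \<Rightarrow> complex \<Rightarrow> real \<Rightarrow> complex" where
  "arc3 z1 z2 u =
     (let w = (z1 - 1) / (z1 + 1) * ((z2 - 1) / (z2 + 1))
      in (1 + of_real u * w) / (1 - of_real u * w))"

text \<open>
  The integral has a meaning only if its upper limit is finite and is not on the cut \<open>(-\<infinity>, -1]\<close> of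
  the Gegenbauer function. The arc then avoids this cut, too.
\<close>

definition admissible :: "(complex \<times> complex) set" where
  "admissible = {(z1, z2). z1 \<in> cut_plane \<and> z2 \<in> cut_plane \<and> z1 + z2 \<noteq> 0 \<and>
     upper_limit z1 z2 \<notin> of_real ` {..-1}}"

lemma arc3_0: "arc3 z1 z2 0 = 1"
  by (simp add: arc3_def)

lemma arc3_1:
  assumes "(z1, z2) \<in> admissible"
  shows "arc3 z1 z2 1 = upper_limit z1 z2"
proof -
  have ne: "z1 + 1 \<noteq> 0" "z2 + 1 \<noteq> 0"
  proof -
    have "- 1 \<notin> cut_plane"
      unfolding cut_plane_def by (auto intro!: image_eqI[of _ _ "-1"])
    then show "z1 + 1 \<noteq> 0" "z2 + 1 \<noteq> 0"
      using assms by (auto simp: admissible_def add_eq_0_iff2)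
  qed
  have "z1 + z2 \<noteq> 0"
    using assms by (simp add: admissible_def)
  have d: "1 - (z1 - 1) / (z1 + 1) * ((z2 - 1) / (z2 + 1)) = 2 * (z1 + z2) / ((z1 + 1) * (z2 + 1))"
    using ne by (simp add: divide_simps) (simp add: algebra_simps)
  have n: "1 + (z1 - 1) / (z1 + 1) * ((z2 - 1) / (z2 + 1)) = 2 * (z1 * z2 + 1) / ((z1 + 1) * (z2 + 1))"
    using ne by (simp add: divide_simps) (simp add: algebra_simps)
  show ?thesis
    unfolding arc3_def upper_limit_def Let_def of_real_1 mult_1 d n
    using ne \<open>z1 + z2 \<noteq> 0\<close>
    by (simp del: distrib_left_numeral add: mult.assoc)
qed

text \<open>
  The multivalued factors of the integrand denote the branches obtained by continuation in
  \<open>(z1, z2)\<close> and along the arc, starting from the principal values for real \<open>z1, z2 > 1\<close> (where all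
  bases are positive). Principal values do not do for all complex \<open>z1, z2\<close>: the arc may
  cross \<open>(-1, 1)\<close>, where the principal square root of \<open>z\<^sup>2 - 1\<close> changes its sign and with it \<open>C\<close>.
  The exponential of the logarithm need not be \<open>f\<close> where \<open>f\<close> is \<open>0\<close>; this only concerns the
  removable singularity of \<open>z3 * (C - 1)\<close> at \<open>z3 = 0\<close>.
\<close>

definition configs :: "(complex \<times> complex \<times> real) set" where
  "configs = {(z1, z2, u). (z1, z2) \<in> admissible \<and> 0 < u \<and> u < 1}"

definition real_configs :: "(complex \<times> complex \<times> real) set" where
  "real_configs = of_real ` {1<..} \<times> of_real ` {1<..} \<times> {0<..<1}"

definition continued_log ::
    "(complex \<times> complex \<times> real \<Rightarrow> complex) \<Rightarrow> complex \<times> complex \<times> real \<Rightarrow> complex" where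
  "continued_log f p = (THE w. \<exists>L.
      continuous_on configs L \<and>
      (\<forall>x\<in>configs. f x \<noteq> 0 \<longrightarrow> exp (L x) = f x) \<and>
      (\<forall>x\<in>real_configs. L x = Ln (f x)) \<and>
      w = L p)"

definition log_sq1 :: "complex \<times> complex \<times> real \<Rightarrow> complex" where
  "log_sq1 = continued_log (\<lambda>(z1, z2, u). (arc3 z1 z2 u)^2 - 1)"

definition C_fun :: "complex \<times> complex \<times> real \<Rightarrow> complex" where
  "C_fun = (\<lambda>(z1, z2, u). let z3 = arc3 z1 z2 u in
     (1 - z1^2 * z2^2 - z1^2 * z3^2 - z2^2 * z3^2 + 2 * z1^2 * z2^2 * z3^2) /
     (2 * z1 * z2 * z3 * (sq1_sqrt z1 * sq1_sqrt z2 * exp (log_sq1 (z1, z2, u) / 2))))"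

text \<open>
  The powers of \<open>z3\<close> and of \<open>C - 1\<close> have opposite monodromy around \<open>z3 = 0\<close>, which can be on the
  arc; only their product is continued.
\<close>

definition log_z3C :: "complex \<times> complex \<times> real \<Rightarrow> complex" where
  "log_z3C = continued_log (\<lambda>(z1, z2, u). arc3 z1 z2 u * (C_fun (z1, z2, u) - 1))"

definition product_integrand ::
    "complex \<Rightarrow> complex \<Rightarrow> complex \<Rightarrow> complex \<Rightarrow> real \<Rightarrow> complex" where
  "product_integrand l a z1 z2 u =
     gegenbauer l a (arc3 z1 z2 u)
     * exp ((a/2 - 5/4) * log_sq1 (z1, z2, u))
     * exp ((- l - a - 1/2) * log_z3C (z1, z2, u))
     * vector_derivative (arc3 z1 z2) (at u)"

definition product_rhs :: "complex \<Rightarrow> complex \<Rightarrow> complex \<Rightarrow> complex \<Rightarrow> complex" where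
  "product_rhs l a z1 z2 =
     cos (of_real pi * (l + a)) * Gamma (l + a + 1/2) * rGamma (l + 1) * rGamma a
     / (2 powr (a - 1/2) * of_real (sqrt pi)
        * (z1 powr (l + a + 1/2) * z2 powr (l + a + 1/2))
        * sq1_powr z1 (a/2 - 1/4) * sq1_powr z2 (a/2 - 1/4))
     * integral {0..1} (product_integrand l a z1 z2)"

text \<open>
  The integrand grows like the power \<open>-\<lambda> - \<alpha> - 1/2\<close> of the distance to the upper limit, so
  that the integral diverges there unless \<open>Re (\<lambda> + \<alpha>) < 1/2\<close> (or the Gegenbauer function vanishes
  identically), and for \<open>\<lambda> + \<alpha> + 1/2 = 0, -1, -2, \<dots>\<close> the factor
  \<open>cos (\<pi> (\<lambda> + \<alpha>)) * \<Gamma> (\<lambda> + \<alpha> + 1/2)\<close> has the indeterminate form \<open>0 * \<infinity>\<close>.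
\<close>

definition rhs_defined :: "complex \<Rightarrow> complex \<Rightarrow> complex \<Rightarrow> complex \<Rightarrow> bool" where
  "rhs_defined l a z1 z2 \<longleftrightarrow>
     (z1, z2) \<in> admissible \<and> Re (l + a) < 1/2 \<and> l + a + 1/2 \<notin> \<int>\<^sub>\<le>\<^sub>0"

text \<open>
  The analytic continuation of the right-hand side in all four variables to the domain
  \<open>z1, z2 \<in> cut_plane\<close>, \<open>\<lambda>, \<alpha> \<noteq> 0\<close>, \<open>Re (\<lambda> + 2 \<alpha>) > 0\<close>. By Hartogs' theorem, holomorphy in each
  variable separately is joint holomorphy. On this domain the continuation is unique.
\<close>

definition continues_rhs :: "(complex \<Rightarrow> complex \<Rightarrow> complex \<Rightarrow> complex \<Rightarrow> complex) \<Rightarrow> bool" where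
  "continues_rhs R \<longleftrightarrow>
     (\<forall>a z1 z2. a \<noteq> 0 \<longrightarrow> z1 \<in> cut_plane \<longrightarrow> z2 \<in> cut_plane \<longrightarrow>
        (\<lambda>l. R l a z1 z2) holomorphic_on {l. l \<noteq> 0 \<and> Re (l + 2 * a) > 0}) \<and>
     (\<forall>l z1 z2. l \<noteq> 0 \<longrightarrow> z1 \<in> cut_plane \<longrightarrow> z2 \<in> cut_plane \<longrightarrow>
        (\<lambda>a. R l a z1 z2) holomorphic_on {a. a \<noteq> 0 \<and> Re (l + 2 * a) > 0}) \<and>
     (\<forall>l a z2. l \<noteq> 0 \<longrightarrow> a \<noteq> 0 \<longrightarrow> Re (l + 2 * a) > 0 \<longrightarrow> z2 \<in> cut_plane \<longrightarrow>
        (\<lambda>z1. R l a z1 z2) holomorphic_on cut_plane) \<and>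
     (\<forall>l a z1. l \<noteq> 0 \<longrightarrow> a \<noteq> 0 \<longrightarrow> Re (l + 2 * a) > 0 \<longrightarrow> z1 \<in> cut_plane \<longrightarrow>
        (\<lambda>z2. R l a z1 z2) holomorphic_on cut_plane) \<and>
     (\<forall>l a z1 z2. l \<noteq> 0 \<longrightarrow> a \<noteq> 0 \<longrightarrow> Re (l + 2 * a) > 0 \<longrightarrow> rhs_defined l a z1 z2 \<longrightarrow>
        R l a z1 z2 = product_rhs l a z1 z2)"

end

theory Submission
  imports Defs "HOL-Complex_Analysis.Complex_Analysis"
begin

text \<open>
  In the variables \<open>p\<^sub>i = (z\<^sub>i - 1) / (z\<^sub>i + 1)\<close> the right-hand side simplifies: with \<open>w = p\<^sub>1 p\<^sub>2\<close>,
  \<open>q = u w\<close> and \<open>s = \<surd>u\<close> one has \<open>z\<^sub>3 = (1 + q) / (1 - q)\<close>, \<open>z\<^sub>3\<^sup>2 - 1 = 4 q / (1 - q)\<^sup>2\<close> and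
  \<open>z\<^sub>3 (C - 1) = (1 - s) (1 - s w) (1 - s p\<^sub>1) (1 - s p\<^sub>2) / (s (1 - q) (1 + p\<^sub>1) (1 + p\<^sub>2))\<close>, so that all
  continued logarithms are sums of principal ones. By a Pfaff transformation \<open>C\<^sub>\<lambda>\<^sup>\<alpha>(z)\<close> is, up to a
  constant, \<open>(1 - p)\<^sup>\<beta> E(p)\<close> with \<open>\<kappa> = \<lambda> + \<alpha> + 1/2\<close>, \<open>\<beta> = \<lambda> + 2 \<alpha>\<close> and \<open>E\<close> the Euler integral of
  \<open>F(\<kappa>, \<beta>; \<beta> - \<kappa> + 1; p)\<close>. The claim becomes
  \<open>\<integral> s\<^sup>\<beta>\<^sup>-\<^sup>1 ((1 - s) (1 - s w) (1 - s p\<^sub>1) (1 - s p\<^sub>2))\<^sup>-\<^sup>\<kappa> (1 - s\<^sup>2 w)\<^sup>2\<^sup>\<kappa> E(s\<^sup>2 w) ds = E(p\<^sub>1) E(p\<^sub>2)\<close> over \<open>[0, 1]\<close>.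

  The hypergeometric operator in \<open>p\<^sub>1\<close> maps the integrand to an \<open>s\<close>-derivative, so the integral is a
  multiple of \<open>E(p\<^sub>1)\<close>; by symmetry and the beta integral at \<open>p\<^sub>1 = p\<^sub>2 = 0\<close> it is \<open>E(p\<^sub>1) E(p\<^sub>2)\<close>
  near the origin, and continuation along \<open>(t p\<^sub>1, t p\<^sub>2)\<close> gives it everywhere. For the continuation in
  all variables one takes the left-hand side itself, which is holomorphic because the Euler
  integral extends to all \<open>c\<close> with \<open>Re b > 0\<close> by a recursion in \<open>c\<close>.
\<close>

text \<open>The coordinate p = exp (-2 x) belongs to z = coth x. The upper limit is coth (x1 + x2),
  so its coordinate is p1 p2, and the arc becomes a segment starting at 0. With s in place of u the
  coordinate of z3 has the square root s sqrt p1 sqrt p2; the roots of p1 and p2 then cancel in C,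
  and z3 (C - 1) splits into factors linear in s.

  The parameters of E are forced: c = alpha + 1/2 = beta - kappa + 1, and Pfaff's transformation
  replaces - lambda by c + lambda = kappa.

  The point p = 0 is z = 1, which is on the cut for z but inside the domain of E. There the
  hypergeometric equation has a regular singularity, and since Re c > 0 its holomorphic solutions
  form a line. A single value at 0 therefore identifies a solution.

  Two obstacles shape the rest. The integral converges only for Re kappa < 1, so the formula itself
  and the holomorphy of the left-hand side are separate tasks. And the branches in the claim are
  given by a uniqueness description, so the explicit logarithms have to be matched with it on the
  connected set \<open>configs\<close>.\<close>

section \<open>Integrals depending holomorphically on a parameter\<close>

text \<open>The majorant is required locally, but on a whole disc inside S, so that Cauchy's
  inequality on smaller discs bounds the derivatives in s by a multiple of the same M.\<close>

definition dominated_family :: "(complex \<Rightarrow> real \<Rightarrow> complex) \<Rightarrow> complex set \<Rightarrow> real set \<Rightarrow> bool" where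
  "dominated_family f S A \<longleftrightarrow> open S \<and>
     (\<forall>v\<in>A. (\<lambda>s. f s v) holomorphic_on S) \<and> (\<forall>s\<in>S. f s integrable_on A) \<and>
     (\<forall>s\<in>S. \<exists>r>0. \<exists>M. M integrable_on A \<and> cball s r \<subseteq> S \<and>
        (\<forall>t\<in>cball s r. \<forall>v\<in>A. norm (f t v) \<le> M v))"

lemma dominated_family_deriv_bound:
  assumes "\<forall>v\<in>A. (\<lambda>s. f s v) holomorphic_on S" and "0 < r" and "cball s r \<subseteq> S"
    and "\<forall>t\<in>cball s r. \<forall>v\<in>A. norm (f t v) \<le> M v"
    and t: "t \<in> cball s (r/2)" and v: "v \<in> A"
  shows "norm (deriv (\<lambda>s. f s v) t) \<le> M v / (r/2)"
proof -
  have sub: "cball t (r/2) \<subseteq> cball s r"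
  proof
    fix x assume "x \<in> cball t (r/2)"
    then show "x \<in> cball s r"
      using t dist_triangle[of s x t] by simp
  qed
  have hol: "(\<lambda>s. f s v) holomorphic_on cball t (r/2)"
    using assms sub holomorphic_on_subset by blast
  have "norm ((deriv ^^ 1) (\<lambda>s. f s v) t) \<le> fact 1 * M v / (r/2) ^ 1"
  proof (rule Cauchy_inequality)
    show "(\<lambda>s. f s v) holomorphic_on ball t (r/2)"
      using hol ball_subset_cball holomorphic_on_subset by blast
    show "continuous_on (cball t (r/2)) (\<lambda>s. f s v)"
      using hol holomorphic_on_imp_continuous_on by blast
    fix x assume "norm (t - x) = r/2"
    then have "x \<in> cball t (r/2)" by (simp add: dist_norm)
    then show "norm (f x v) \<le> M v" using sub assms by blast
  qed (use assms in simp)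
  then show ?thesis by simp
qed

text \<open>The mean value inequality bounds the difference quotients by 2 M / r, so dominated
  convergence applies along every sequence tending to s.\<close>

lemma dominated_family_has_integral_derivative:
  assumes fam: "dominated_family f S A" and s: "s \<in> S"
  shows "(\<lambda>v. deriv (\<lambda>s. f s v) s) integrable_on A"
    and "((\<lambda>s. integral A (f s)) has_field_derivative integral A (\<lambda>v. deriv (\<lambda>s. f s v) s)) (at s)"
proof -
  have S: "open S" and hol: "\<forall>v\<in>A. (\<lambda>s. f s v) holomorphic_on S"
    and int: "\<And>s. s \<in> S \<Longrightarrow> f s integrable_on A"
    using fam by (auto simp: dominated_family_def)
  obtain r M where r: "0 < r" and M: "M integrable_on A" and sub: "cball s r \<subseteq> S"
    and dom: "\<forall>t\<in>cball s r. \<forall>v\<in>A. norm (f t v) \<le> M v"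
    using fam s unfolding dominated_family_def by meson
  have quot: "norm ((f x v - f s v) / (x - s)) \<le> M v / (r/2)"
    if x: "x \<in> cball s (r/2)" "x \<noteq> s" and v: "v \<in> A" for x v
  proof -
    have sub2: "cball s (r/2) \<subseteq> S" using sub r by (auto simp: subset_iff)
    have "norm (f x v - f s v) \<le> M v / (r/2) * norm (x - s)"
    proof (rule field_differentiable_bound)
      show "convex (cball s (r/2))" by simp
      fix z assume z: "z \<in> cball s (r/2)"
      have "(\<lambda>s. f s v) field_differentiable (at z)"
        using hol v S z sub2 holomorphic_on_imp_differentiable_at by blast
      then show "((\<lambda>s. f s v) has_field_derivative deriv (\<lambda>s. f s v) z) (at z within cball s (r/2))"
        using DERIV_deriv_iff_field_differentiable has_field_derivative_at_within by blast
      show "norm (deriv (\<lambda>s. f s v) z) \<le> M v / (r/2)"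
        using dominated_family_deriv_bound[OF hol r sub dom z v] .
    qed (use x r in auto)
    then show ?thesis using x by (simp add: norm_divide divide_le_eq)
  qed
  have seq: "(\<lambda>v. deriv (\<lambda>s. f s v) s) integrable_on A \<and>
     (\<lambda>n. integral A (\<lambda>v. (f (X n) v - f s v) / (X n - s))) \<longlonglongrightarrow> integral A (\<lambda>v. deriv (\<lambda>s. f s v) s)"
    if X: "\<And>n. X n \<in> cball s (r/2)" "\<And>n. X n \<noteq> s" "X \<longlonglongrightarrow> s" for X :: "nat \<Rightarrow> complex"
  proof -
    have XS: "X n \<in> S" for n
      using X(1)[of n] sub r by (auto simp: subset_iff)
    have 1: "(\<lambda>v. (f (X n) v - f s v) / (X n - s)) integrable_on A" for n
      by (intro integrable_on_divide integrable_diff int XS s)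
    have 2: "(\<lambda>v. M v / (r/2)) integrable_on A" by (intro integrable_on_divide M)
    have 3: "(\<lambda>n. (f (X n) v - f s v) / (X n - s)) \<longlonglongrightarrow> deriv (\<lambda>s. f s v) s" if "v \<in> A" for v
    proof -
      have "((\<lambda>s. f s v) has_field_derivative deriv (\<lambda>s. f s v) s) (at s)"
        using hol that S s DERIV_deriv_iff_field_differentiable holomorphic_on_imp_differentiable_at by blast
      then have "((\<lambda>x. (f x v - f s v) / (x - s)) \<longlongrightarrow> deriv (\<lambda>s. f s v) s) (at s)"
        by (simp add: has_field_derivative_iff)
      moreover have "\<forall>i. X i \<in> UNIV - {s}" using X(2) by simp
      ultimately show ?thesis
        using X(3) unfolding tendsto_at_iff_sequentially o_def by blast
    qed
    have 4: "norm ((f (X n) v - f s v) / (X n - s)) \<le> M v / (r/2)" if "v \<in> A" for n v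
      using quot[OF X(1,2) that] .
    show ?thesis
      using dominated_convergence[where S=A and h="\<lambda>v. M v / (r/2)" and
          f="\<lambda>n v. (f (X n) v - f s v) / (X n - s)" and g="\<lambda>v. deriv (\<lambda>s. f s v) s", OF 1 2 4 3]
      by (rule conjI)
  qed
  \<comment> \<open>Dominated convergence yields integrability of the limit only from an actual
    sequence; this one serves that purpose.\<close>
  define X0 where "X0 n = s + of_real (r / 2 / real (Suc n))" for n
  have X0: "X0 n \<in> cball s (r/2)" "X0 n \<noteq> s" for n
    using r by (auto simp: X0_def dist_norm norm_divide divide_le_eq simp del: of_nat_Suc)
  have "(\<lambda>n. r / 2 / real (Suc n)) \<longlonglongrightarrow> 0"
    by (rule LIMSEQ_Suc, rule lim_const_over_n)
  then have "X0 \<longlonglongrightarrow> s + of_real 0"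
    unfolding X0_def by (intro tendsto_intros)
  then show int': "(\<lambda>v. deriv (\<lambda>s. f s v) s) integrable_on A"
    using seq[of X0, OF X0(1) X0(2)] by simp
  show "((\<lambda>s. integral A (f s)) has_field_derivative integral A (\<lambda>v. deriv (\<lambda>s. f s v) s)) (at s)"
    unfolding has_field_derivative_iff tendsto_at_iff_sequentially
  proof (intro allI impI)
    fix X :: "nat \<Rightarrow> complex" assume X: "\<forall>i. X i \<in> UNIV - {s}" "X \<longlonglongrightarrow> s"
    have "\<forall>\<^sub>F n in sequentially. dist (X n) s < r/2"
      using X r tendstoD half_gt_zero by blast
    then obtain N where N: "\<And>n. n \<ge> N \<Longrightarrow> dist (X n) s < r/2"
      unfolding eventually_sequentially by blast
    \<comment> \<open>Dropping finitely many terms puts the sequence into the disc on which the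
      majorant is valid.\<close>
    define Y where "Y n = X (n + N)" for n
    have Y: "Y n \<in> cball s (r/2)" "Y n \<noteq> s" for n
      using N[of "n + N"] X by (auto simp: Y_def dist_commute)
    have "Y \<longlonglongrightarrow> s" unfolding Y_def using X LIMSEQ_ignore_initial_segment by blast
    then have L: "(\<lambda>n. integral A (\<lambda>v. (f (Y n) v - f s v) / (Y n - s))) \<longlonglongrightarrow> integral A (\<lambda>v. deriv (\<lambda>s. f s v) s)"
      using seq[of Y, OF Y(1) Y(2)] by blast
    have YS: "Y n \<in> S" for n
      using Y(1)[of n] sub r by (auto simp: subset_iff)
    have "integral A (\<lambda>v. (f (Y n) v - f s v) / (Y n - s)) = (integral A (f (Y n)) - integral A (f s)) / (Y n - s)" for n
      using int[OF YS] int[OF s] by (simp add: integral_diff)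
    from L[unfolded this] have "(\<lambda>n. (integral A (f (X (n+N))) - integral A (f s)) / (X (n+N) - s)) \<longlonglongrightarrow> integral A (\<lambda>v. deriv (\<lambda>s. f s v) s)"
      unfolding Y_def .
    then show "((\<lambda>y. (integral A (f y) - integral A (f s)) / (y - s)) \<circ> X) \<longlonglongrightarrow> integral A (\<lambda>v. deriv (\<lambda>s. f s v) s)"
      unfolding o_def by (rule LIMSEQ_offset)
  qed
qed

lemma dominated_family_holomorphic:
  assumes "dominated_family f S A"
  shows "(\<lambda>s. integral A (f s)) holomorphic_on S"
  using dominated_family_has_integral_derivative(2)[OF assms] assms
  by (auto simp: dominated_family_def holomorphic_on_open)

text \<open>Makes a second differentiation under the integral sign possible, as a second-order
  operator requires.\<close>

lemma dominated_family_deriv: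
  assumes fam: "dominated_family f S A"
  shows "dominated_family (\<lambda>s v. deriv (\<lambda>s. f s v) s) S A"
  unfolding dominated_family_def
proof (intro conjI ballI)
  show S: "open S" using fam by (simp add: dominated_family_def)
  show "(\<lambda>s. deriv (\<lambda>s. f s v) s) holomorphic_on S" if "v \<in> A" for v
    using fam that by (auto simp: dominated_family_def intro!: holomorphic_deriv)
  show "(\<lambda>v. deriv (\<lambda>s. f s v) s) integrable_on A" if "s \<in> S" for s
    using dominated_family_has_integral_derivative(1)[OF fam that] .
  fix s assume s: "s \<in> S"
  have hol: "\<forall>v\<in>A. (\<lambda>s. f s v) holomorphic_on S" using fam by (simp add: dominated_family_def)
  obtain r M where r: "0 < r" and M: "M integrable_on A" and sub: "cball s r \<subseteq> S"
    and dom: "\<forall>t\<in>cball s r. \<forall>v\<in>A. norm (f t v) \<le> M v"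
    using fam s unfolding dominated_family_def by meson
  show "\<exists>r>0. \<exists>M. M integrable_on A \<and> cball s r \<subseteq> S \<and>
        (\<forall>t\<in>cball s r. \<forall>v\<in>A. norm (deriv (\<lambda>s. f s v) t) \<le> M v)"
  proof (intro exI conjI)
    show "0 < r/2" using r by simp
    show "(\<lambda>v. M v / (r/2)) integrable_on A" by (intro integrable_on_divide M)
    show "cball s (r/2) \<subseteq> S" using sub r by (auto simp: subset_iff)
    show "\<forall>t\<in>cball s (r/2). \<forall>v\<in>A. norm (deriv (\<lambda>s. f s v) t) \<le> M v / (r/2)"
      using dominated_family_deriv_bound[OF hol r sub dom] by blast
  qed
qed

text \<open>Zeilberger's method: \<open>C\<close> is a certificate that the operator maps the integrand to a
  derivative with respect to the variable of integration.\<close>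

lemma integral_satisfies_ode:
  fixes f1 :: "complex \<Rightarrow> real \<Rightarrow> complex"
  assumes fam: "dominated_family f S {0..1}" and s: "s \<in> S"
    and f1: "\<And>t v. t \<in> S \<Longrightarrow> v \<in> {0<..<1} \<Longrightarrow> ((\<lambda>s. f s v) has_field_derivative f1 t v) (at t)"
    and f2: "\<And>v. v \<in> {0<..<1} \<Longrightarrow> ((\<lambda>s. f1 s v) has_field_derivative f2 v) (at s)"
    and cont: "continuous_on {0..1} C" and C0: "C 0 = 0" and C1: "C 1 = 0"
    and C: "\<And>v. v \<in> {0<..<1} \<Longrightarrow>
      (C has_vector_derivative \<alpha> * f2 v + \<beta> * f1 s v + \<gamma> * f s v) (at v)"
  shows "\<alpha> * deriv (deriv (\<lambda>s. integral {0..1} (f s))) s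
       + \<beta> * deriv (\<lambda>s. integral {0..1} (f s)) s + \<gamma> * integral {0..1} (f s) = 0"
proof -
  note fam1 = dominated_family_deriv[OF fam]
  have S: "open S" using fam by (simp add: dominated_family_def)
  have D1: "deriv (\<lambda>s. integral {0..1} (f s)) t = integral {0..1} (\<lambda>v. deriv (\<lambda>s. f s v) t)"
    if "t \<in> S" for t
    using dominated_family_has_integral_derivative(2)[OF fam that] by (rule DERIV_imp_deriv)
  have "deriv (deriv (\<lambda>s. integral {0..1} (f s))) s
      = deriv (\<lambda>t. integral {0..1} (\<lambda>v. deriv (\<lambda>s. f s v) t)) s"
    by (rule deriv_cong_ev) (use D1 S s eventually_nhds_in_open[OF S s] in \<open>auto elim!: eventually_mono\<close>)
  also have "\<dots> = integral {0..1} (\<lambda>v. deriv (\<lambda>t. deriv (\<lambda>s. f s v) t) s)"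
    using dominated_family_has_integral_derivative(2)[OF fam1 s] by (rule DERIV_imp_deriv)
  finally have D2: "deriv (deriv (\<lambda>s. integral {0..1} (f s))) s
     = integral {0..1} (\<lambda>v. deriv (\<lambda>t. deriv (\<lambda>s. f s v) t) s)" .
  have d1: "deriv (\<lambda>s. f s v) t = f1 t v" if "t \<in> S" "v \<in> {0<..<1}" for t v
    using f1[OF that] by (rule DERIV_imp_deriv)
  have d2: "deriv (\<lambda>t. deriv (\<lambda>s. f s v) t) s = f2 v" if v: "v \<in> {0<..<1}" for v
  proof -
    have "deriv (\<lambda>t. deriv (\<lambda>s. f s v) t) s = deriv (\<lambda>t. f1 t v) s"
      by (rule deriv_cong_ev) (use d1 v s eventually_nhds_in_open[OF S s] in \<open>auto elim!: eventually_mono\<close>)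
    also have "\<dots> = f2 v" using f2[OF v] by (rule DERIV_imp_deriv)
    finally show ?thesis .
  qed
  have i0: "f s integrable_on {0..1}" using fam s by (auto simp: dominated_family_def)
  note i1 = dominated_family_has_integral_derivative(1)[OF fam s]
  note i2 = dominated_family_has_integral_derivative(1)[OF fam1 s]
  \<comment> \<open>The integrand may be unbounded at the end points, where C is merely continuous;
    hence the form of the fundamental theorem with derivatives in the interior only.\<close>
  have "((\<lambda>v. \<alpha> * f2 v + \<beta> * f1 s v + \<gamma> * f s v) has_integral (C 1 - C 0)) {0..1}"
    by (rule fundamental_theorem_of_calculus_interior) (use cont C in auto)
  moreover have "((\<lambda>v. \<alpha> * f2 v + \<beta> * f1 s v + \<gamma> * f s v) has_integral
     (\<alpha> * integral {0..1} (\<lambda>v. deriv (\<lambda>t. deriv (\<lambda>s. f s v) t) s)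
      + \<beta> * integral {0..1} (\<lambda>v. deriv (\<lambda>s. f s v) s) + \<gamma> * integral {0..1} (f s))) {0..1}"
  \<comment> \<open>\<open>f1\<close> and \<open>f2\<close> are known to be the derivatives only for
    0 < v < 1, and the two end points are a null set.\<close>
  proof (rule has_integral_spike[of "{0,1}"])
    show "((\<lambda>v. \<alpha> * deriv (\<lambda>t. deriv (\<lambda>s. f s v) t) s + \<beta> * deriv (\<lambda>s. f s v) s + \<gamma> * f s v) has_integral
     (\<alpha> * integral {0..1} (\<lambda>v. deriv (\<lambda>t. deriv (\<lambda>s. f s v) t) s)
      + \<beta> * integral {0..1} (\<lambda>v. deriv (\<lambda>s. f s v) s) + \<gamma> * integral {0..1} (f s))) {0..1}"
      by (intro has_integral_add has_integral_mult_right integrable_integral i0 i1 i2)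
  qed (use d1 d2 s in auto)
  ultimately have "C 1 - C 0 = \<alpha> * integral {0..1} (\<lambda>v. deriv (\<lambda>t. deriv (\<lambda>s. f s v) t) s)
      + \<beta> * integral {0..1} (\<lambda>v. deriv (\<lambda>s. f s v) s) + \<gamma> * integral {0..1} (f s)"
    by (rule has_integral_unique)
  then show ?thesis
    unfolding D1[OF s] D2 by (simp only: C0 C1 diff_self)
qed

section \<open>The complex beta integral\<close>

lemma absolutely_integrable_on_Icc_bound:
  fixes f :: "real \<Rightarrow> complex"
  assumes cont: "continuous_on {0<..<1} f" and M: "M integrable_on {0..1}"
    and le: "\<And>v. v \<in> {0<..<1} \<Longrightarrow> norm (f v) \<le> M v"
  shows "f absolutely_integrable_on {0..1}"
proof -
  have "f absolutely_integrable_on {0<..<1}"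
  proof (rule measurable_bounded_by_integrable_imp_absolutely_integrable)
    show "f \<in> borel_measurable (lebesgue_on {0<..<1})"
      using cont by (rule continuous_imp_measurable_on_sets_lebesgue) simp
    show "M integrable_on {0<..<1}"
      using M by (simp add: integrable_on_Icc_iff_Ioo)
  qed (use le in auto)
  then show ?thesis
    unfolding absolutely_integrable_on_def by (simp add: integrable_on_Icc_iff_Ioo)
qed

lemma norm_of_real_powr:
  fixes z :: complex
  assumes "0 \<le> x"
  shows "norm (of_real x powr z) = x powr Re z"
  using assms by (simp add: norm_powr_real_powr)

lemma continuous_on_of_real_powr:
  fixes z :: complex
  assumes "continuous_on A f" "\<And>x. x \<in> A \<Longrightarrow> 0 < f x"
  shows "continuous_on A (\<lambda>x. complex_of_real (f x) powr z)"
proof -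
  have "continuous_on A (\<lambda>x. exp (z * complex_of_real (ln (f x))))"
    using assms by (intro continuous_intros) (auto dest!: assms(2))
  also have "?this \<longleftrightarrow> ?thesis"
    using assms(2) by (intro continuous_on_cong) (auto simp: powr_def Ln_of_real dest: assms(2))
  finally show ?thesis .
qed

definition beta_weight :: "complex \<Rightarrow> complex \<Rightarrow> real \<Rightarrow> complex" where
  "beta_weight b d v = of_real v powr (b - 1) * of_real (1 - v) powr (d - 1)"

lemma norm_beta_weight:
  assumes "v \<in> {0..1}"
  shows "norm (beta_weight b d v) = v powr (Re b - 1) * (1 - v) powr (Re d - 1)"
  using assms norm_of_real_powr[of v "b - 1"] norm_of_real_powr[of "1 - v" "d - 1"]
  by (simp add: beta_weight_def norm_mult)

text \<open>\<open>0 powr x\<close> is 0 for every exponent. This default makes the weight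
  holomorphic in its exponents at the end points too, and gives the certificates the value 0
  there.\<close>

lemma beta_weight_endpoints [simp]: "beta_weight b d 0 = 0" "beta_weight b d 1 = 0"
  by (simp_all add: beta_weight_def)

text \<open>Powers of a base in [0, 1] decrease in the exponent, so lower bounds on the real parts
  give one majorant for all parameters near a point.\<close>

lemma norm_beta_weight_le:
  assumes "v \<in> {0..1}" "b0 \<le> Re b" "d0 \<le> Re d"
  shows "norm (beta_weight b d v) \<le> v powr (b0 - 1) * (1 - v) powr (d0 - 1)"
  unfolding norm_beta_weight[OF assms(1)]
  using assms by (intro mult_mono powr_mono') auto

lemma continuous_on_beta_weight: "continuous_on {0<..<1} (beta_weight b d)"
  unfolding beta_weight_def by (intro continuous_intros continuous_on_of_real_powr) auto

lemma holomorphic_on_beta_weight: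
  assumes "B holomorphic_on S" "D holomorphic_on S" "v \<in> {0..1}"
  shows "(\<lambda>s. beta_weight (B s) (D s) v) holomorphic_on S"
proof (cases "v = 0 \<or> v = 1")
  case False
  have "(\<lambda>s. exp ((B s - 1) * Ln (of_real v)) * exp ((D s - 1) * Ln (of_real (1 - v)))) holomorphic_on S"
    by (intro holomorphic_intros assms)
  then show ?thesis using False by (simp add: beta_weight_def powr_def)
qed auto

lemma dominated_family_beta_weight:
  assumes S: "open S" and B: "B holomorphic_on S" and D: "D holomorphic_on S"
    and pos: "\<And>s. s \<in> S \<Longrightarrow> Re (B s) > 0" "\<And>s. s \<in> S \<Longrightarrow> Re (D s) > 0"
    and cont: "continuous_on (S \<times> {0..1}) (\<lambda>(s, v). g s v)"
    and hol: "\<And>v. v \<in> {0..1} \<Longrightarrow> (\<lambda>s. g s v) holomorphic_on S"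
  shows "dominated_family (\<lambda>s v. beta_weight (B s) (D s) v * g s v) S {0..1}"
    (is "dominated_family ?f S _")
proof -
  have dom: "\<exists>r>0. \<exists>M. M integrable_on {0..1} \<and> cball s r \<subseteq> S \<and>
        (\<forall>t\<in>cball s r. \<forall>v\<in>{0..1}. norm (?f t v) \<le> M v)" if s: "s \<in> S" for s
  proof -
    \<comment> \<open>On T both real parts exceed half their value at s. The halves are still
      positive, so the beta density formed with them is an integrable majorant.\<close>
    define T where "T = (S \<inter> (\<lambda>t. Re (B t)) -` {Re (B s) / 2<..}) \<inter> (S \<inter> (\<lambda>t. Re (D t)) -` {Re (D s) / 2<..})"
    have "open T" unfolding T_def
      by (intro open_Int continuous_open_preimage S open_greaterThan continuous_intros
            holomorphic_on_imp_continuous_on B D)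
    moreover have "s \<in> T" using s pos[OF s] by (simp add: T_def)
    ultimately obtain r where r: "0 < r" "cball s r \<subseteq> T"
      using open_contains_cball by blast
    have TS: "cball s r \<subseteq> S" using r by (auto simp: T_def)
    have "compact ((\<lambda>(s, v). g s v) ` (cball s r \<times> {0..1}))"
      by (intro compact_continuous_image continuous_on_subset[OF cont] compact_Times) (use TS in auto)
    from compact_imp_bounded[OF this]
    obtain K where K': "\<forall>y\<in>(\<lambda>(s, v). g s v) ` (cball s r \<times> {0..1}). norm y \<le> K"
      unfolding bounded_iff ..
    have K: "norm (g t v) \<le> K" if "t \<in> cball s r" "v \<in> {0..1}" for t v
      using K'[rule_format, OF imageI[of "(t, v)"]] that by simp
    have K0: "0 \<le> K"
      by (rule order_trans[OF norm_ge_zero K[of s 0]]) (use r in auto)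
    let ?M = "\<lambda>v. v powr (Re (B s) / 2 - 1) * (1 - v) powr (Re (D s) / 2 - 1) * K"
    show ?thesis
    proof (intro exI conjI ballI)
      show "?M integrable_on {0..1}"
        using pos[OF s] by (intro integrable_on_mult_left integrable_Beta') auto
      fix t v assume t: "t \<in> cball s r" and v: "v \<in> {0..1::real}"
      show "norm (?f t v) \<le> ?M v"
        unfolding norm_mult
        using t r K[OF t v] K0 v by (intro mult_mono norm_beta_weight_le) (auto simp: T_def)
    qed (use r TS in auto)
  qed
  show ?thesis
    unfolding dominated_family_def
  proof (intro conjI ballI)
    show "(\<lambda>s. ?f s v) holomorphic_on S" if "v \<in> {0..1}" for v
      by (intro holomorphic_intros holomorphic_on_beta_weight B D hol that)
    fix s assume s: "s \<in> S"
    then obtain r M where M: "M integrable_on {0..1}" "0 < (r::real)"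
      "\<forall>t\<in>cball s r. \<forall>v\<in>{0..1}. norm (?f t v) \<le> M v"
      using dom by meson
    have "continuous_on {0..1} (g s)"
      using continuous_on_o_Pair[OF cont, of s] s by (simp add: o_def)
    then have "continuous_on {0<..<1} (?f s)"
      by (intro continuous_intros continuous_on_beta_weight) (auto elim: continuous_on_subset)
    then have "?f s absolutely_integrable_on {0..1}"
      by (rule absolutely_integrable_on_Icc_bound[OF _ M(1)]) (use M in auto)
    then show "?f s integrable_on {0..1}"
      by (rule set_lebesgue_integral_eq_integral(1))
  qed (use S dom in auto)
qed

lemma beta_weight_absolutely_integrable:
  assumes "Re b > 0" "Re d > 0" and cont: "continuous_on {0..1} g"
  shows "(\<lambda>v. beta_weight b d v * g v) absolutely_integrable_on {0..1}"
proof -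
  have "compact (g ` {0..1})"
    by (intro compact_continuous_image cont) auto
  from compact_imp_bounded[OF this]
  obtain K where "\<forall>y\<in>g ` {0..1}. norm y \<le> K"
    unfolding bounded_iff ..
  then have K: "norm (g v) \<le> K" if "v \<in> {0..1}" for v
    using that by blast
  show ?thesis
  proof (rule absolutely_integrable_on_Icc_bound)
    show "continuous_on {0<..<1} (\<lambda>v. beta_weight b d v * g v)"
      by (intro continuous_intros continuous_on_beta_weight continuous_on_subset[OF cont]) auto
    show "(\<lambda>v. v powr (Re b - 1) * (1 - v) powr (Re d - 1) * K) integrable_on {0..1}"
      using assms by (intro integrable_on_mult_left integrable_Beta') auto
    show "norm (beta_weight b d v * g v) \<le> v powr (Re b - 1) * (1 - v) powr (Re d - 1) * K"
      if "v \<in> {0<..<1}" for v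
      unfolding norm_mult using that K[of v] by (intro mult_mono norm_beta_weight_le) auto
  qed
qed

lemma islimpt_positive_reals: "(1::complex) islimpt (complex_of_real ` {0<..})"
  unfolding islimpt_approachable
proof (intro allI impI)
  fix e :: real assume "0 < e"
  show "\<exists>x'\<in>complex_of_real ` {0<..}. x' \<noteq> 1 \<and> dist x' 1 < e"
  proof (intro bexI conjI)
    show "complex_of_real (1 + e/2) \<in> complex_of_real ` {0<..}"
      using \<open>0 < e\<close> by (intro imageI) simp
    show "complex_of_real (1 + e/2) \<noteq> 1" "dist (complex_of_real (1 + e/2)) 1 < e"
      using \<open>0 < e\<close> by (simp_all add: dist_norm)
  qed
qed

lemma eq_on_half_plane:
  assumes "f holomorphic_on {s. Re s > 0}" "g holomorphic_on {s. Re s > 0}"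
    and eq: "\<And>x. x > 0 \<Longrightarrow> f (of_real x) = g (of_real x)" and w: "Re w > 0"
  shows "f w = g w"
proof -
  have "f w - g w = 0"
  proof (rule analytic_continuation[where f = "\<lambda>w. f w - g w"])
    show "(\<lambda>w. f w - g w) holomorphic_on {s. Re s > 0}" by (intro holomorphic_intros assms)
    show "connected {s. Re s > 0}" by (intro convex_connected convex_halfspace_Re_gt)
    show "open {s. Re s > 0}" by (rule open_halfspace_Re_gt)
  qed (use eq w islimpt_positive_reals in auto)
  then show ?thesis by simp
qed

text \<open>The real beta integral is continued in one argument at a time: in b while d is real, and
  afterwards in d for the given complex b.\<close>

theorem beta_weight_integral:
  assumes b: "Re b > 0" and d: "Re d > 0"
  shows "integral {0..1} (beta_weight b d) = Gamma b * Gamma d * rGamma (b + d)"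
proof -
  have pole: "s \<notin> \<int>\<^sub>\<le>\<^sub>0" if "Re s > 0" for s
    using that by (auto elim!: nonpos_Ints_cases)
  have fam1: "dominated_family (\<lambda>s v. beta_weight s d v * 1) {s. Re s > 0} {0..1}" if "Re d > 0" for d
    using that by (intro dominated_family_beta_weight holomorphic_intros open_halfspace_Re_gt) auto
  have fam2: "dominated_family (\<lambda>s v. beta_weight b s v * 1) {s. Re s > 0} {0..1}" if "Re b > 0" for b
    using that by (intro dominated_family_beta_weight holomorphic_intros open_halfspace_Re_gt) auto
  have real: "integral {0..1} (beta_weight (of_real x) (of_real y)) = Beta (of_real x) (of_real y)"
    if "x > 0" "y > 0" for x y
  proof -
    have "((\<lambda>t. complex_of_real (t powr (x - 1) * (1 - t) powr (y - 1))) has_integral of_real (Beta x y)) {0..1}"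
      using has_integral_linear[OF has_integral_Beta_real[OF that] bounded_linear_of_real]
      by (simp add: o_def)
    moreover have "complex_of_real (t powr (x - 1) * (1 - t) powr (y - 1)) = beta_weight (of_real x) (of_real y) t"
      if "t \<in> {0..1}" for t
      using that powr_of_real[of t "x - 1"] powr_of_real[of "1 - t" "y - 1"]
      by (simp add: beta_weight_def)
    ultimately have "(beta_weight (of_real x) (of_real y) has_integral of_real (Beta x y)) {0..1}"
      by (rule has_integral_eq[rotated])
    then show ?thesis by (simp add: Beta_complex_of_real integral_unique)
  qed
  have half: "integral {0..1} (beta_weight s (of_real y)) = Beta s (of_real y)" if "Re s > 0" "y > 0" for s y
  proof (rule eq_on_half_plane[where f = "\<lambda>s. integral {0..1} (beta_weight s (of_real y))"
        and g = "\<lambda>s. Beta s (of_real y)", OF _ _ _ \<open>Re s > 0\<close>])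
    show "(\<lambda>s. integral {0..1} (beta_weight s (of_real y))) holomorphic_on {s. Re s > 0}"
      using dominated_family_holomorphic[OF fam1[of "of_real y"]] that by simp
    show "(\<lambda>s. Beta s (of_real y)) holomorphic_on {s. Re s > 0}"
      unfolding Beta_altdef using pole that by (intro holomorphic_intros) auto
  qed (use real that in auto)
  have "integral {0..1} (beta_weight b d) = Beta b d"
  proof (rule eq_on_half_plane[where f = "\<lambda>s. integral {0..1} (beta_weight b s)" and g = "Beta b", OF _ _ _ d])
    show "(\<lambda>s. integral {0..1} (beta_weight b s)) holomorphic_on {s. Re s > 0}"
      using dominated_family_holomorphic[OF fam2[OF b]] by simp
    show "Beta b holomorphic_on {s. Re s > 0}"
      unfolding Beta_altdef[abs_def] using pole b by (intro holomorphic_intros) auto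
  qed (use b half in auto)
  then show ?thesis by (simp add: Beta_altdef)
qed

section \<open>The hypergeometric differential equation\<close>

definition hypergeo_op ::
    "complex \<Rightarrow> complex \<Rightarrow> complex \<Rightarrow> (complex \<Rightarrow> complex) \<Rightarrow> complex \<Rightarrow> complex" where
  "hypergeo_op a b c f x =
     x * (1 - x) * deriv (deriv f) x + (c - (a + b + 1) * x) * deriv f x + (- a * b) * f x"

text \<open>The coefficient of x^n in the equation is the recurrence (n + 1) (c + n) F_(n+1) = (a +
  n) (b + n) F_n. Without divisions, its solution makes sense for every c.\<close>

lemma hypergeo_fps_coeff:
  fixes F :: "complex fps"
  assumes ode: "fps_X * (1 - fps_X) * fps_deriv (fps_deriv F)
      + (fps_const c - fps_const (a + b + 1) * fps_X) * fps_deriv F + fps_const (- a * b) * F = 0"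
  shows "fps_nth F n * pochhammer c n * fact n = fps_nth F 0 * pochhammer a n * pochhammer b n"
proof (induction n)
  case (Suc n)
  have "fps_nth (fps_X * (1 - fps_X) * fps_deriv (fps_deriv F)
      + (fps_const c - fps_const (a + b + 1) * fps_X) * fps_deriv F + fps_const (- a * b) * F) n = 0"
    unfolding ode by simp
  then have "(1 + of_nat n) * (c + of_nat n) * fps_nth F (Suc n) = (a + of_nat n) * (b + of_nat n) * fps_nth F n"
    by (cases n; cases "n - 1")
       (simp_all add: algebra_simps fps_X_mult_nth fps_mult_nth_0 numeral_2_eq_2)
  then have step: "(of_nat (Suc n)) * (c + of_nat n) * fps_nth F (Suc n) = (a + of_nat n) * (b + of_nat n) * fps_nth F n"
    by simp
  have "fps_nth F (Suc n) * pochhammer c (Suc n) * fact (Suc n)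
      = (of_nat (Suc n)) * (c + of_nat n) * fps_nth F (Suc n) * (pochhammer c n * fact n)"
    by (simp only: pochhammer_Suc fact_Suc of_nat_mult mult_ac)
  also have "\<dots> = (a + of_nat n) * (b + of_nat n) * (fps_nth F n * pochhammer c n * fact n)"
    unfolding step by (simp only: mult_ac)
  finally show ?case unfolding Suc.IH by (simp add: pochhammer_Suc mult_ac)
qed simp

lemma hypergeo_ode_series:
  assumes r: "0 < r" and hol: "f holomorphic_on ball 0 r"
    and ode: "\<And>x. x \<in> ball 0 r \<Longrightarrow> hypergeo_op a b c f x = 0"
    and c: "c \<notin> \<int>\<^sub>\<le>\<^sub>0" and x: "x \<in> ball 0 r"
  shows "(\<lambda>n. f 0 * (pochhammer a n * pochhammer b n / (pochhammer c n * fact n)) * x ^ n) sums f x"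
proof -
  define F where "F = fps_expansion f 0"
  have F: "f has_fps_expansion F"
    unfolding F_def by (rule has_fps_expansion_fps_expansion[OF _ _ hol]) (use r in auto)
  have "(\<lambda>x. x * (1 - x) * deriv (deriv f) x + (c - (a + b + 1) * x) * deriv f x + (- a * b) * f x)
    has_fps_expansion (fps_X * (1 - fps_X) * fps_deriv (fps_deriv F)
      + (fps_const c - fps_const (a + b + 1) * fps_X) * fps_deriv F + fps_const (- a * b) * F)"
    by (intro fps_expansion_intros F)
  moreover have "(\<lambda>x. x * (1 - x) * deriv (deriv f) x + (c - (a + b + 1) * x) * deriv f x + (- a * b) * f x)
    has_fps_expansion 0"
    unfolding has_fps_expansion_0_iff
    using eventually_nhds_in_open[of "ball 0 r" 0] r ode
    by (auto simp: hypergeo_op_def elim!: eventually_mono)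
  ultimately have "fps_X * (1 - fps_X) * fps_deriv (fps_deriv F)
      + (fps_const c - fps_const (a + b + 1) * fps_X) * fps_deriv F + fps_const (- a * b) * F = 0"
    by (rule fps_expansion_unique_complex)
  from hypergeo_fps_coeff[OF this]
  have co: "fps_nth F n * pochhammer c n * fact n = fps_nth F 0 * pochhammer a n * pochhammer b n" for n .
  have pc: "pochhammer c n \<noteq> 0" for n
    using c by (auto simp: pochhammer_eq_0_iff)
  have "(deriv ^^ n) f 0 / fact n = f 0 * (pochhammer a n * pochhammer b n / (pochhammer c n * fact n))" for n
    using co[of n] pc[of n] by (simp add: F_def fps_expansion_def divide_simps)
  then show ?thesis
    using holomorphic_power_series[OF hol x] by simp
qed

text \<open>Each solution is its value at 0 times one fixed series. Cross-multiplication also covers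
  solutions that vanish at 0.\<close>

lemma hypergeo_ode_unique:
  assumes "0 < r" and "f holomorphic_on ball 0 r" and "g holomorphic_on ball 0 r"
    and "\<And>x. x \<in> ball 0 r \<Longrightarrow> hypergeo_op a b c f x = 0"
    and "\<And>x. x \<in> ball 0 r \<Longrightarrow> hypergeo_op a b c g x = 0"
    and "c \<notin> \<int>\<^sub>\<le>\<^sub>0" and "x \<in> ball 0 r"
  shows "g 0 * f x = f 0 * g x"
proof -
  define t where "t n = pochhammer a n * pochhammer b n / (pochhammer c n * fact n) * x ^ n" for n
  have "(\<lambda>n. g 0 * (f 0 * t n)) sums (g 0 * f x)"
    using hypergeo_ode_series[of r f a b c x] assms
    by (intro sums_mult) (simp add: t_def mult.assoc)
  moreover have "(\<lambda>n. f 0 * (g 0 * t n)) sums (f 0 * g x)"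
    using hypergeo_ode_series[of r g a b c x] assms
    by (intro sums_mult) (simp add: t_def mult.assoc)
  ultimately show ?thesis
    by (metis (no_types, lifting) mult.left_commute sums_unique2 sums_cong)
qed

lemma hypergeo_opI:
  assumes S: "open S" "x \<in> S"
    and d1: "\<And>y. y \<in> S \<Longrightarrow> (f has_field_derivative f1 y) (at y)"
    and d2: "(f1 has_field_derivative f2) (at x)"
  shows "hypergeo_op a b c f x = x * (1 - x) * f2 + (c - (a + b + 1) * x) * f1 x + (- a * b) * f x"
proof -
  have "deriv (deriv f) x = deriv f1 x"
    by (rule deriv_cong_ev)
       (use eventually_nhds_in_open[OF S] d1 in \<open>auto elim!: eventually_mono intro!: DERIV_imp_deriv\<close>)
  then show ?thesis
    using DERIV_imp_deriv[OF d2] DERIV_imp_deriv[OF d1[OF S(2)]] by (simp add: hypergeo_op_def)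
qed

definition slit_plane :: "complex set" where
  "slit_plane = - (of_real ` {1..})"

lemma slit_plane_iff: "x \<in> slit_plane \<longleftrightarrow> 1 - x \<notin> \<real>\<^sub>\<le>\<^sub>0"
  unfolding slit_plane_def Compl_iff
  by (auto simp: complex_nonpos_Reals_iff image_iff complex_eq_iff)

lemma open_slit_plane [simp]: "open slit_plane"
  unfolding slit_plane_def using closed_slot_right by blast

section \<open>Euler's integral\<close>

lemma continuous_on_cpowr:
  fixes f g :: "'a::topological_space \<Rightarrow> complex"
  assumes "continuous_on A f" "continuous_on A g" "\<And>x. x \<in> A \<Longrightarrow> f x \<notin> \<real>\<^sub>\<le>\<^sub>0"
  shows "continuous_on A (\<lambda>x. f x powr g x)"
proof -
  have nz: "f x \<noteq> 0" if "x \<in> A" for x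
    using assms(3)[OF that] by auto
  have "continuous_on A (\<lambda>x. exp (g x * Ln (f x)))"
    using assms by (intro continuous_intros) auto
  also have "?this \<longleftrightarrow> ?thesis"
    using nz by (intro continuous_on_cong) (auto simp: powr_def)
  finally show ?thesis .
qed

lemma holomorphic_on_cpowr:
  assumes "f holomorphic_on A" "g holomorphic_on A" "\<And>x. x \<in> A \<Longrightarrow> f x \<notin> \<real>\<^sub>\<le>\<^sub>0"
  shows "(\<lambda>x. f x powr g x) holomorphic_on A"
proof -
  have nz: "f x \<noteq> 0" if "x \<in> A" for x
    using assms(3)[OF that] by auto
  have "(\<lambda>x. exp (g x * Ln (f x))) holomorphic_on A"
    using assms by (intro holomorphic_intros) auto
  also have "?this \<longleftrightarrow> ?thesis"
    using nz by (intro holomorphic_cong) (auto simp: powr_def)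
  finally show ?thesis .
qed

lemma cpowr_plus_1:
  fixes y :: complex
  assumes "y \<noteq> 0"
  shows "y powr (s + 1) = y * y powr s"
  using assms by (simp add: powr_add)

lemma DERIV_cpowr:
  fixes s :: complex
  assumes "(f has_field_derivative f') (at x within A)" "f x \<notin> \<real>\<^sub>\<le>\<^sub>0"
  shows "((\<lambda>x. f x powr s) has_field_derivative s * f x powr (s - 1) * f') (at x within A)"
  using DERIV_chain2[OF has_field_derivative_powr[OF assms(2), of s] assms(1)] by simp

lemma has_vector_derivative_cpowr:
  fixes s :: complex
  assumes "(f has_vector_derivative f') (at x)" "f x \<notin> \<real>\<^sub>\<le>\<^sub>0"
  shows "((\<lambda>x. f x powr s) has_vector_derivative s * f x powr (s - 1) * f') (at x)"
  using field_vector_diff_chain_at[OF assms(1) has_field_derivative_powr[OF assms(2), of s]]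
  by (simp add: o_def mult_ac)

lemma continuous_on_beta_weight_Icc:
  assumes "Re b > 1" "Re d > 1"
  shows "continuous_on {0..1} (beta_weight b d)"
  unfolding beta_weight_def
  using assms by (intro continuous_intros continuous_on_powr_complex) auto

text \<open>Raising both parameters by one makes the derivative a polynomial multiple of the
  original weight, and the raised weight is continuous with value 0 at both ends when the real parts
  of b and d are positive. Certificates are built from it.\<close>

lemma has_vector_derivative_beta_weight:
  assumes v: "v \<in> {0<..<1}"
  shows "(beta_weight (b + 1) (d + 1) has_vector_derivative
     beta_weight b d v * (b * (1 - of_real v) - d * of_real v)) (at v)"
proof -
  have "((\<lambda>v. complex_of_real v powr b * complex_of_real (1 - v) powr d) has_vector_derivative
     (complex_of_real v powr b * (d * complex_of_real (1 - v) powr (d - 1) * of_real (-1))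
      + b * complex_of_real v powr (b - 1) * of_real 1 * complex_of_real (1 - v) powr d)) (at v)"
    using v by (intro has_vector_derivative_mult has_vector_derivative_cpowr has_vector_derivative_of_real
       derivative_eq_intros) (auto simp: complex_nonpos_Reals_iff)
  moreover have p: "complex_of_real v powr b = of_real v * complex_of_real v powr (b - 1)"
      "complex_of_real (1 - v) powr d = of_real (1 - v) * complex_of_real (1 - v) powr (d - 1)"
    using v cpowr_plus_1[of "of_real v" "b - 1"] cpowr_plus_1[of "of_real (1 - v)" "d - 1"] by auto
  moreover have "complex_of_real v powr b * (d * complex_of_real (1 - v) powr (d - 1) * of_real (-1))
      + b * complex_of_real v powr (b - 1) * of_real 1 * complex_of_real (1 - v) powr d
    = beta_weight b d v * (b * (1 - of_real v) - d * of_real v)"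
    unfolding p beta_weight_def by (simp add: algebra_simps)
  ultimately show ?thesis
    by (simp add: beta_weight_def[abs_def])
qed

lemma beta_weight_plus_1:
  assumes "v \<in> {0<..<1}"
  shows "beta_weight (b + 1) (d + 1) v = of_real v * (1 - of_real v) * beta_weight b d v"
  using assms cpowr_plus_1[of "of_real v" "b - 1"] cpowr_plus_1[of "of_real (1 - v)" "d - 1"]
  by (simp add: beta_weight_def)

lemma slit_plane_0 [simp]: "0 \<in> slit_plane"
  by (simp add: slit_plane_iff)

lemma ball_subset_slit_plane: "ball 0 1 \<subseteq> slit_plane"
  by (auto simp: slit_plane_iff complex_nonpos_Reals_iff) (smt (verit) abs_Re_le_cmod)

text \<open>If x t lies in [1, infinity) with 0 < t <= 1, then so does x. All continuations to the
  slit plane rest on this star shape about 0.\<close>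

lemma slit_plane_scale:
  assumes "x \<in> slit_plane" "t \<in> {0..1}"
  shows "x * of_real t \<in> slit_plane"
proof (cases "Im x = 0 \<and> t > 0")
  case True
  then have "Re x < 1" using assms by (auto simp: slit_plane_iff complex_nonpos_Reals_iff)
  then have "Re x * t < 1"
    using assms True by (smt (verit) mult_left_le_one_le mult_nonpos_nonneg mult_less_cancel_left_pos mult.commute atLeastAtMost_iff mult_left_less_imp_less mult_right_le_one_le)
  then show ?thesis by (auto simp: slit_plane_iff complex_nonpos_Reals_iff)
next
  case False
  then show ?thesis using assms by (auto simp: slit_plane_iff complex_nonpos_Reals_iff)
qed

lemma slit_plane_scale':
  assumes "x \<in> slit_plane" "t \<in> {0..1}"
  shows "1 - x * of_real t \<notin> \<real>\<^sub>\<le>\<^sub>0" "1 - x * of_real t \<noteq> 0"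
  using slit_plane_scale[OF assms] by (auto simp: slit_plane_iff)

lemma starlike_0_imp_connected:
  fixes S :: "complex set"
  assumes "\<And>x t. x \<in> S \<Longrightarrow> t \<in> {0..1} \<Longrightarrow> x * of_real t \<in> S"
  shows "connected S"
proof (cases "S = {}")
  case False
  then obtain x where "x \<in> S" by blast
  then have "0 \<in> S" using assms[of x 0] by simp
  have "starlike S"
    unfolding starlike_def
  proof (intro bexI ballI subsetI)
    fix x y assume "x \<in> S" "y \<in> closed_segment 0 x"
    then show "y \<in> S"
      using assms by (auto simp: in_segment scaleR_conv_of_real mult.commute)
  qed fact
  then show ?thesis by (rule starlike_imp_connected)
qed auto

lemma connected_slit_plane [simp]: "connected slit_plane"
  by (rule starlike_0_imp_connected) (rule slit_plane_scale)

lemma nonpos_Ints_Re_pos: "Re c > 0 \<Longrightarrow> c \<notin> \<int>\<^sub>\<le>\<^sub>0"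
  by (auto elim!: nonpos_Ints_cases)

text \<open>For Re b, Re d > 0 this is Gamma b Gamma d times the regularized hypergeometric function
  with third parameter c = b + d. The parameter d is kept in place of c because convergence is a
  condition on it.\<close>

definition euler_integral :: "complex \<Rightarrow> complex \<Rightarrow> complex \<Rightarrow> complex \<Rightarrow> complex" where
  "euler_integral a b d x =
     integral {0..1} (\<lambda>v. beta_weight b d v * (1 - x * of_real v) powr (- a))"

lemma continuous_on_euler_factor:
  assumes "\<And>s. s \<in> S \<Longrightarrow> X s \<in> slit_plane" and "continuous_on S X" and "continuous_on S A"
  shows "continuous_on (S \<times> {0..1}) (\<lambda>(s, v). (1 - X s * of_real v) powr (- A s))"
  unfolding split_def
  by (intro continuous_on_cpowr continuous_intros continuous_on_compose2[OF assms(2)]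
        continuous_on_compose2[OF assms(3)] slit_plane_scale') (use assms in auto)

lemma dominated_family_euler:
  assumes "open S" "A holomorphic_on S" "B holomorphic_on S" "D holomorphic_on S" "X holomorphic_on S"
    and "\<And>s. s \<in> S \<Longrightarrow> Re (B s) > 0" "\<And>s. s \<in> S \<Longrightarrow> Re (D s) > 0"
    and X: "\<And>s. s \<in> S \<Longrightarrow> X s \<in> slit_plane"
  shows "dominated_family
     (\<lambda>s v. beta_weight (B s) (D s) v * (1 - X s * of_real v) powr (- A s)) S {0..1}"
  by (intro dominated_family_beta_weight continuous_on_euler_factor holomorphic_on_imp_continuous_on
        holomorphic_on_cpowr holomorphic_intros slit_plane_scale' assms) auto

lemma holomorphic_on_euler_integral:
  assumes "open S" "A holomorphic_on S" "B holomorphic_on S" "D holomorphic_on S" "X holomorphic_on S"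
    and "\<And>s. s \<in> S \<Longrightarrow> Re (B s) > 0" "\<And>s. s \<in> S \<Longrightarrow> Re (D s) > 0"
    and "\<And>s. s \<in> S \<Longrightarrow> X s \<in> slit_plane"
  shows "(\<lambda>s. euler_integral (A s) (B s) (D s) (X s)) holomorphic_on S"
  unfolding euler_integral_def
  using dominated_family_holomorphic[OF dominated_family_euler[OF assms]] .

lemma euler_integral_0:
  assumes "Re b > 0" "Re d > 0"
  shows "euler_integral a b d 0 = Gamma b * Gamma d * rGamma (b + d)"
  using beta_weight_integral[OF assms] by (simp add: euler_integral_def)

lemma euler_integral_ode:
  assumes b: "Re b > 0" and d: "Re d > 0" and x: "x \<in> slit_plane"
  shows "hypergeo_op a b (b + d) (euler_integral a b d) x = 0"
proof -
  define f where "f x v = beta_weight b d v * (1 - x * of_real v) powr (- a)" for x v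
  define f1 where "f1 x v = beta_weight b d v * (a * of_real v * (1 - x * of_real v) powr (- a - 1))" for x v
  define f2 where "f2 v = beta_weight b d v * (a * of_real v * ((a + 1) * of_real v * (1 - x * of_real v) powr (- a - 2)))" for v
  \<comment> \<open>The classical certificate v^b (1 - v)^d (1 - x v)^(-a-1), up to the factor - a;
    its exponents b and d give the vanishing at the ends.\<close>
  define C where "C v = - a * (beta_weight (b + 1) (d + 1) v * (1 - x * of_real v) powr (- a - 1))" for v
  have fam: "dominated_family f slit_plane {0..1}"
    unfolding f_def by (rule dominated_family_euler) (use b d in \<open>auto intro: holomorphic_intros\<close>)
  have "x * (1 - x) * deriv (deriv (\<lambda>x. integral {0..1} (f x))) x
     + (b + d - (a + b + 1) * x) * deriv (\<lambda>x. integral {0..1} (f x)) x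
     + (- a * b) * integral {0..1} (f x) = 0"
  proof (rule integral_satisfies_ode[OF fam x, of f1 f2 C])
    show "((\<lambda>s. f s v) has_field_derivative f1 t v) (at t)" if "t \<in> slit_plane" "v \<in> {0<..<1}" for t v
    proof -
      have "1 - t * of_real v \<notin> \<real>\<^sub>\<le>\<^sub>0" using that by (intro slit_plane_scale') auto
      then show ?thesis
        unfolding f_def f1_def by (auto intro!: derivative_eq_intros DERIV_cpowr simp: algebra_simps)
    qed
    show "((\<lambda>s. f1 s v) has_field_derivative f2 v) (at x)" if "v \<in> {0<..<1}" for v
    proof -
      have "1 - x * of_real v \<notin> \<real>\<^sub>\<le>\<^sub>0" using that x by (intro slit_plane_scale') auto
      then show ?thesis
        unfolding f1_def f2_def by (auto intro!: derivative_eq_intros DERIV_cpowr simp: algebra_simps)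
    qed
    show "continuous_on {0..1} C"
      unfolding C_def using b d x
      by (intro continuous_intros continuous_on_beta_weight_Icc continuous_on_cpowr slit_plane_scale') auto
    show "C 0 = 0" "C 1 = 0" by (simp_all add: C_def)
    show "(C has_vector_derivative
       x * (1 - x) * f2 v + (b + d - (a + b + 1) * x) * f1 x v + (- a * b) * f x v) (at v)"
      if v: "v \<in> {0<..<1}" for v
    proof -
      define y where "y = 1 - x * of_real v"
      \<comment> \<open>All occurring powers of y are polynomial multiples of the lowest one, so the
        claim becomes a polynomial identity.\<close>
      define P where "P = y powr (- a - 2)"
      have y: "y \<notin> \<real>\<^sub>\<le>\<^sub>0" "y \<noteq> 0" using v x slit_plane_scale'[of x v] by (auto simp: y_def)
      have p1: "y powr (- a - 1) = y * P"
      proof -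
        have "- a - 2 + 1 = - a - 1" by algebra
        then show ?thesis
          using cpowr_plus_1[OF y(2), of "- a - 2"] by (simp only: P_def)
      qed
      have p0: "y powr (- a) = y * (y * P)"
        using cpowr_plus_1[OF y(2), of "- a - 1"] p1 by simp
      have dy: "((\<lambda>v. 1 - x * complex_of_real v) has_vector_derivative - x) (at v)"
        by (auto intro!: derivative_eq_intros has_vector_derivative_of_real)
      have "(C has_vector_derivative - a * (beta_weight (b + 1) (d + 1) v * ((- a - 1) * y powr (- a - 1 - 1) * (- x))
         + beta_weight b d v * (b * (1 - of_real v) - d * of_real v) * y powr (- a - 1))) (at v)"
        unfolding C_def[abs_def] y_def using y
        by (intro has_vector_derivative_mult_right has_vector_derivative_mult has_vector_derivative_beta_weight v
             has_vector_derivative_cpowr dy) (auto simp: y_def)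
      moreover note beta_weight_plus_1[OF v, of b d]
      moreover have "y powr (- a - 1 - 1) = P"
      proof -
        have "- a - 1 - 1 = - a - 2" by algebra
        then show ?thesis by (simp only: P_def)
      qed
      ultimately have "(C has_vector_derivative - a * (of_real v * (1 - of_real v) * beta_weight b d v * ((- a - 1) * P * (- x))
         + beta_weight b d v * (b * (1 - of_real v) - d * of_real v) * (y * P))) (at v)"
        by (simp only: p1)
      moreover have "- a * (of_real v * (1 - of_real v) * beta_weight b d v * ((- a - 1) * P * (- x))
         + beta_weight b d v * (b * (1 - of_real v) - d * of_real v) * (y * P))
         = x * (1 - x) * f2 v + (b + d - (a + b + 1) * x) * f1 x v + (- a * b) * f x v"
        unfolding f_def f1_def f2_def y_def[symmetric] p0 p1 P_def[symmetric]
        unfolding y_def by algebra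
      ultimately show ?thesis by simp
    qed
  qed
  then show ?thesis
    by (simp add: hypergeo_op_def euler_integral_def[abs_def] f_def[abs_def])
qed

text \<open>Instead of integrating a binomial series term by term, one reads the coefficients off
  the differential equation. The value at 0 is the beta integral, whose Gamma factors cancel against
  the two factors \<open>rGamma\<close>.\<close>

lemma euler_integral_series:
  assumes b: "Re b > 0" and d: "Re d > 0" and x: "norm x < 1"
  shows "(\<lambda>n. pochhammer a n * pochhammer b n * rGamma (b + d + of_nat n) * x ^ n / fact n)
     sums (rGamma b * rGamma d * euler_integral a b d x)"
proof -
  have c: "b + d \<notin> \<int>\<^sub>\<le>\<^sub>0" using b d by (intro nonpos_Ints_Re_pos) simp
  have hol: "euler_integral a b d holomorphic_on ball 0 1"
    by (rule holomorphic_on_euler_integral) (use b d ball_subset_slit_plane in \<open>auto intro: holomorphic_intros\<close>)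
  have "(\<lambda>n. rGamma b * rGamma d * (euler_integral a b d 0
      * (pochhammer a n * pochhammer b n / (pochhammer (b + d) n * fact n)) * x ^ n))
    sums (rGamma b * rGamma d * euler_integral a b d x)"
    using hol euler_integral_ode[OF b d] c x ball_subset_slit_plane
    by (intro sums_mult hypergeo_ode_series[of 1]) auto
  moreover have "rGamma b * rGamma d * (euler_integral a b d 0
      * (pochhammer a n * pochhammer b n / (pochhammer (b + d) n * fact n)) * x ^ n)
    = pochhammer a n * pochhammer b n * rGamma (b + d + of_nat n) * x ^ n / fact n" for n
  proof -
    have "pochhammer (b + d) n \<noteq> 0" using c by (auto simp: pochhammer_eq_0_iff)
    moreover have "rGamma b * Gamma b = 1" "rGamma d * Gamma d = 1"
      using b d nonpos_Ints_Re_pos by (auto simp: Gamma_def rGamma_eq_zero_iff)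
    moreover have "rGamma b * rGamma d * (Gamma b * Gamma d * q) = (rGamma b * Gamma b) * (rGamma d * Gamma d) * q" for q
      by (simp only: mult_ac)
    ultimately show ?thesis
      unfolding euler_integral_0[OF b d] pochhammer_rGamma[of "b + d" n]
      by (simp add: mult.assoc[symmetric])
  qed
  ultimately show ?thesis by simp
qed

section \<open>Analytic continuation of the hypergeometric function\<close>

text \<open>The recursion is \<open>F c = (c + x d/dx) (F (c + 1))\<close> for the regularized function \<open>F\<close>.\<close>

primrec hypergeo_cont :: "nat \<Rightarrow> complex \<Rightarrow> complex \<Rightarrow> complex \<Rightarrow> complex \<Rightarrow> complex" where
  "hypergeo_cont 0 a b c x = rGamma b * rGamma (c - b) * euler_integral a b (c - b) x"
| "hypergeo_cont (Suc n) a b c x =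
     c * hypergeo_cont n a b (c + 1) x + a * b * x * hypergeo_cont n (a + 1) (b + 1) (c + 2) x"

text \<open>Both recursive calls raise Re (c - b) by one and keep Re b positive: c + 2 - (b + 1) =
  (c - b) + 1. So n steps lead back to the region where Euler's integral converges.\<close>

lemma holomorphic_on_hypergeo_cont:
  assumes "open S" and "X holomorphic_on S" and "\<And>s. s \<in> S \<Longrightarrow> X s \<in> slit_plane"
    and "A holomorphic_on S" "B holomorphic_on S" "C holomorphic_on S"
    and "\<And>s. s \<in> S \<Longrightarrow> Re (B s) > 0" "\<And>s. s \<in> S \<Longrightarrow> Re (C s - B s) + real n > 0"
  shows "(\<lambda>s. hypergeo_cont n (A s) (B s) (C s) (X s)) holomorphic_on S"
  using assms(4-8)
proof (induction n arbitrary: A B C)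
  case 0
  have "(\<lambda>s. euler_integral (A s) (B s) (C s - B s) (X s)) holomorphic_on S"
    by (rule holomorphic_on_euler_integral) (use assms(1-3) 0 in \<open>auto intro!: holomorphic_intros\<close>)
  then show ?case using 0 by (auto intro!: holomorphic_intros)
next
  case (Suc n)
  have "(\<lambda>s. hypergeo_cont n (A s) (B s) (C s + 1) (X s)) holomorphic_on S"
    by (rule Suc.IH) (use Suc.prems in \<open>force intro!: holomorphic_intros\<close>)+
  moreover have "(\<lambda>s. hypergeo_cont n (A s + 1) (B s + 1) (C s + 2) (X s)) holomorphic_on S"
    by (rule Suc.IH) (use Suc.prems in \<open>force intro!: holomorphic_intros\<close>)+
  ultimately show ?case
    using Suc.prems assms(2) by (auto intro!: holomorphic_intros)
qed

definition hypergeo_term :: "complex \<Rightarrow> complex \<Rightarrow> complex \<Rightarrow> complex \<Rightarrow> nat \<Rightarrow> complex" where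
  "hypergeo_term a b c x n =
     pochhammer a n * pochhammer b n * rGamma (c + of_nat n) * x ^ n / fact n"

lemma hypergeo_cont_sums:
  assumes "norm x < 1" and "Re b > 0" and "Re (c - b) + real n > 0"
  shows "hypergeo_term a b c x sums hypergeo_cont n a b c x"
  using assms(2,3)
proof (induction n arbitrary: a b c)
  case 0
  then show ?case
    using euler_integral_series[of b "c - b" x a] assms(1) by (simp add: hypergeo_term_def[abs_def])
next
  case (Suc n)
  have 1: "hypergeo_term a b (c + 1) x sums hypergeo_cont n a b (c + 1) x"
    by (rule Suc.IH) (use Suc.prems in auto)
  have 2: "hypergeo_term (a + 1) (b + 1) (c + 2) x sums hypergeo_cont n (a + 1) (b + 1) (c + 2) x"
    by (rule Suc.IH) (use Suc.prems in auto)
  \<comment> \<open>The terms of x d/dx F (c + 1). The factor m removes the term with index 0, and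
    the shifted series has the parameters a + 1, b + 1, c + 2.\<close>
  define s where "s m = of_nat m * hypergeo_term a b (c + 1) x m" for m
  have "s (Suc m) = a * b * x * hypergeo_term (a + 1) (b + 1) (c + 2) x m" for m
    unfolding s_def hypergeo_term_def using of_nat_neq_0[of m, where ?'a = complex]
    by (simp add: pochhammer_rec divide_simps add_ac)
  then have "(\<lambda>m. s (Suc m)) sums (a * b * x * hypergeo_cont n (a + 1) (b + 1) (c + 2) x)"
    using sums_mult[OF 2, of "a * b * x"] by simp
  then have "s sums (a * b * x * hypergeo_cont n (a + 1) (b + 1) (c + 2) x)"
    unfolding sums_Suc_iff by (simp add: s_def)
  from sums_add[OF sums_mult[OF 1, of c] this]
  have "(\<lambda>m. c * hypergeo_term a b (c + 1) x m + s m) sums hypergeo_cont (Suc n) a b c x"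
    by simp
  \<comment> \<open>(c + m) rGamma (c + m + 1) = rGamma (c + m) holds at the poles of Gamma as
    well.\<close>
  moreover have "c * hypergeo_term a b (c + 1) x m + s m = hypergeo_term a b c x m" for m
    using rGamma_plus1[of "c + of_nat m"]
    by (simp add: s_def hypergeo_term_def add_ac flip: distrib_right add_divide_distrib)
  ultimately show ?case by simp
qed

text \<open>Resolves the definite description: a holomorphic function on the connected slit plane is
  determined by its series on the unit disc.\<close>

lemma hypergeo_reg_eqI:
  assumes hol: "f holomorphic_on slit_plane"
    and ser: "\<And>x. norm x < 1 \<Longrightarrow> hypergeo_term a b c x sums f x"
    and z: "z \<in> slit_plane"
  shows "hypergeo_reg a b c z = f z"
proof -
  have f: "\<forall>x. norm x < 1 \<longrightarrow> f x = (\<Sum>n. hypergeo_term a b c x n)"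
    using ser by (auto simp: sums_iff)
  show ?thesis
    unfolding hypergeo_reg_def slit_plane_def[symmetric] hypergeo_term_def[symmetric]
  proof (rule the_equality)
    show "\<exists>g. g holomorphic_on slit_plane \<and> (\<forall>x. norm x < 1 \<longrightarrow> g x = (\<Sum>n. hypergeo_term a b c x n)) \<and> f z = g z"
      using hol f by blast
    fix w assume "\<exists>g. g holomorphic_on slit_plane \<and> (\<forall>x. norm x < 1 \<longrightarrow> g x = (\<Sum>n. hypergeo_term a b c x n)) \<and> w = g z"
    then obtain g where g: "g holomorphic_on slit_plane"
      "\<forall>x. norm x < 1 \<longrightarrow> g x = (\<Sum>n. hypergeo_term a b c x n)" "w = g z" by blast
    have "g z = f z"
      by (rule analytic_continuation_open[where s = "ball 0 1" and s' = slit_plane])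
         (use g f hol z ball_subset_slit_plane in auto)
    then show "w = f z" using g by simp
  qed
qed

lemma hypergeo_reg_eq_cont:
  assumes "Re b > 0" and "Re (c - b) + real n > 0" and "x \<in> slit_plane"
  shows "hypergeo_reg a b c x = hypergeo_cont n a b c x"
  by (rule hypergeo_reg_eqI) (use assms in \<open>auto intro!: hypergeo_cont_sums holomorphic_on_hypergeo_cont holomorphic_intros\<close>)

text \<open>The number of recursion steps depends on c - b and may be unbounded on S, but one number
  works near each point. With all four arguments as functions of s, one statement serves every
  variable of the claim.\<close>

lemma holomorphic_on_hypergeo_reg:
  assumes S: "open S" and X: "X holomorphic_on S" "\<And>s. s \<in> S \<Longrightarrow> X s \<in> slit_plane"
    and hol: "A holomorphic_on S" "B holomorphic_on S" "C holomorphic_on S"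
    and B: "\<And>s. s \<in> S \<Longrightarrow> Re (B s) > 0"
  shows "(\<lambda>s. hypergeo_reg (A s) (B s) (C s) (X s)) holomorphic_on S"
  unfolding holomorphic_on_def
proof
  fix s assume s: "s \<in> S"
  obtain n where n: "- Re (C s - B s) < real n" using reals_Archimedean2 by blast
  define T where "T = S \<inter> (\<lambda>s. Re (C s - B s)) -` {- real n<..}"
  have T: "open T" "s \<in> T" "T \<subseteq> S"
    unfolding T_def using s n
    by (auto intro!: continuous_open_preimage S continuous_intros holomorphic_on_imp_continuous_on hol)
  have "(\<lambda>s. hypergeo_cont n (A s) (B s) (C s) (X s)) holomorphic_on T"
    by (rule holomorphic_on_hypergeo_cont)
       (use T X B hol in \<open>auto intro: holomorphic_on_subset simp: T_def\<close>)
  also have "?this \<longleftrightarrow> (\<lambda>s. hypergeo_reg (A s) (B s) (C s) (X s)) holomorphic_on T"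
    by (rule holomorphic_cong) (use T X B in \<open>auto simp: T_def intro!: hypergeo_reg_eq_cont[symmetric]\<close>)
  finally show "(\<lambda>s. hypergeo_reg (A s) (B s) (C s) (X s)) field_differentiable at s within S"
    using T holomorphic_on_imp_differentiable_at field_differentiable_at_within by blast
qed

section \<open>Holomorphy of the Gegenbauer function in parameters and argument\<close>

lemma cut_plane_iff: "z \<in> cut_plane \<longleftrightarrow> z - 1 \<notin> \<real>\<^sub>\<le>\<^sub>0"
  unfolding cut_plane_def Compl_iff
  by (auto simp: complex_nonpos_Reals_iff image_iff complex_eq_iff)

lemma open_cut_plane [simp]: "open cut_plane"
  unfolding cut_plane_def using closed_slot_left by blast

lemma cut_plane_imp_slit_plane: "z \<in> cut_plane \<Longrightarrow> (1 - z) / 2 \<in> slit_plane"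
  by (auto simp: cut_plane_iff slit_plane_iff complex_nonpos_Reals_iff)

text \<open>Re (lambda + 2 alpha) > 0 acts twice: it keeps Gamma (2 alpha + lambda) off its poles,
  and it is the condition Re b > 0 of Euler's integral.\<close>

lemma holomorphic_on_gegenbauer:
  assumes "open S" and hol: "L holomorphic_on S" "A holomorphic_on S" "Z holomorphic_on S"
    and pos: "\<And>s. s \<in> S \<Longrightarrow> Re (L s + 2 * A s) > 0" and "\<And>s. s \<in> S \<Longrightarrow> Z s \<in> cut_plane"
  shows "(\<lambda>s. gegenbauer (L s) (A s) (Z s)) holomorphic_on S"
proof -
  have nz: "2 * A s + L s \<notin> \<int>\<^sub>\<le>\<^sub>0" if "s \<in> S" for s
    using pos[OF that] by (intro nonpos_Ints_Re_pos) (simp add: add.commute)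
  have "(\<lambda>s. hypergeo_reg (- L s) (2 * A s + L s) (A s + 1/2) ((1 - Z s) / 2)) holomorphic_on S"
    by (rule holomorphic_on_hypergeo_reg)
       (use assms cut_plane_imp_slit_plane in \<open>auto intro!: holomorphic_intros simp: add.commute\<close>)
  moreover have "(\<lambda>s. 2 powr (2 * A s - 1)) holomorphic_on S"
    by (intro holomorphic_on_cpowr holomorphic_intros hol) auto
  ultimately show ?thesis
    unfolding gegenbauer_def using hol nz by (auto intro!: holomorphic_intros)
qed

text \<open>The function g p = (1 - p)^(-b) F (- p / (1 - p)) solves the hypergeometric equation
  with parameters c - a, b, c and agrees with the right-hand integral at 0. The map p to - p / (1 -
  p) preserves the slit plane because 1 - Y p = 1 / (1 - p).\<close>

lemma euler_integral_pfaff: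
  assumes b: "Re b > 0" and d: "Re d > 0" and p: "p \<in> slit_plane"
  shows "euler_integral a b d (- p / (1 - p)) = (1 - p) powr b * euler_integral (b + d - a) b d p"
proof -
  define F where "F = euler_integral a b d"
  define c where "c = b + d"
  define Y where "Y p = - p / (1 - p)" for p :: complex
  have c: "c \<notin> \<int>\<^sub>\<le>\<^sub>0" using b d by (intro nonpos_Ints_Re_pos) (simp add: c_def)
  have ne: "1 - p \<noteq> 0" "1 - p \<notin> \<real>\<^sub>\<le>\<^sub>0" if "p \<in> slit_plane" for p
    using that by (auto simp: slit_plane_iff)
  have Y: "Y p \<in> slit_plane" if "p \<in> slit_plane" for p
  proof -
    have "1 - Y p = inverse (1 - p)" using ne[OF that] by (simp add: Y_def field_simps)
    then show ?thesis using ne[OF that] by (simp add: slit_plane_iff)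
  qed
  have dY: "(Y has_field_derivative - 1 / (1 - p)^2) (at p)" if "p \<in> slit_plane" for p
    unfolding Y_def[abs_def] using ne[OF that]
    by (auto intro!: derivative_eq_intros simp: power2_eq_square divide_simps)
  have holF: "F holomorphic_on slit_plane"
    unfolding F_def by (rule holomorphic_on_euler_integral) (use b d in \<open>auto intro: holomorphic_intros\<close>)
  have dF: "(F has_field_derivative deriv F y) (at y)" if "y \<in> slit_plane" for y
    using holF that holomorphic_derivI by auto
  have ddF: "(deriv F has_field_derivative deriv (deriv F) y) (at y)" if "y \<in> slit_plane" for y
    using holomorphic_deriv[OF holF] that holomorphic_derivI by auto
  define g where "g p = (1 - p) powr (- b) * F (Y p)" for p
  define g1 where "g1 p = b * (1 - p) powr (- b - 1) * F (Y p) - (1 - p) powr (- b - 2) * deriv F (Y p)" for p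
  define g2 where "g2 p = b * (b + 1) * (1 - p) powr (- b - 2) * F (Y p)
     - (2 * b + 2) * (1 - p) powr (- b - 3) * deriv F (Y p) + (1 - p) powr (- b - 4) * deriv (deriv F) (Y p)" for p
  \<comment> \<open>Expressing all powers through the lowest exponent, - b - 4, turns the
    verification of the equation into polynomial algebra.\<close>
  have pw: "q powr (- b) = q^4 * q powr (- b - 4)" "q powr (- b - 1) = q^3 * q powr (- b - 4)"
    "q powr (- b - 2) = q^2 * q powr (- b - 4)" "q powr (- b - 3) = q * q powr (- b - 4)"
    if "q \<noteq> 0" for q :: complex
  proof -
    have e: "q powr (s + of_nat n) = q powr s * q ^ n" for s n
      using that by (simp add: powr_add powr_nat)
    have s: "- b - 4 + of_nat 4 = - b" "- b - 4 + of_nat 3 = - b - 1" "- b - 4 + of_nat 2 = - b - 2"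
      "- b - 4 + of_nat 1 = - b - 3"
      by simp_all
    show "q powr (- b) = q^4 * q powr (- b - 4)" "q powr (- b - 1) = q^3 * q powr (- b - 4)"
      "q powr (- b - 2) = q^2 * q powr (- b - 4)" "q powr (- b - 3) = q * q powr (- b - 4)"
      using e[of "- b - 4" 4] e[of "- b - 4" 3] e[of "- b - 4" 2] e[of "- b - 4" 1]
      unfolding s by (simp_all only: mult.commute power_one_right)
  qed
  have d1: "(g has_field_derivative g1 p) (at p)" if "p \<in> slit_plane" for p
  proof -
    have "((\<lambda>p. F (Y p)) has_field_derivative deriv F (Y p) * (- 1 / (1 - p)^2)) (at p)"
      using DERIV_chain2[OF dF[OF Y[OF that]] dY[OF that]] .
    moreover have "((\<lambda>p. (1 - p) powr (- b)) has_field_derivative (- b) * (1 - p) powr (- b - 1) * (0 - 1)) (at p)"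
      using ne[OF that] by (intro DERIV_cpowr derivative_intros)
    ultimately have "(g has_field_derivative ((- b) * (1 - p) powr (- b - 1) * (0 - 1) * F (Y p) +
       deriv F (Y p) * (- 1 / (1 - p)^2) * (1 - p) powr (- b))) (at p)"
      unfolding g_def[abs_def] by (intro DERIV_mult)
    moreover have "(- b) * (1 - p) powr (- b - 1) * (0 - 1) * F (Y p) +
       deriv F (Y p) * (- 1 / (1 - p)^2) * (1 - p) powr (- b) = g1 p"
      unfolding g1_def pw[OF ne(1)[OF that]] using ne[OF that] by (simp add: field_simps)
    ultimately show ?thesis by simp
  qed
  have d2: "(g1 has_field_derivative g2 p) (at p)" if "p \<in> slit_plane" for p
  proof -
    have "((\<lambda>p. F (Y p)) has_field_derivative deriv F (Y p) * (- 1 / (1 - p)^2)) (at p)"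
      using DERIV_chain2[OF dF[OF Y[OF that]] dY[OF that]] .
    moreover have "((\<lambda>p. deriv F (Y p)) has_field_derivative deriv (deriv F) (Y p) * (- 1 / (1 - p)^2)) (at p)"
      using DERIV_chain2[OF ddF[OF Y[OF that]] dY[OF that]] .
    moreover have "((\<lambda>p. (1 - p) powr s) has_field_derivative s * (1 - p) powr (s - 1) * (0 - 1)) (at p)" for s
      using ne[OF that] by (intro DERIV_cpowr derivative_intros)
    ultimately have "(g1 has_field_derivative
      (b * ((- b - 1) * (1 - p) powr (- b - 1 - 1) * (0 - 1)) * F (Y p) +
        deriv F (Y p) * (- 1 / (1 - p)^2) * (b * (1 - p) powr (- b - 1)))
      - ((- b - 2) * (1 - p) powr (- b - 2 - 1) * (0 - 1) * deriv F (Y p) +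
        deriv (deriv F) (Y p) * (- 1 / (1 - p)^2) * (1 - p) powr (- b - 2))) (at p)"
      unfolding g1_def[abs_def] by (intro DERIV_mult DERIV_diff DERIV_cmult)
    moreover have e: "- b - 1 - 1 = - b - 2" "- b - 2 - 1 = - b - 3" by algebra+
    moreover have "(b * ((- b - 1) * (1 - p) powr (- b - 2) * (0 - 1)) * F (Y p) +
        deriv F (Y p) * (- 1 / (1 - p)^2) * (b * (1 - p) powr (- b - 1)))
      - ((- b - 2) * (1 - p) powr (- b - 3) * (0 - 1) * deriv F (Y p) +
        deriv (deriv F) (Y p) * (- 1 / (1 - p)^2) * (1 - p) powr (- b - 2)) = g2 p"
      unfolding g2_def pw[OF ne(1)[OF that]] using ne[OF that]
      by (simp add: power2_eq_square power3_eq_cube divide_simps) (simp add: algebra_simps)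
    ultimately show ?thesis by simp
  qed
  have ode: "hypergeo_op (c - a) b c g p = 0" if p: "p \<in> slit_plane" for p
  proof -
    have "hypergeo_op a b c F (Y p) = 0"
      unfolding F_def c_def by (intro euler_integral_ode b d Y p)
    \<comment> \<open>The equation for F at Y p, multiplied by (1 - p)^2 to clear
      denominators.\<close>
    then have E: "(- p * deriv (deriv F) (Y p) + (c * (1 - p)^2 + (a + b + 1) * p * (1 - p)) * deriv F (Y p)
       - a * b * (1 - p)^2 * F (Y p)) = 0"
      unfolding hypergeo_op_def using ne[OF p]
      by (simp add: Y_def power2_eq_square divide_simps) algebra
    have "hypergeo_op (c - a) b c g p
        = p * (1 - p) * g2 p + (c - (c - a + b + 1) * p) * g1 p + (- (c - a) * b) * g p"
      by (rule hypergeo_opI[OF open_slit_plane p d1 d2[OF p]])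
    also have "\<dots> = 0"
      unfolding g_def g1_def g2_def pw[OF ne(1)[OF p]]
      using E by algebra
    finally show ?thesis .
  qed
  define G where "G = euler_integral (c - a) b d"
  have holG: "G holomorphic_on slit_plane"
    unfolding G_def by (rule holomorphic_on_euler_integral) (use b d in \<open>auto intro: holomorphic_intros\<close>)
  have holg: "g holomorphic_on slit_plane"
    using d1 by (auto simp: holomorphic_on_open)
  have Gode: "hypergeo_op (c - a) b c G x = 0" if "x \<in> slit_plane" for x
    unfolding G_def c_def by (intro euler_integral_ode b d that)
  have G0: "G 0 = g 0" "G 0 \<noteq> 0"
    using b d c nonpos_Ints_Re_pos
    by (auto simp: G_def g_def F_def Y_def euler_integral_0 Gamma_eq_zero_iff rGamma_eq_zero_iff c_def)
  have "g p = G p"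
  proof (rule analytic_continuation_open[where f = g and g = G and s = "ball 0 1" and s' = slit_plane])
    fix x :: complex assume "x \<in> ball 0 1"
    then have "G 0 * g x = g 0 * G x"
      using ball_subset_slit_plane ode Gode c holg holG
      by (intro hypergeo_ode_unique[of 1 _ _ "c - a" b c]) (auto intro: holomorphic_on_subset)
    then show "g x = G x" using G0 by simp
  qed (use holg holG p ball_subset_slit_plane in auto)
  then have "(1 - p) powr b * ((1 - p) powr (- b) * F (Y p)) = (1 - p) powr b * G p"
    by (simp add: g_def)
  moreover have "(1 - p) powr b * (1 - p) powr (- b) = 1"
    using ne[OF p] by (simp add: powr_minus)
  ultimately show ?thesis
    by (simp add: F_def G_def Y_def c_def mult.assoc[symmetric])
qed

section \<open>The product integral\<close>

text \<open>Derivatives in logarithmic form: for a product of powers they become the product times a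
  sum of fractions, so the powers themselves drop out of the later algebra.\<close>

lemma DERIV_cpowr_log:
  fixes s :: complex
  assumes "(f has_field_derivative f') (at x)" "f x \<notin> \<real>\<^sub>\<le>\<^sub>0"
  shows "((\<lambda>x. f x powr s) has_field_derivative f x powr s * (s * f' / f x)) (at x)"
proof -
  have "f x \<noteq> 0" using assms(2) by auto
  then have "f x powr s = f x * f x powr (s - 1)"
    using cpowr_plus_1[of "f x" "s - 1"] by simp
  then show ?thesis
    using DERIV_cpowr[OF assms, of s] \<open>f x \<noteq> 0\<close> by (simp add: mult_ac)
qed

lemma DERIV_mult_log:
  fixes f g :: "complex \<Rightarrow> complex"
  assumes "(f has_field_derivative f x * a) (at x)" "(g has_field_derivative g x * b) (at x)"
  shows "((\<lambda>x. f x * g x) has_field_derivative f x * g x * (a + b)) (at x)"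
  using DERIV_mult[OF assms] by (simp add: algebra_simps)

text \<open>Here t stands for r v. For the kernel W, k \<alpha> is the logarithmic derivative in p
  and \<alpha>' the p-derivative of \<alpha>; k \<epsilon> is v times the logarithmic derivative in
  v; m is the rational factor of the certificate and m' is v times its v-derivative. The three
  identities are what is left of the certificate once k, b and the hypergeometric factor Q are
  separated off.\<close>

lemma kernel_identities:
  fixes p v t :: complex
  defines "y1 \<equiv> 1 - p * v" and "y2 \<equiv> 1 - p * t" and "y3 \<equiv> 1 - p * t * v"
  defines "\<alpha> \<equiv> v / y1 + t / y2 - 2 * t * v / y3"
  defines "\<alpha>' \<equiv> v\<^sup>2 / y1\<^sup>2 + t\<^sup>2 / y2\<^sup>2 - 2 * t\<^sup>2 * v\<^sup>2 / y3\<^sup>2"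
  defines "m \<equiv> 1 / y1 - (1 - p) * t / (y3 * y2)"
  defines "m' \<equiv> p * v / y1\<^sup>2 - (1 - p) * t / (y3 * y2)
      - (1 - p) * t * (2 * p * t * v / (y3\<^sup>2 * y2) + p * t / (y3 * y2\<^sup>2))"
  defines "\<epsilon> \<equiv> p * v / y1 + t / (1 - t) + p * t / y2 - 4 * p * t * v / y3"
  assumes ne: "y1 \<noteq> 0" "y2 \<noteq> 0" "y3 \<noteq> 0" "1 - t \<noteq> 0"
  shows "(1 - p) * \<alpha> + (1 - v) * m = (1 - t * v) / y3"
    and "p * (1 - p) * \<alpha>\<^sup>2 - (1 + p) * \<alpha> = - (v * m + (1 - v) * (\<epsilon> * m))"
    and "p * (1 - p) * \<alpha>' + (1 - p) * \<alpha> = v * m - (1 - v) * m'"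
proof -
  \<comment> \<open>In this form m shows a factor 1 - t, which cancels the pole of \<epsilon> at t =
    1. Splitting off that term leaves only the denominators y1, y2, y3.\<close>
  have m: "m = (1 - t) * (1 - p\<^sup>2 * t * v) / (y1 * y2 * y3)"
    unfolding m_def using ne by (simp add: divide_simps) (simp add: y1_def y2_def y3_def, algebra)
  have tm: "t / (1 - t) * m = t * (1 - p\<^sup>2 * t * v) / (y1 * y2 * y3)"
    unfolding m using ne(4) by simp
  have em: "\<epsilon> * m = (p * v / y1 + p * t / y2 - 4 * p * t * v / y3) * m
      + t * (1 - p\<^sup>2 * t * v) / (y1 * y2 * y3)"
    unfolding \<epsilon>_def tm[symmetric] by (simp only: distrib_right left_diff_distrib) simp
  show "(1 - p) * \<alpha> + (1 - v) * m = (1 - t * v) / y3"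
    unfolding \<alpha>_def m_def using ne by (simp add: divide_simps) (simp add: y1_def y2_def y3_def, algebra)
  show "p * (1 - p) * \<alpha>\<^sup>2 - (1 + p) * \<alpha> = - (v * m + (1 - v) * (\<epsilon> * m))"
    unfolding em unfolding m \<alpha>_def using ne
    by (simp add: power2_eq_square divide_simps) (simp add: y1_def y2_def y3_def, algebra)
  show "p * (1 - p) * \<alpha>' + (1 - p) * \<alpha> = v * m - (1 - v) * m'"
    unfolding \<alpha>_def \<alpha>'_def m_def m'_def using ne
    by (simp add: power2_eq_square divide_simps) (simp add: y1_def y2_def y3_def, algebra)
qed

text \<open>The equation of Q at the argument p c eliminates \<open>Q2\<close>. The remaining terms
  are grouped by k^2 Q, k Q, k b Q and c Q1: the second identity of the kernel settles the first
  group, the third settles the second, and the first settles the last two.\<close>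

lemma certificate_identity:
  fixes p c v k b \<alpha> \<alpha>' m m' \<epsilon> i Q Q1 Q2 :: complex
  assumes "i * (1 - p * c) = 1"
    and "(1 - p) * \<alpha> + (1 - v) * m = (1 - c) * i"
    and "p * (1 - p) * \<alpha>\<^sup>2 - (1 + p) * \<alpha> = - (v * m + (1 - v) * \<epsilon>)"
    and "p * (1 - p) * \<alpha>' + (1 - p) * \<alpha> = v * m - (1 - v) * m'"
    and "p * c * (1 - p * c) * Q2 + (b + (1 - k) - (k + b + 1) * (p * c)) * Q1 - k * b * Q = 0"
  shows "p * (1 - p) * ((k\<^sup>2 * \<alpha>\<^sup>2 + k * \<alpha>') * Q + 2 * k * \<alpha> * c * Q1 + c\<^sup>2 * Q2)
     + (b + (1 - k) - (k + b + 1) * p) * (k * \<alpha> * Q + c * Q1) + (- k * b) * Q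
   = - k * ((b * (1 - v) - (1 - k) * v) * Q * m + (1 - v) * (k * \<epsilon> * Q + 2 * c * p * Q1 * m + Q * m'))"
proof -
  have Q2: "p * c * Q2 = i * (k * b * Q - (b + (1 - k) - (k + b + 1) * (p * c)) * Q1)"
    using assms(1,5) by algebra
  have "p * (1 - p) * ((k\<^sup>2 * \<alpha>\<^sup>2 + k * \<alpha>') * Q + 2 * k * \<alpha> * c * Q1 + c\<^sup>2 * Q2)
     + (b + (1 - k) - (k + b + 1) * p) * (k * \<alpha> * Q + c * Q1) + (- k * b) * Q
   = k\<^sup>2 * Q * (p * (1 - p) * \<alpha>\<^sup>2 - (1 + p) * \<alpha>) + k * Q * (p * (1 - p) * \<alpha>' + (1 - p) * \<alpha>)
     + k * b * Q * ((1 - p) * \<alpha> - 1)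
     + c * Q1 * (2 * k * p * (1 - p) * \<alpha> + (b + (1 - k) - (k + b + 1) * p)) + (1 - p) * c * (p * c * Q2)"
    by (simp add: algebra_simps power2_eq_square)
  also have "\<dots> = k\<^sup>2 * Q * (- (v * m + (1 - v) * \<epsilon>)) + k * Q * (v * m - (1 - v) * m')
     + k * b * Q * ((1 - c) * i - (1 - v) * m - 1 + (1 - p) * c * i)
     + c * Q1 * (2 * k * p * ((1 - c) * i - (1 - v) * m) + (b + (1 - k) - (k + b + 1) * p)
         - (1 - p) * i * (b + (1 - k) - (k + b + 1) * (p * c)))"
    unfolding Q2 assms(3,4) using assms(2) by algebra
  also have "(1 - c) * i - (1 - v) * m - 1 + (1 - p) * c * i = - (1 - v) * m"
    using assms(1) by algebra
  also have "2 * k * p * ((1 - c) * i - (1 - v) * m) + (b + (1 - k) - (k + b + 1) * p)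
         - (1 - p) * i * (b + (1 - k) - (k + b + 1) * (p * c)) = - 2 * k * p * (1 - v) * m"
    using assms(1) by algebra
  finally show ?thesis by (simp add: algebra_simps power2_eq_square)
qed

text \<open>The regular part of the powers in the transformed integrand; the factors that are
  singular at the end points, s^(b-1) and (1-s)^(-k), form
  \<open>beta_weight b (1 - k)\<close>.\<close>

definition product_kernel :: "complex \<Rightarrow> complex \<Rightarrow> complex \<Rightarrow> complex \<Rightarrow> complex" where
  "product_kernel k p r v =
     (1 - p * v) powr (- k) * (1 - r * v) powr (- k) * (1 - p * r * v) powr (- k)
     * (1 - p * r * v\<^sup>2) powr (2 * k)"

definition product_integral :: "complex \<Rightarrow> complex \<Rightarrow> complex \<Rightarrow> complex \<Rightarrow> complex" where
  "product_integral k b p r = integral {0..1} (\<lambda>v. beta_weight b (1 - k) v *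
     (product_kernel k p r (of_real v) * euler_integral k b (1 - k) (p * r * (of_real v)\<^sup>2)))"

lemma slit_plane_scale_square:
  assumes "x \<in> slit_plane" "t \<in> {0..1::real}"
  shows "x * (of_real t)\<^sup>2 \<in> slit_plane"
  using slit_plane_scale[OF assms(1), of "t\<^sup>2"] assms(2) by (simp add: power_le_one)

lemma holomorphic_on_euler_integral':
  assumes "Re b > 0" "Re k < 1"
  shows "euler_integral k b (1 - k) holomorphic_on slit_plane"
  by (rule holomorphic_on_euler_integral) (use assms in \<open>auto intro: holomorphic_intros\<close>)

text \<open>Three slit conditions control four bases: 1 - p r s^2 arises by scaling p r with s^2,
  which lies in [0, 1] as well. The same condition admits the argument of the Euler
  integral.\<close>

lemma dominated_family_product:
  assumes S: "open S" and hol: "P holomorphic_on S" "R holomorphic_on S"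
    and mem: "\<And>s. s \<in> S \<Longrightarrow> P s \<in> slit_plane" "\<And>s. s \<in> S \<Longrightarrow> R s \<in> slit_plane"
      "\<And>s. s \<in> S \<Longrightarrow> P s * R s \<in> slit_plane"
    and b: "Re b > 0" and k: "Re k < 1"
  shows "dominated_family (\<lambda>s v. beta_weight b (1 - k) v * (product_kernel k (P s) (R s) (of_real v)
     * euler_integral k b (1 - k) (P s * R s * (of_real v)\<^sup>2))) S {0..1}"
proof (rule dominated_family_beta_weight[OF S])
  have nonpos: "1 - P s * of_real v \<notin> \<real>\<^sub>\<le>\<^sub>0" "1 - R s * of_real v \<notin> \<real>\<^sub>\<le>\<^sub>0"
    "1 - P s * R s * of_real v \<notin> \<real>\<^sub>\<le>\<^sub>0" "1 - P s * R s * (of_real v)\<^sup>2 \<notin> \<real>\<^sub>\<le>\<^sub>0"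
    if "s \<in> S" "v \<in> {0..1}" for s v
    using slit_plane_scale[OF mem(1)[OF that(1)] that(2)] slit_plane_scale[OF mem(2)[OF that(1)] that(2)]
      slit_plane_scale[OF mem(3)[OF that(1)] that(2)] slit_plane_scale_square[OF mem(3)[OF that(1)] that(2)]
    by (simp_all add: slit_plane_iff)
  note hE = holomorphic_on_euler_integral'[OF b k]
  note cont = hol[THEN holomorphic_on_imp_continuous_on]
  have cP: "continuous_on (S \<times> {0..1::real}) (\<lambda>x. P (fst x))" "continuous_on (S \<times> {0..1::real}) (\<lambda>x. R (fst x))"
    by (intro continuous_on_compose2[OF cont(1)] continuous_on_compose2[OF cont(2)] continuous_intros; auto)+
  have "continuous_on (S \<times> {0..1}) (\<lambda>x. euler_integral k b (1 - k) (P (fst x) * R (fst x) * (of_real (snd x))\<^sup>2))"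
  proof (rule continuous_on_compose2[OF holomorphic_on_imp_continuous_on[OF hE]])
    show "continuous_on (S \<times> {0..1}) (\<lambda>x. P (fst x) * R (fst x) * (complex_of_real (snd x))\<^sup>2)"
      by (intro continuous_intros cP)
    show "(\<lambda>x. P (fst x) * R (fst x) * (complex_of_real (snd x))\<^sup>2) ` (S \<times> {0..1}) \<subseteq> slit_plane"
      using slit_plane_scale_square[OF mem(3)] by auto
  qed
  moreover have "continuous_on (S \<times> {0..1}) (\<lambda>x. (1 - P (fst x) * of_real (snd x)) powr (- k))"
    "continuous_on (S \<times> {0..1}) (\<lambda>x. (1 - R (fst x) * of_real (snd x)) powr (- k))"
    "continuous_on (S \<times> {0..1}) (\<lambda>x. (1 - P (fst x) * R (fst x) * of_real (snd x)) powr (- k))"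
    "continuous_on (S \<times> {0..1}) (\<lambda>x. (1 - P (fst x) * R (fst x) * (of_real (snd x))\<^sup>2) powr (2 * k))"
    by (rule continuous_on_cpowr, intro continuous_intros cP, rule continuous_on_const,
        rule nonpos, force, force)+
  ultimately show "continuous_on (S \<times> {0..1}) (\<lambda>(s, v). product_kernel k (P s) (R s) (of_real v)
     * euler_integral k b (1 - k) (P s * R s * (of_real v)\<^sup>2))"
    unfolding product_kernel_def split_def by (intro continuous_on_mult)
  fix v :: real assume v: "v \<in> {0..1}"
  have "(euler_integral k b (1 - k) \<circ> (\<lambda>s. P s * R s * (of_real v)\<^sup>2)) holomorphic_on S"
  proof (rule holomorphic_on_compose_gen[OF _ hE])
    show "(\<lambda>s. P s * R s * (of_real v)\<^sup>2) holomorphic_on S"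
      by (intro holomorphic_intros hol)
    show "(\<lambda>s. P s * R s * (of_real v)\<^sup>2) ` S \<subseteq> slit_plane"
      using slit_plane_scale_square[OF mem(3) v] by blast
  qed
  then show "(\<lambda>s. product_kernel k (P s) (R s) (of_real v)
     * euler_integral k b (1 - k) (P s * R s * (of_real v)\<^sup>2)) holomorphic_on S"
    unfolding product_kernel_def o_def
    by (intro holomorphic_on_mult holomorphic_on_cpowr holomorphic_on_diff holomorphic_on_const hol nonpos v)
qed (use b k in auto)

lemma product_integral_commute: "product_integral k b p r = product_integral k b r p"
  by (simp add: product_integral_def product_kernel_def mult_ac)

text \<open>In the unit disc p, r and p r lie in the slit plane at once, so the family is dominated;
  a neighbourhood of the origin is all that identification by power series asks for.\<close>

lemma product_integral_ode:
  assumes b: "Re b > 0" and k: "Re k < 1" and r: "norm r < 1" and p: "norm p < 1"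
  shows "hypergeo_op k b (b + (1 - k)) (\<lambda>p. product_integral k b p r) p = 0"
proof -
  define Q where "Q = euler_integral k b (1 - k)"
  define S where "S = ball (0::complex) 1"
  have holQ: "Q holomorphic_on slit_plane"
    unfolding Q_def by (rule holomorphic_on_euler_integral'[OF b k])
  have dQ: "(Q has_field_derivative deriv Q y) (at y)" if "y \<in> slit_plane" for y
    using holQ that holomorphic_derivI by auto
  have ddQ: "(deriv Q has_field_derivative deriv (deriv Q) y) (at y)" if "y \<in> slit_plane" for y
    using holomorphic_deriv[OF holQ] that holomorphic_derivI by auto
  have mem: "x \<in> slit_plane" "x * r \<in> slit_plane" if "x \<in> S" for x
  proof -
    show "x \<in> slit_plane" using that ball_subset_slit_plane by (auto simp: S_def)
    have "norm (x * r) < 1 * 1"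
      unfolding norm_mult using that r by (intro mult_strict_mono') (auto simp: S_def)
    then show "x * r \<in> slit_plane" using ball_subset_slit_plane by auto
  qed
  have rS: "r \<in> slit_plane" using r ball_subset_slit_plane by auto
  have pS: "p \<in> S" using p by (simp add: S_def)
  have nonpos: "1 - x * of_real v \<notin> \<real>\<^sub>\<le>\<^sub>0" "1 - r * of_real v \<notin> \<real>\<^sub>\<le>\<^sub>0"
    "1 - x * r * of_real v \<notin> \<real>\<^sub>\<le>\<^sub>0" "1 - x * r * (of_real v)\<^sup>2 \<notin> \<real>\<^sub>\<le>\<^sub>0"
    if "x \<in> S" "v \<in> {0..1}" for x v
    using slit_plane_scale[OF mem(1)[OF that(1)] that(2)] slit_plane_scale[OF rS that(2)]
      slit_plane_scale[OF mem(2)[OF that(1)] that(2)] slit_plane_scale_square[OF mem(2)[OF that(1)] that(2)]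
    by (simp_all add: slit_plane_iff)
  define \<alpha> where "\<alpha> x V = V / (1 - x * V) + r * V / (1 - x * r * V) - 2 * r * V\<^sup>2 / (1 - x * r * V\<^sup>2)" for x V
  define \<alpha>' where "\<alpha>' x V = V\<^sup>2 / (1 - x * V)\<^sup>2 + (r * V)\<^sup>2 / (1 - x * r * V)\<^sup>2
     - 2 * (r * V\<^sup>2)\<^sup>2 / (1 - x * r * V\<^sup>2)\<^sup>2" for x V
  define f where "f x v = beta_weight b (1 - k) v * (product_kernel k x r (of_real v) * Q (x * r * (of_real v)\<^sup>2))" for x v
  define f1 where "f1 x v = beta_weight b (1 - k) v * (product_kernel k x r (of_real v) *
     (k * \<alpha> x (of_real v) * Q (x * r * (of_real v)\<^sup>2)
      + r * (of_real v)\<^sup>2 * deriv Q (x * r * (of_real v)\<^sup>2)))" for x v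
  define f2 where "f2 v = beta_weight b (1 - k) v * (product_kernel k p r (of_real v) *
     ((k\<^sup>2 * (\<alpha> p (of_real v))\<^sup>2 + k * \<alpha>' p (of_real v)) * Q (p * r * (of_real v)\<^sup>2)
      + 2 * k * \<alpha> p (of_real v) * (r * (of_real v)\<^sup>2) * deriv Q (p * r * (of_real v)\<^sup>2)
      + (r * (of_real v)\<^sup>2)\<^sup>2 * deriv (deriv Q) (p * r * (of_real v)\<^sup>2)))" for v
  define m where "m V = 1 / (1 - p * V) - (1 - p) * (r * V) / ((1 - p * r * V\<^sup>2) * (1 - p * r * V))" for V
  define H where "H V = product_kernel k p r V * (Q (p * r * V\<^sup>2) * m V)" for V
  \<comment> \<open>In the variable \<open>x = - ln p / 2\<close> the kernel has the same image under the operators in \<open>x\<^sub>1\<close> and in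
    \<open>x\<^sub>3\<close>; integrating by parts in \<open>x\<^sub>3\<close>, and accounting for the limit of integration that moves with
    \<open>x\<^sub>1\<close>, yields this certificate.\<close>
  define C where "C v = - k * (beta_weight (b + 1) (1 - k + 1) v * H (of_real v))" for v
  have fam: "dominated_family f S {0..1}"
    unfolding f_def Q_def using mem rS b k
    by (intro dominated_family_product) (auto simp: S_def intro: holomorphic_intros)
  have dW: "((\<lambda>x. product_kernel k x r (of_real v)) has_field_derivative
      product_kernel k x r (of_real v) * (k * \<alpha> x (of_real v))) (at x)" if "x \<in> S" "v \<in> {0..1}" for x v
  proof -
    have "((\<lambda>x. product_kernel k x r (of_real v)) has_field_derivative
      product_kernel k x r (of_real v) * (- k * (0 - 1 * of_real v) / (1 - x * of_real v)
       + - k * 0 / (1 - r * of_real v)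
       + - k * (0 - 1 * r * of_real v) / (1 - x * r * of_real v)
       + 2 * k * (0 - 1 * r * (of_real v)\<^sup>2) / (1 - x * r * (of_real v)\<^sup>2))) (at x)"
      unfolding product_kernel_def
      by (intro DERIV_mult_log DERIV_cpowr_log nonpos[OF that]) (auto intro!: derivative_eq_intros)
    moreover have "- k * (0 - 1 * of_real v) / (1 - x * of_real v)
       + - k * 0 / (1 - r * of_real v)
       + - k * (0 - 1 * r * of_real v) / (1 - x * r * of_real v)
       + 2 * k * (0 - 1 * r * (of_real v)\<^sup>2) / (1 - x * r * (of_real v)\<^sup>2) = k * \<alpha> x (of_real v)"
      by (simp add: \<alpha>_def algebra_simps)
    ultimately show ?thesis by simp
  qed
  have dq: "((\<lambda>x. x * r * (of_real v)\<^sup>2) has_field_derivative r * (of_real v)\<^sup>2) (at x)" for x v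
    by (auto intro!: derivative_eq_intros)
  have qS: "x * r * (of_real v)\<^sup>2 \<in> slit_plane" if "x \<in> S" "v \<in> {0..1::real}" for x v
    using slit_plane_scale_square mem(2) that by blast
  note dQx = DERIV_chain2[OF dQ[OF qS] dq]
  note ddQx = DERIV_chain2[OF ddQ[OF qS] dq]
  have d\<alpha>: "((\<lambda>x. \<alpha> x (of_real v)) has_field_derivative \<alpha>' x (of_real v)) (at x)"
    if "x \<in> S" "v \<in> {0..1}" for x v
  proof -
    have "1 - x * of_real v \<noteq> 0" "1 - x * r * of_real v \<noteq> 0" "1 - x * r * (of_real v)\<^sup>2 \<noteq> 0"
      using nonpos[OF that] by auto
    then show ?thesis
      unfolding \<alpha>_def \<alpha>'_def
      by (auto intro!: derivative_eq_intros simp: power2_eq_square)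
  qed
  have "p * (1 - p) * deriv (deriv (\<lambda>x. integral {0..1} (f x))) p
     + (b + (1 - k) - (k + b + 1) * p) * deriv (\<lambda>x. integral {0..1} (f x)) p
     + (- k * b) * integral {0..1} (f p) = 0"
  proof (rule integral_satisfies_ode[OF fam pS, of f1 f2 C])
    show "((\<lambda>x. f x v) has_field_derivative f1 x v) (at x)" if "x \<in> S" "v \<in> {0<..<1}" for x v
    proof -
      have v: "v \<in> {0..1}" using that by simp
      show ?thesis
        unfolding f_def f1_def
        by (rule DERIV_cong[OF DERIV_cmult[OF DERIV_mult[OF dW[OF that(1) v] dQx[OF that(1) v]]]])
           (simp add: algebra_simps)
    qed
    show "((\<lambda>x. f1 x v) has_field_derivative f2 v) (at p)" if "v \<in> {0<..<1}" for v
    proof -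
      have v: "v \<in> {0..1}" using that by simp
      show ?thesis
        unfolding f1_def f2_def
        by (rule DERIV_cong[OF DERIV_cmult[OF DERIV_mult[OF dW[OF pS v]
              DERIV_add[OF DERIV_mult[OF DERIV_cmult[OF d\<alpha>[OF pS v]] dQx[OF pS v]] DERIV_cmult[OF ddQx[OF pS v]]]]]])
           (simp add: algebra_simps power2_eq_square)
    qed
    have contQ: "continuous_on {0..1} (\<lambda>v. Q (p * r * (complex_of_real v)\<^sup>2))"
    proof (rule continuous_on_compose2[OF holomorphic_on_imp_continuous_on[OF holQ]])
      show "continuous_on {0..1} (\<lambda>v. p * r * (complex_of_real v)\<^sup>2)"
        by (intro continuous_intros)
      show "(\<lambda>v. p * r * (complex_of_real v)\<^sup>2) ` {0..1} \<subseteq> slit_plane"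
        using qS[OF pS] by blast
    qed
    have nz: "1 - p * of_real v \<noteq> 0" "1 - r * of_real v \<noteq> 0" "1 - p * r * of_real v \<noteq> 0"
        "1 - p * r * (of_real v)\<^sup>2 \<noteq> 0" if "v \<in> {0..1}" for v
      using nonpos[OF pS that] by auto
    show "continuous_on {0..1} C"
    proof -
      have "continuous_on {0..1} (\<lambda>v. product_kernel k p r (complex_of_real v))"
        unfolding product_kernel_def
        by (intro continuous_on_mult continuous_on_cpowr continuous_on_const nonpos[OF pS])
           (auto intro!: continuous_intros)
      moreover have "continuous_on {0..1} (\<lambda>v. m (complex_of_real v))"
        unfolding m_def by (intro continuous_intros) (auto dest: nz)
      moreover have "continuous_on {0..1} (beta_weight (b + 1) (1 - k + 1))"
        using b k by (intro continuous_on_beta_weight_Icc) auto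
      ultimately show ?thesis
        unfolding C_def H_def by (intro continuous_on_mult continuous_on_const contQ)
    qed
    show "C 0 = 0" "C 1 = 0" by (simp_all add: C_def)
    show "(C has_vector_derivative
       p * (1 - p) * f2 v + (b + (1 - k) - (k + b + 1) * p) * f1 p v + (- k * b) * f p v) (at v)"
      if v: "v \<in> {0<..<1}" for v
    proof -
      have v': "v \<in> {0..1}" using v by simp
      define V where "V = complex_of_real v"
      define W where "W = product_kernel k p r V"
      define t where "t = r * V"
      define c where "c = r * V\<^sup>2"
      \<comment> \<open>k \<epsilon> and m' are the images under V d/dV of the logarithm of the
        kernel and of m. This normalization makes both depend on r and V only through t = r V and
        V.\<close>
      define \<epsilon> where "\<epsilon> = p * V / (1 - p * V) + t / (1 - t) + p * t / (1 - p * t) - 4 * p * t * V / (1 - p * t * V)"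
      define m' where "m' = p * V / (1 - p * V)\<^sup>2 - (1 - p) * t / ((1 - p * t * V) * (1 - p * t))
        - (1 - p) * t * (2 * p * t * V / ((1 - p * t * V)\<^sup>2 * (1 - p * t)) + p * t / ((1 - p * t * V) * (1 - p * t)\<^sup>2))"
      have V0: "V \<noteq> 0" using v by (simp add: V_def)
      note np = nonpos[OF pS v', folded V_def]
      note ne = nz[OF v', folded V_def]
      have ptV: "p * r * V\<^sup>2 = p * t * V" "p * r * V = p * t" "r * V = t" "c = t * V" "r * V\<^sup>2 = t * V"
         "p * (t * V) = p * t * V"
        by (simp_all add: t_def c_def power2_eq_square mult_ac)
      have dWV: "((\<lambda>V. product_kernel k p r V) has_field_derivative W * (k * \<epsilon> / V)) (at V)"
      proof -
        have "((\<lambda>V. product_kernel k p r V) has_field_derivative W * (- k * (- p) / (1 - p * V)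
           + - k * (- r) / (1 - r * V) + - k * (- (p * r)) / (1 - p * r * V)
           + 2 * k * (- (2 * p * r * V)) / (1 - p * r * V\<^sup>2))) (at V)"
          unfolding W_def product_kernel_def
          by (intro DERIV_mult_log DERIV_cpowr_log np) (auto intro!: derivative_eq_intros)
        moreover have "- k * (- p) / (1 - p * V)
           + - k * (- r) / (1 - r * V) + - k * (- (p * r)) / (1 - p * r * V)
           + 2 * k * (- (2 * p * r * V)) / (1 - p * r * V\<^sup>2) = k * \<epsilon> / V"
        proof -
          have "- k * (- p) / y1 + - k * (- r) / y0 + - k * (- (p * r)) / y2 + 2 * k * (- (2 * p * r * V)) / y3
            = k * (p * V / y1 + t / y0 + p * t / y2 - 4 * p * t * V / y3) / V"
            if "y1 \<noteq> 0" "y0 \<noteq> 0" "y2 \<noteq> 0" "y3 \<noteq> 0" for y1 y0 y2 y3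
            unfolding t_def using V0 that by (simp add: divide_simps) (simp add: algebra_simps)
          from this[OF ne] show ?thesis unfolding \<epsilon>_def ptV .
        qed
        ultimately show ?thesis by simp
      qed
      have dm: "(m has_field_derivative m' / V) (at V)"
      proof -
        have "(m has_field_derivative (p / (1 - p * V)\<^sup>2 - (1 - p) *
           (r / ((1 - p * r * V\<^sup>2) * (1 - p * r * V))
            + r * V * (2 * p * r * V / ((1 - p * r * V\<^sup>2)\<^sup>2 * (1 - p * r * V))
               + p * r / ((1 - p * r * V\<^sup>2) * (1 - p * r * V)\<^sup>2))))) (at V)"
        proof -
          have i: "((\<lambda>V. 1 / (1 - p * V)) has_field_derivative p / (1 - p * V)\<^sup>2) (at V)"
            "((\<lambda>V. 1 / (1 - p * r * V)) has_field_derivative p * r / (1 - p * r * V)\<^sup>2) (at V)"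
            "((\<lambda>V. 1 / (1 - p * r * V\<^sup>2)) has_field_derivative 2 * p * r * V / (1 - p * r * V\<^sup>2)\<^sup>2) (at V)"
            using ne by (auto intro!: derivative_eq_intros simp: power2_eq_square)
          have l: "((\<lambda>V. (1 - p) * (r * V)) has_field_derivative (1 - p) * r) (at V)"
            by (auto intro!: derivative_eq_intros)
          have m: "m = (\<lambda>V. 1 / (1 - p * V) - (1 - p) * (r * V) * (1 / (1 - p * r * V\<^sup>2) * (1 / (1 - p * r * V))))"
            by (simp add: m_def fun_eq_iff)
          have eq: "A - ((1 - p) * r * (1 / y3 * (1 / y2)) + (D3 / y3\<^sup>2 * (1 / y2) + D2 / y2\<^sup>2 * (1 / y3)) * ((1 - p) * (r * V)))
            = A - (1 - p) * (r / (y3 * y2) + r * V * (D3 / (y3\<^sup>2 * y2) + D2 / (y3 * y2\<^sup>2)))"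
            for A D2 D3 y2 y3 :: complex
            by (simp add: algebra_simps)
          show ?thesis
            unfolding m by (rule DERIV_cong[OF DERIV_diff[OF i(1) DERIV_mult[OF l DERIV_mult[OF i(3,2)]]] eq])
        qed
        moreover have "p / (1 - p * V)\<^sup>2 - (1 - p) *
           (r / ((1 - p * r * V\<^sup>2) * (1 - p * r * V))
            + r * V * (2 * p * r * V / ((1 - p * r * V\<^sup>2)\<^sup>2 * (1 - p * r * V))
               + p * r / ((1 - p * r * V\<^sup>2) * (1 - p * r * V)\<^sup>2))) = m' / V"
        proof -
          have "p / y1\<^sup>2 - (1 - p) * (r / (y3 * y2) + r * V * (2 * p * r * V / (y3\<^sup>2 * y2) + p * r / (y3 * y2\<^sup>2)))
            = (p * V / y1\<^sup>2 - (1 - p) * t / (y3 * y2)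
               - (1 - p) * t * (2 * p * t * V / (y3\<^sup>2 * y2) + p * t / (y3 * y2\<^sup>2))) / V"
            if "y1 \<noteq> 0" "y2 \<noteq> 0" "y3 \<noteq> 0" for y1 y2 y3
            unfolding t_def using V0 that by (simp add: divide_simps) (simp add: algebra_simps power2_eq_square)
          from this[OF ne(1,3,4)] show ?thesis unfolding m'_def ptV .
        qed
        ultimately show ?thesis by simp
      qed
      have dqV: "((\<lambda>V. p * r * V\<^sup>2) has_field_derivative 2 * p * r * V) (at V)"
        by (auto intro!: derivative_eq_intros)
      have qV: "p * r * V\<^sup>2 \<in> slit_plane" using qS[OF pS v'] by (simp add: V_def)
      define Q0 Q1 Q2 where "Q0 = Q (p * r * V\<^sup>2)" and "Q1 = deriv Q (p * r * V\<^sup>2)"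
        and "Q2 = deriv (deriv Q) (p * r * V\<^sup>2)"
      have dH: "(H has_field_derivative W * (k * \<epsilon> * Q0 * m V + 2 * c * p * Q1 * m V + Q0 * m') / V) (at V)"
        unfolding H_def[abs_def]
        by (rule DERIV_cong[OF DERIV_mult[OF dWV DERIV_mult[OF DERIV_chain2[OF dQ[OF qV] dqV] dm]]])
           (use V0 in \<open>simp add: W_def[symmetric] Q0_def[symmetric] Q1_def[symmetric] c_def divide_simps\<close>,
            simp add: algebra_simps power2_eq_square)
      have "((\<lambda>v. H (of_real v)) has_vector_derivative
         W * (k * \<epsilon> * Q0 * m V + 2 * c * p * Q1 * m V + Q0 * m') / V) (at v)"
        using has_vector_derivative_real_field[of H _ v] dH by (simp add: V_def)
      from has_vector_derivative_mult_right[OF has_vector_derivative_mult[OF has_vector_derivative_beta_weight[OF v] this], of "- k" b "1 - k"]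
      have "(C has_vector_derivative - k * (beta_weight (b + 1) (1 - k + 1) v *
           (W * (k * \<epsilon> * Q0 * m V + 2 * c * p * Q1 * m V + Q0 * m') / V)
         + beta_weight b (1 - k) v * (b * (1 - V) - (1 - k) * V) * (W * (Q0 * m V)))) (at v)"
        unfolding C_def[abs_def] V_def[symmetric] by (simp add: H_def W_def Q0_def V_def)
      \<comment> \<open>The raised weight contributes V (1 - V); its V absorbs the 1 / V coming from
        the V d/dV normalization.\<close>
      moreover have "- k * (beta_weight (b + 1) (1 - k + 1) v *
           (W * (k * \<epsilon> * Q0 * m V + 2 * c * p * Q1 * m V + Q0 * m') / V)
         + beta_weight b (1 - k) v * (b * (1 - V) - (1 - k) * V) * (W * (Q0 * m V)))
        = beta_weight b (1 - k) v * W * (- k * ((b * (1 - V) - (1 - k) * V) * Q0 * m V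
           + (1 - V) * (k * (\<epsilon> * m V) * Q0 + 2 * c * p * Q1 * m V + Q0 * m')))"
        unfolding beta_weight_plus_1[OF v, of b "1 - k"] V_def[symmetric] using V0
        by (simp add: divide_simps) (simp add: algebra_simps)
      moreover have "- k * ((b * (1 - V) - (1 - k) * V) * Q0 * m V
           + (1 - V) * (k * (\<epsilon> * m V) * Q0 + 2 * c * p * Q1 * m V + Q0 * m'))
        = p * (1 - p) * ((k\<^sup>2 * (\<alpha> p V)\<^sup>2 + k * \<alpha>' p V) * Q0 + 2 * k * \<alpha> p V * c * Q1 + c\<^sup>2 * Q2)
     + (b + (1 - k) - (k + b + 1) * p) * (k * \<alpha> p V * Q0 + c * Q1) + (- k * b) * Q0"
      proof -
        note ne' = ne[unfolded ptV]
        have a: "\<alpha> p V = V / (1 - p * V) + t / (1 - p * t) - 2 * t * V / (1 - p * t * V)"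
          "\<alpha>' p V = V\<^sup>2 / (1 - p * V)\<^sup>2 + t\<^sup>2 / (1 - p * t)\<^sup>2 - 2 * t\<^sup>2 * V\<^sup>2 / (1 - p * t * V)\<^sup>2"
          "m V = 1 / (1 - p * V) - (1 - p) * t / ((1 - p * t * V) * (1 - p * t))"
          unfolding \<alpha>_def \<alpha>'_def m_def ptV by (simp_all add: power_mult_distrib power2_eq_square mult_ac t_def)
        note ki = kernel_identities[OF ne'(1,3,4,2), folded a \<epsilon>_def m'_def]
        have "hypergeo_op k b (b + (1 - k)) Q (p * t * V) = 0"
          unfolding Q_def using qV b k by (intro euler_integral_ode) (simp_all add: ptV)
        then have ode: "p * c * (1 - p * c) * Q2 + (b + (1 - k) - (k + b + 1) * (p * c)) * Q1 - k * b * Q0 = 0"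
          by (simp add: hypergeo_op_def Q0_def Q1_def Q2_def ptV)
        show ?thesis
          by (rule certificate_identity[symmetric, OF _ _ ki(2,3) ode, where i = "1 / (1 - p * t * V)"])
             (use ki(1) ne'(4) in \<open>simp_all add: ptV(4,6)\<close>)
      qed
      ultimately have "(C has_vector_derivative beta_weight b (1 - k) v * W *
         (p * (1 - p) * ((k\<^sup>2 * (\<alpha> p V)\<^sup>2 + k * \<alpha>' p V) * Q0 + 2 * k * \<alpha> p V * c * Q1 + c\<^sup>2 * Q2)
          + (b + (1 - k) - (k + b + 1) * p) * (k * \<alpha> p V * Q0 + c * Q1) + (- k * b) * Q0)) (at v)"
        by (simp only:)
      moreover have "beta_weight b (1 - k) v * W *
         (p * (1 - p) * ((k\<^sup>2 * (\<alpha> p V)\<^sup>2 + k * \<alpha>' p V) * Q0 + 2 * k * \<alpha> p V * c * Q1 + c\<^sup>2 * Q2)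
          + (b + (1 - k) - (k + b + 1) * p) * (k * \<alpha> p V * Q0 + c * Q1) + (- k * b) * Q0)
        = p * (1 - p) * f2 v + (b + (1 - k) - (k + b + 1) * p) * f1 p v + (- k * b) * f p v"
        unfolding f2_def f1_def f_def V_def[symmetric] W_def[symmetric] Q0_def[symmetric] Q1_def[symmetric]
          Q2_def[symmetric] c_def[symmetric]
        by algebra
      ultimately show ?thesis by (simp only:)
    qed
  qed
  then show ?thesis
    unfolding hypergeo_op_def product_integral_def[abs_def] f_def[abs_def] Q_def .
qed

lemma euler_integral_0_nonzero:
  assumes "Re b > 0" "Re d > 0"
  shows "euler_integral a b d 0 \<noteq> 0"
proof -
  have "b \<notin> \<int>\<^sub>\<le>\<^sub>0" "d \<notin> \<int>\<^sub>\<le>\<^sub>0" "b + d \<notin> \<int>\<^sub>\<le>\<^sub>0"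
    using assms by (auto intro!: nonpos_Ints_Re_pos)
  then show ?thesis
    by (simp add: euler_integral_0[OF assms] Gamma_eq_zero_iff rGamma_eq_zero_iff)
qed

text \<open>Both sides solve the same equation in p, so for fixed r they differ by a factor
  depending on r alone; symmetry reduces this factor to its value at the origin.\<close>

lemma product_integral_eq_ball:
  assumes b: "Re b > 0" and k: "Re k < 1" and p: "norm p < 1" and r: "norm r < 1"
  shows "product_integral k b p r = euler_integral k b (1 - k) p * euler_integral k b (1 - k) r"
proof -
  define E where "E = euler_integral k b (1 - k)"
  have d: "Re (1 - k) > 0" using k by simp
  have E0: "E 0 \<noteq> 0" unfolding E_def by (rule euler_integral_0_nonzero[OF b d])
  have c: "b + (1 - k) \<notin> \<int>\<^sub>\<le>\<^sub>0" using b k by (intro nonpos_Ints_Re_pos) simp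
  have holE: "E holomorphic_on ball 0 1"
    unfolding E_def using holomorphic_on_euler_integral'[OF b k] ball_subset_slit_plane
    by (rule holomorphic_on_subset)
  have odeE: "hypergeo_op k b (b + (1 - k)) E x = 0" if "x \<in> ball 0 1" for x
    unfolding E_def using that ball_subset_slit_plane b d by (intro euler_integral_ode) auto
  have step: "E 0 * product_integral k b p r = product_integral k b 0 r * E p"
    if p: "norm p < 1" and r: "norm r < 1" for p r
  proof (rule hypergeo_ode_unique[of 1 _ _ k b "b + (1 - k)"])
    have mem: "x \<in> slit_plane" "r \<in> slit_plane" "x * r \<in> slit_plane" if "x \<in> ball 0 1" for x
    proof -
      have "norm (x * r) < 1 * 1"
        unfolding norm_mult using that r by (intro mult_strict_mono') auto
      then show "x \<in> slit_plane" "r \<in> slit_plane" "x * r \<in> slit_plane"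
        using that r ball_subset_slit_plane by auto
    qed
    show "(\<lambda>p. product_integral k b p r) holomorphic_on ball 0 1"
      unfolding product_integral_def
      using mem b k
      by (intro dominated_family_holomorphic dominated_family_product holomorphic_intros) auto
    show "hypergeo_op k b (b + (1 - k)) (\<lambda>p. product_integral k b p r) x = 0" if "x \<in> ball 0 1" for x
      using that by (intro product_integral_ode b k r) simp
  qed (use holE odeE c p in auto)
  have "product_integral k b 0 0 = E 0 * E 0"
  proof -
    have "product_integral k b 0 0 = integral {0..1} (\<lambda>v. beta_weight b (1 - k) v) * E 0"
      by (simp add: product_integral_def product_kernel_def E_def)
    also have "integral {0..1} (\<lambda>v. beta_weight b (1 - k) v) = E 0"
      by (simp add: E_def euler_integral_def)
    finally show ?thesis .
  qed
  \<comment> \<open>Used with second argument 0, the rule evaluates the integral on the axis; after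
    exchanging the arguments this is the unknown factor for general r.\<close>
  with step[OF r, of 0] E0 have "product_integral k b r 0 = E 0 * E r"
    by simp
  with step[OF p r] E0 show ?thesis
    by (simp add: product_integral_commute[of k b 0 r] E_def[symmetric])
qed

theorem product_integral_eq:
  assumes b: "Re b > 0" and k: "Re k < 1"
    and p: "p \<in> slit_plane" and r: "r \<in> slit_plane" and pr: "p * r \<in> slit_plane"
  shows "product_integral k b p r = euler_integral k b (1 - k) p * euler_integral k b (1 - k) r"
proof -
  \<comment> \<open>The product of the scaled points is multiplied by t^2 when s is multiplied by t,
    so the third condition respects the star shape too.\<close>
  define S where "S = (\<lambda>s. s * p) -` slit_plane \<inter> (\<lambda>s. s * r) -` slit_plane
    \<inter> (\<lambda>s. s * p * (s * r)) -` slit_plane"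
  have S: "open S" unfolding S_def
    by (intro open_Int open_vimage open_slit_plane continuous_intros)
  have conn: "connected S"
  proof (rule starlike_0_imp_connected)
    fix x and t :: real assume "x \<in> S" and t: "t \<in> {0..1}"
    then have *: "x * p \<in> slit_plane" "x * r \<in> slit_plane" "x * p * (x * r) \<in> slit_plane"
      by (auto simp: S_def)
    show "x * of_real t \<in> S"
      using slit_plane_scale[OF *(1) t] slit_plane_scale[OF *(2) t] slit_plane_scale_square[OF *(3) t]
      by (auto simp: S_def mult_ac power2_eq_square)
  qed
  \<comment> \<open>Chosen so that s p and s r lie in the unit disc for norm s < e.\<close>
  define e where "e = 1 / (1 + norm p + norm r)"
  have e: "e > 0" unfolding e_def by (simp add: add_pos_nonneg)
  have small: "norm (s * p) < 1" "norm (s * r) < 1" if "s \<in> ball 0 e" for s :: complex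
  proof -
    have pos: "0 < 1 + norm p + norm r" by (simp add: add_pos_nonneg)
    have "norm s * (1 + norm p + norm r) < 1"
      using that pos by (simp add: e_def field_simps)
    then show "norm (s * p) < 1" "norm (s * r) < 1"
      by (smt (verit) distrib_left mult_1_right mult_nonneg_nonneg norm_ge_zero norm_mult)+
  qed
  have sub: "ball 0 e \<subseteq> S"
  proof
    fix s :: complex assume s: "s \<in> ball 0 e"
    have "norm (s * p * (s * r)) < 1 * 1"
      unfolding norm_mult[of "s * p"] using small[OF s] by (intro mult_strict_mono') auto
    then show "s \<in> S" using small[OF s] ball_subset_slit_plane by (auto simp: S_def)
  qed
  define E where "E = euler_integral k b (1 - k)"
  have holE: "E holomorphic_on slit_plane"
    unfolding E_def by (rule holomorphic_on_euler_integral'[OF b k])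
  have comp: "(\<lambda>s. E (s * q)) holomorphic_on S" if "\<And>s. s \<in> S \<Longrightarrow> s * q \<in> slit_plane" for q
  proof -
    have "(E \<circ> (\<lambda>s. s * q)) holomorphic_on S"
      by (rule holomorphic_on_compose_gen[OF _ holE]) (use that in \<open>auto intro!: holomorphic_intros\<close>)
    then show ?thesis by (simp add: o_def)
  qed
  have "product_integral k b (1 * p) (1 * r) = E (1 * p) * E (1 * r)"
  proof (rule analytic_continuation_open[where f = "\<lambda>s. product_integral k b (s * p) (s * r)"
      and g = "\<lambda>s. E (s * p) * E (s * r)" and s = "ball 0 e" and s' = S and z = 1])
    show "(\<lambda>s. product_integral k b (s * p) (s * r)) holomorphic_on S"
      unfolding product_integral_def
      by (intro dominated_family_holomorphic dominated_family_product S b k holomorphic_intros)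
         (auto simp: S_def)
    show "(\<lambda>s. E (s * p) * E (s * r)) holomorphic_on S"
      by (intro holomorphic_intros comp) (auto simp: S_def)
    show "product_integral k b (s * p) (s * r) = E (s * p) * E (s * r)" if "s \<in> ball 0 e" for s
      unfolding E_def using small[OF that] by (intro product_integral_eq_ball b k)
    show "1 \<in> S" using p r pr by (simp add: S_def)
  qed (use S conn sub e in auto)
  then show ?thesis by (simp add: E_def)
qed

text \<open>The change of variable from s to u = s^2 is available for absolutely integrable
  functions.\<close>

lemma product_integrand_absolutely_integrable:
  assumes b: "Re b > 0" and k: "Re k < 1"
    and p: "p \<in> slit_plane" and r: "r \<in> slit_plane" and pr: "p * r \<in> slit_plane"
  shows "(\<lambda>v. beta_weight b (1 - k) v *
     (product_kernel k p r (of_real v) * euler_integral k b (1 - k) (p * r * (of_real v)\<^sup>2)))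
     absolutely_integrable_on {0..1}"
proof (rule beta_weight_absolutely_integrable[where g = "\<lambda>v. product_kernel k p r (of_real v) *
      euler_integral k b (1 - k) (p * r * (of_real v)\<^sup>2)"])
  have nonpos: "1 - p * of_real v \<notin> \<real>\<^sub>\<le>\<^sub>0" "1 - r * of_real v \<notin> \<real>\<^sub>\<le>\<^sub>0"
    "1 - p * r * of_real v \<notin> \<real>\<^sub>\<le>\<^sub>0" "1 - p * r * (of_real v)\<^sup>2 \<notin> \<real>\<^sub>\<le>\<^sub>0"
    if "v \<in> {0..1}" for v
    using slit_plane_scale[OF p that] slit_plane_scale[OF r that]
      slit_plane_scale[OF pr that] slit_plane_scale_square[OF pr that]
    by (simp_all add: slit_plane_iff)
  have "continuous_on {0..1} (\<lambda>v. euler_integral k b (1 - k) (p * r * (complex_of_real v)\<^sup>2))"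
  proof (rule continuous_on_compose2[OF holomorphic_on_imp_continuous_on[OF holomorphic_on_euler_integral'[OF b k]]])
    show "continuous_on {0..1} (\<lambda>v. p * r * (complex_of_real v)\<^sup>2)"
      by (intro continuous_intros)
    show "(\<lambda>v. p * r * (complex_of_real v)\<^sup>2) ` {0..1} \<subseteq> slit_plane"
      using slit_plane_scale_square[OF pr] by blast
  qed
  moreover have "continuous_on {0..1} (\<lambda>v. product_kernel k p r (complex_of_real v))"
    unfolding product_kernel_def
    by (intro continuous_on_mult continuous_on_cpowr continuous_on_const nonpos)
       (auto intro!: continuous_intros)
  ultimately show "continuous_on {0..1} (\<lambda>v. product_kernel k p r (of_real v) *
      euler_integral k b (1 - k) (p * r * (of_real v)\<^sup>2))"
    by (intro continuous_on_mult)
qed (use b k in auto)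

text \<open>The substitution s = sqrt u, performed on the open interval because the square root is
  not differentiable at 0.\<close>

lemma integral_sqrt_substitution:
  fixes g :: "real \<Rightarrow> complex"
  assumes "g absolutely_integrable_on {0..1}"
  shows "((\<lambda>u. g (sqrt u) / of_real (2 * sqrt u)) has_integral integral {0..1} g) {0..1}"
proof -
  have g: "g absolutely_integrable_on {0<..<1}"
    using assms unfolding absolutely_integrable_on_def by (simp add: integrable_on_Icc_iff_Ioo)
  have img: "sqrt ` {0<..<1} = {0<..<1}"
  proof (intro equalityI subsetI)
    fix x :: real assume "x \<in> {0<..<1}"
    then have "x = sqrt (x\<^sup>2)" "x\<^sup>2 \<in> {0<..<1}" by (auto simp: power_less_one_iff)
    then show "x \<in> sqrt ` {0<..<1}" by blast
  qed auto
  have "(\<lambda>u. \<bar>inverse (sqrt u) / 2\<bar> *\<^sub>R g (sqrt u)) absolutely_integrable_on {0<..<1} \<and>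
    integral {0<..<1} (\<lambda>u. \<bar>inverse (sqrt u) / 2\<bar> *\<^sub>R g (sqrt u)) = integral {0<..<1} g"
    by (subst has_absolute_integral_change_of_variables_real[where g = sqrt])
       (use g img in \<open>auto intro!: derivative_eq_intros inj_onI\<close>)
  then have "((\<lambda>u. \<bar>inverse (sqrt u) / 2\<bar> *\<^sub>R g (sqrt u)) has_integral integral {0<..<1} g) {0<..<1}"
    using has_integral_integral set_lebesgue_integral_eq_integral(1) by metis
  moreover have "\<bar>inverse (sqrt u) / 2\<bar> *\<^sub>R g (sqrt u) = g (sqrt u) / of_real (2 * sqrt u)"
    if "u \<in> {0<..<1}" for u
    using that by (simp add: scaleR_conv_of_real field_simps)
  ultimately have "((\<lambda>u. g (sqrt u) / of_real (2 * sqrt u)) has_integral integral {0<..<1} g) {0<..<1}"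
    by (rule has_integral_eq[rotated])
  then show ?thesis
    by (simp add: has_integral_Icc_iff_Ioo integral_open_interval_real[symmetric])
qed

text \<open>For z = (1 + p) / (1 - p) the hypergeometric argument (1 - z) / 2 is - p / (1 - p), as
  in Pfaff's transformation. Here c - b = 1 - kappa, so Re (lambda + alpha) < 1/2 is exactly the
  convergence condition at v = 1. The prefactor Gamma (2 alpha + lambda) cancels against
  \<open>rGamma\<close> of the same argument.\<close>

lemma gegenbauer_eq_euler_integral:
  assumes b: "Re (l + 2 * a) > 0" and k: "Re (l + a) < 1/2" and p: "p \<in> slit_plane"
  shows "gegenbauer l a ((1 + p) / (1 - p)) =
     of_real (sqrt pi) / 2 powr (2 * a - 1) * rGamma a * rGamma (l + 1) * rGamma (1 - (l + a + 1/2))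
     * ((1 - p) powr (l + 2 * a)
        * euler_integral (l + a + 1/2) (l + 2 * a) (1 - (l + a + 1/2)) p)"
proof -
  define \<beta> where "\<beta> = 2 * a + l"
  define \<kappa> where "\<kappa> = l + a + 1/2"
  define d where "d = 1 - \<kappa>"
  have \<beta>: "Re \<beta> > 0" "l + 2 * a = \<beta>" using b by (simp_all add: \<beta>_def add.commute)
  have d: "Re d > 0" "a + 1/2 - \<beta> = d" "\<beta> + d - (- l) = \<kappa>"
    using k by (simp_all add: d_def \<beta>_def \<kappa>_def field_simps)
  have ne: "1 - p \<noteq> 0" "1 - p \<notin> \<real>\<^sub>\<le>\<^sub>0" using p by (auto simp: slit_plane_iff)
  have x: "(1 - (1 + p) / (1 - p)) / 2 = - p / (1 - p)"
    using ne by (simp add: field_simps)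
  have "1 - (- p / (1 - p)) = inverse (1 - p)" using ne by (simp add: field_simps)
  then have x': "- p / (1 - p) \<in> slit_plane" using ne by (simp add: slit_plane_iff)
  have "Gamma \<beta> * rGamma \<beta> = 1"
    using \<beta>(1) nonpos_Ints_Re_pos by (auto simp: Gamma_def rGamma_eq_zero_iff)
  moreover have "hypergeo_reg (- l) \<beta> (a + 1/2) (- p / (1 - p))
      = rGamma \<beta> * rGamma d * ((1 - p) powr \<beta> * euler_integral \<kappa> \<beta> d p)"
    using hypergeo_reg_eq_cont[of \<beta> "a + 1/2" 0 "- p / (1 - p)" "- l", unfolded hypergeo_cont.simps d(2)]
      \<beta>(1) d(1) x'
    unfolding euler_integral_pfaff[OF \<beta>(1) d(1) p, of "- l", unfolded d(3)] by simp
  ultimately show ?thesis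
    unfolding gegenbauer_def x \<beta>_def[symmetric] \<beta>(2) \<kappa>_def[symmetric] d_def[symmetric] by (simp add: divide_simps)
qed

section \<open>The continued logarithms\<close>

text \<open>The two arguments lie both in (0, pi), both in (-pi, 0), or are both 0, so their
  difference stays in (-pi, pi) and no multiple of 2 pi i appears.\<close>

lemma Ln_divide_same_side:
  assumes "Im a > 0 \<and> Im b > 0 \<or> Im a < 0 \<and> Im b < 0 \<or> Im a = 0 \<and> Im b = 0 \<and> Re a > 0 \<and> Re b > 0"
  shows "Ln (a / b) = Ln a - Ln b" and "\<bar>Im (Ln a - Ln b)\<bar> < pi"
proof -
  have ne: "a \<noteq> 0" "b \<noteq> 0" using assms by auto
  have pos: "0 < Im (Ln z) \<and> Im (Ln z) < pi" if "Im z > 0" for z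
    using that Im_Ln_pos_lt[of z] by (cases "z = 0") auto
  have neg: "- pi < Im (Ln z) \<and> Im (Ln z) < 0" if "Im z < 0" for z
  proof -
    have "z \<noteq> 0" using that by auto
    then show ?thesis
      using that mpi_less_Im_Ln[of z] Im_Ln_le_pi[of z] Im_Ln_pos_le[of z] by linarith
  qed
  have real: "Im (Ln z) = 0" if "Im z = 0" "Re z > 0" for z
    using that Im_Ln_eq_0[of z] by (cases "z = 0") auto
  show im: "\<bar>Im (Ln a - Ln b)\<bar> < pi"
    using assms pos[of a] pos[of b] neg[of a] neg[of b] real[of a] real[of b] pi_gt_zero by auto
  have "exp (Ln a - Ln b) = a / b" using ne by (simp add: exp_diff)
  moreover have "Ln (exp (Ln a - Ln b)) = Ln a - Ln b"
    using im by (intro Ln_exp) auto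
  ultimately show "Ln (a / b) = Ln a - Ln b" by simp
qed

text \<open>In this coordinate the cut plane becomes the plane without (-infinity, 0] and [1,
  infinity); these two rays come from (-1, 1] and from the rest of the cut together with
  infinity.\<close>

definition cayley :: "complex \<Rightarrow> complex" where
  "cayley z = (z - 1) / (z + 1)"

lemma cut_plane_nonpos:
  assumes "z \<in> cut_plane"
  shows "z \<notin> \<real>\<^sub>\<le>\<^sub>0" "z + 1 \<notin> \<real>\<^sub>\<le>\<^sub>0" "z - 1 \<notin> \<real>\<^sub>\<le>\<^sub>0" "z \<noteq> 0" "z + 1 \<noteq> 0" "z - 1 \<noteq> 0"
proof -
  show "z \<notin> \<real>\<^sub>\<le>\<^sub>0" "z + 1 \<notin> \<real>\<^sub>\<le>\<^sub>0" "z - 1 \<notin> \<real>\<^sub>\<le>\<^sub>0"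
    using assms by (auto simp: cut_plane_iff complex_nonpos_Reals_iff)
  then show "z \<noteq> 0" "z + 1 \<noteq> 0" "z - 1 \<noteq> 0" by auto
qed

lemma cayley_facts:
  assumes "z \<in> cut_plane"
  shows "1 - cayley z = 2 / (z + 1)" "1 + cayley z = 2 * z / (z + 1)"
    "z = (1 + cayley z) / (1 - cayley z)" "cayley z \<noteq> 0"
    "cayley z \<notin> \<real>\<^sub>\<le>\<^sub>0" "1 + cayley z \<notin> \<real>\<^sub>\<le>\<^sub>0" "cayley z \<in> slit_plane"
    and "Ln (cayley z) = Ln (z - 1) - Ln (z + 1)"
    and "Ln (1 - cayley z) = of_real (ln 2) - Ln (z + 1)"
    and "Ln (1 + cayley z) = of_real (ln 2) + Ln z - Ln (z + 1)"
proof -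
  note ne = cut_plane_nonpos[OF assms]
  show 1: "1 - cayley z = 2 / (z + 1)" "1 + cayley z = 2 * z / (z + 1)"
    using ne by (auto simp: cayley_def field_simps)
  show "z = (1 + cayley z) / (1 - cayley z)"
    unfolding 1 using ne by simp
  show c0: "cayley z \<noteq> 0"
    using ne by (auto simp: cayley_def)
  \<comment> \<open>z - 1, z and z + 1 have the same imaginary part, and if it is 0 all three are
    positive, since z is off the cut.\<close>
  have side: "Im (z - 1) > 0 \<and> Im (z + 1) > 0 \<or> Im (z - 1) < 0 \<and> Im (z + 1) < 0 \<or>
    Im (z - 1) = 0 \<and> Im (z + 1) = 0 \<and> Re (z - 1) > 0 \<and> Re (z + 1) > 0"
    "Im z > 0 \<and> Im (z + 1) > 0 \<or> Im z < 0 \<and> Im (z + 1) < 0 \<or>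
    Im z = 0 \<and> Im (z + 1) = 0 \<and> Re z > 0 \<and> Re (z + 1) > 0"
    using assms by (auto simp: cut_plane_iff complex_nonpos_Reals_iff)
  show L: "Ln (cayley z) = Ln (z - 1) - Ln (z + 1)"
    unfolding cayley_def by (rule Ln_divide_same_side(1)[OF side(1)])
  have im: "\<bar>Im (Ln (cayley z))\<bar> < pi"
    unfolding L by (rule Ln_divide_same_side(2)[OF side(1)])
  show np: "cayley z \<notin> \<real>\<^sub>\<le>\<^sub>0"
  proof
    assume "cayley z \<in> \<real>\<^sub>\<le>\<^sub>0"
    then have "Re (cayley z) < 0 \<and> Im (cayley z) = 0"
      using c0 by (auto simp: complex_nonpos_Reals_iff complex_eq_iff)
    then have "Im (Ln (cayley z)) = pi"
      using Im_Ln_eq_pi[OF c0] by simp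
    then show False using im by simp
  qed
  then show "1 + cayley z \<notin> \<real>\<^sub>\<le>\<^sub>0"
    by (auto simp: complex_nonpos_Reals_iff)
  have half: "(z + 1) / 2 \<notin> \<real>\<^sub>\<le>\<^sub>0" using ne(2) by (auto simp: complex_nonpos_Reals_iff)
  have inv: "1 - cayley z = inverse ((z + 1) / 2)" by (simp add: 1(1))
  show "cayley z \<in> slit_plane"
    unfolding slit_plane_iff inv nonpos_Reals_inverse_iff by (rule half)
  have Lhalf: "Ln ((z + 1) / 2) = Ln (z + 1) - of_real (ln 2)"
  proof -
    have "of_real 2 * ((z + 1) / 2) = z + 1" by simp
    then show ?thesis
      using Ln_times_of_real[of 2 "(z + 1) / 2"] ne(5) by (simp del: times_divide_eq_right add: Ln_of_real[of 2, simplified])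
  qed
  show "Ln (1 - cayley z) = of_real (ln 2) - Ln (z + 1)"
    unfolding inv Ln_inverse[OF half] Lhalf by simp
  have "Ln (1 + cayley z) = Ln (of_real 2 * (z / (z + 1)))"
    by (simp add: 1(2))
  also have "\<dots> = of_real (ln 2) + Ln (z / (z + 1))"
    using Ln_times_of_real[of 2 "z / (z + 1)"] ne by (simp add: Ln_of_real[of 2, simplified])
  also have "Ln (z / (z + 1)) = Ln z - Ln (z + 1)"
    by (rule Ln_divide_same_side(1)[OF side(2)])
  finally show "Ln (1 + cayley z) = of_real (ln 2) + Ln z - Ln (z + 1)" by simp
qed

lemma slit_planeE:
  assumes "w \<notin> slit_plane"
  obtains x where "w = of_real x" "x \<ge> 1"
  using assms by (auto simp: slit_plane_def)

lemma nonpos_RealsE: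
  assumes "w \<in> \<real>\<^sub>\<le>\<^sub>0"
  obtains x where "w = complex_of_real x" "x \<le> 0"
  using assms by (auto simp: nonpos_Reals_def)

lemma inverse_cayley:
  assumes "p \<notin> \<real>\<^sub>\<le>\<^sub>0" "p \<in> slit_plane"
  shows "(1 + p) / (1 - p) \<in> cut_plane" "cayley ((1 + p) / (1 - p)) = p"
proof -
  have ne: "1 - p \<noteq> 0" "p \<noteq> 0" using assms by (auto simp: slit_plane_iff)
  show "(1 + p) / (1 - p) \<in> cut_plane"
    unfolding cut_plane_iff
  proof
    assume "(1 + p) / (1 - p) - 1 \<in> \<real>\<^sub>\<le>\<^sub>0"
    then obtain t where t: "(1 + p) / (1 - p) - 1 = complex_of_real t" "t \<le> 0"
      by (rule nonpos_RealsE)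
    \<comment> \<open>A value 1 + t on the cut, t <= 0, forces p = t / (2 + t), which is at most 0
      for t > -2 and at least 1 for t < -2.\<close>
    then have e: "p * (of_real (2 + t)) = of_real t"
      using ne by (simp add: field_simps)
    then have "2 + t \<noteq> 0" using t by force
    then have p: "p = of_real (t / (2 + t))"
      using e by (simp add: field_simps flip: of_real_add)
    show False
    proof (cases "2 + t > 0")
      case True
      then have "t / (2 + t) \<le> 0" using t by (simp add: divide_nonpos_pos)
      then have "p \<in> \<real>\<^sub>\<le>\<^sub>0" unfolding p by (simp only: nonpos_Reals_of_real_iff)
      then show False using assms(1) by simp
    next
      case False
      then have "1 \<le> t / (2 + t)" using \<open>2 + t \<noteq> 0\<close> by (simp add: field_simps)
      then show False using assms(2) p unfolding slit_plane_def by blast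
    qed
  qed
  show "cayley ((1 + p) / (1 - p)) = p"
    unfolding cayley_def using ne by (simp add: divide_simps)
qed

section \<open>Admissible pairs and configurations in Cayley coordinates\<close>

lemma cayley_product:
  assumes "z1 \<in> cut_plane" "z2 \<in> cut_plane"
  shows "1 - cayley z1 * cayley z2 = 2 * (z1 + z2) / ((z1 + 1) * (z2 + 1))"
    and "1 + cayley z1 * cayley z2 = 2 * (z1 * z2 + 1) / ((z1 + 1) * (z2 + 1))"
  using cut_plane_nonpos[OF assms(1)] cut_plane_nonpos[OF assms(2)]
  by (simp_all add: cayley_def divide_simps) (simp_all add: algebra_simps)

text \<open>The upper limit is (1 + w) / (1 - w) with w the product of the coordinates. Values w > 1
  give exactly the points below -1 on the real axis, and w = 1 is the case z1 + z2 = 0 of an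
  infinite limit.\<close>

lemma admissible_iff:
  assumes z: "z1 \<in> cut_plane" "z2 \<in> cut_plane"
  shows "(z1, z2) \<in> admissible \<longleftrightarrow> cayley z1 * cayley z2 \<in> slit_plane"
proof -
  define w where "w = cayley z1 * cayley z2"
  have ne: "z1 + 1 \<noteq> 0" "z2 + 1 \<noteq> 0" using cut_plane_nonpos z by auto
  have 0: "1 - w = 0 \<longleftrightarrow> z1 + z2 = 0"
    unfolding w_def cayley_product[OF z] using ne by (simp del: distrib_left_numeral)
  have up: "upper_limit z1 z2 * (1 - w) = 1 + w" if "z1 + z2 \<noteq> 0"
    unfolding w_def cayley_product[OF z] upper_limit_def using that ne
    by (simp del: distrib_left_numeral add: mult.assoc) (simp add: algebra_simps)
  show ?thesis
    unfolding w_def[symmetric]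
  proof
    assume adm: "(z1, z2) \<in> admissible"
    then have nz: "z1 + z2 \<noteq> 0" and ul: "upper_limit z1 z2 \<notin> of_real ` {..-1}"
      by (auto simp: admissible_def)
    show "w \<in> slit_plane"
    proof (rule ccontr)
      assume "w \<notin> slit_plane"
      then obtain x where x: "w = of_real x" "x \<ge> 1" by (rule slit_planeE)
      have "x \<noteq> 1" using 0 nz x by auto
      then have nx: "complex_of_real (1 - x) \<noteq> 0" by (simp only: of_real_eq_0_iff)
      have "upper_limit z1 z2 * of_real (1 - x) = of_real (1 + x)"
        using up[OF nz] x by simp
      then have "upper_limit z1 z2 = of_real ((1 + x) / (1 - x))"
        unfolding of_real_divide using nx by (metis nonzero_eq_divide_eq)
      moreover have "(1 + x) / (1 - x) \<le> - 1" using x \<open>x \<noteq> 1\<close> by (simp add: field_simps)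
      ultimately show False using ul by blast
    qed
  next
    assume w: "w \<in> slit_plane"
    then have "1 - w \<noteq> 0" by (auto simp: slit_plane_iff)
    then have nz: "z1 + z2 \<noteq> 0" using 0 by simp
    have "upper_limit z1 z2 \<notin> of_real ` {..-1}"
    proof
      assume "upper_limit z1 z2 \<in> of_real ` {..-1}"
      then obtain y where y: "upper_limit z1 z2 = of_real y" "y \<le> - 1" by auto
      have e: "w * of_real (y + 1) = of_real (y - 1)"
        using up[OF nz] unfolding y by (simp add: algebra_simps)
      then have "y + 1 \<noteq> 0" using y by force
      then have "complex_of_real (y + 1) \<noteq> 0" by (metis of_real_eq_0_iff)
      then have "w = of_real ((y - 1) / (y + 1))"
        unfolding of_real_divide using e by (metis nonzero_eq_divide_eq)
      moreover have "1 \<le> (y - 1) / (y + 1)" using y \<open>y + 1 \<noteq> 0\<close> by (simp add: field_simps)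
      ultimately show False using w unfolding slit_plane_def by blast
    qed
    then show "(z1, z2) \<in> admissible" using nz z by (simp add: admissible_def)
  qed
qed

text \<open>A straight path to a base point need not preserve the condition on p1 p2. Scaling p1 and
  p2 towards 0 does, and inside the unit disc the condition is automatic, which leaves only the cut
  (-1, 0] to avoid.\<close>

lemma connected_configs: "connected configs"
proof -
  define T where "T = {(p1, p2, u :: real). p1 \<notin> \<real>\<^sub>\<le>\<^sub>0 \<and> p2 \<notin> \<real>\<^sub>\<le>\<^sub>0 \<and> p1 \<in> slit_plane \<and> p2 \<in> slit_plane
     \<and> p1 * p2 \<in> slit_plane \<and> 0 < u \<and> u < 1}"
  define c where "c = (1/2 :: complex, 1/2 :: complex, 1/2 :: real)"
  have small: "(q1, q2, u) \<in> T"
    if "norm q1 < 1" "norm q2 < 1" "q1 \<notin> \<real>\<^sub>\<le>\<^sub>0" "q2 \<notin> \<real>\<^sub>\<le>\<^sub>0" "0 < u" "u < 1" for q1 q2 u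
  proof -
    have "norm (q1 * q2) < 1 * 1"
      unfolding norm_mult using that by (intro mult_strict_mono') auto
    then show ?thesis using that ball_subset_slit_plane by (auto simp: T_def)
  qed
  have scale: "q * of_real t \<notin> \<real>\<^sub>\<le>\<^sub>0" if "q \<notin> \<real>\<^sub>\<le>\<^sub>0" "0 < t" for q :: complex and t
    using that by (auto simp: complex_nonpos_Reals_iff zero_less_mult_iff mult_le_0_iff)
  have to_c: "connected_component T x c" if x: "x \<in> T" for x
  proof -
    obtain p1 p2 u where x': "x = (p1, p2, u)" by (metis prod_cases3)
    have p: "p1 \<notin> \<real>\<^sub>\<le>\<^sub>0" "p2 \<notin> \<real>\<^sub>\<le>\<^sub>0" "p1 \<in> slit_plane" "p2 \<in> slit_plane" "p1 * p2 \<in> slit_plane" "0 < u" "u < 1"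
      using x by (auto simp: x' T_def)
    \<comment> \<open>Scaling stops at a positive factor because 0 itself is excluded; this factor
      brings both points into the unit disc.\<close>
    define e where "e = 1 / (2 + norm p1 + norm p2)"
    have pos: "0 < 2 + norm p1 + norm p2" by (simp add: add_pos_nonneg)
    then have e: "0 < e" "e \<le> 1" by (simp_all add: e_def field_simps)
    define q1 where "q1 = p1 * of_real e"
    define q2 where "q2 = p2 * of_real e"
    have q: "norm q1 < 1" "norm q2 < 1" "q1 \<notin> \<real>\<^sub>\<le>\<^sub>0" "q2 \<notin> \<real>\<^sub>\<le>\<^sub>0"
    proof -
      have "norm q1 = norm p1 * e" "norm q2 = norm p2 * e"
        using e by (simp_all add: q1_def q2_def norm_mult)
      moreover have "norm p1 * e < 1" "norm p2 * e < 1"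
        using pos by (auto simp: e_def divide_simps add_pos_nonneg)
      ultimately show "norm q1 < 1" "norm q2 < 1" by simp_all
      show "q1 \<notin> \<real>\<^sub>\<le>\<^sub>0" "q2 \<notin> \<real>\<^sub>\<le>\<^sub>0"
        unfolding q1_def q2_def using scale p e by blast+
    qed
    have "connected_component T (p1, p2, u) (q1, q2, u)"
      unfolding connected_component_def
    proof (intro exI conjI)
      let ?f = "\<lambda>t::real. (p1 * of_real t, p2 * of_real t, u)"
      show "connected (?f ` {e..1})"
        by (intro connected_continuous_image continuous_intros) auto
      show "?f ` {e..1} \<subseteq> T"
      proof
        fix y assume "y \<in> ?f ` {e..1}"
        then obtain t where "y = ?f t" "t \<in> {e..1}" by blast
        then have t: "y = ?f t" "e \<le> t" "t \<le> 1" by auto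
        then have t01: "t \<in> {0..1}" "0 < t" using e by auto
        show "y \<in> T"
          using slit_plane_scale[OF p(3) t01(1)] slit_plane_scale[OF p(4) t01(1)]
            slit_plane_scale_square[OF p(5) t01(1)] scale[OF p(1) t01(2)] scale[OF p(2) t01(2)] p(6,7)
          by (auto simp: t T_def power2_eq_square mult_ac)
      qed
      show "(p1, p2, u) \<in> ?f ` {e..1}" using e by (intro image_eqI[of _ _ 1]) auto
      show "(q1, q2, u) \<in> ?f ` {e..1}" using e by (intro image_eqI[of _ _ e]) (auto simp: q1_def q2_def)
    qed
    moreover have "connected_component T (q1, q2, u) c"
      unfolding connected_component_def
    proof (intro exI conjI)
      \<comment> \<open>The unit disc without (-1, 0] is star-shaped about 1/2.\<close>
      let ?g = "\<lambda>q t. q * of_real (1 - t) + of_real (t / 2) :: complex"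
      let ?f = "\<lambda>t::real. (?g q1 t, ?g q2 t, u * (1 - t) + t / 2)"
      have g: "norm (?g q t) < 1 \<and> ?g q t \<notin> \<real>\<^sub>\<le>\<^sub>0" if "norm q < 1" "q \<notin> \<real>\<^sub>\<le>\<^sub>0" "t \<in> {0..1}" for q t
      proof
        have "norm (?g q t) \<le> norm q * (1 - t) + t / 2"
          using that norm_triangle_ineq[of "q * of_real (1 - t)" "of_real (t / 2)"]
          by (simp add: norm_mult del: of_real_diff of_real_divide)
        also have "\<dots> < 1"
        proof (cases "t = 1")
          case False
          then have "norm q * (1 - t) < 1 * (1 - t)" using that by (intro mult_strict_right_mono) auto
          then show ?thesis using that by simp
        qed simp
        finally show "norm (?g q t) < 1" .
        show "?g q t \<notin> \<real>\<^sub>\<le>\<^sub>0"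
        proof (cases "t = 1")
          case False
          then have "0 < 1 - t" using that by auto
          then have "Im q = 0 \<Longrightarrow> 0 < Re q * (1 - t)"
            using that(2) by (auto simp: complex_nonpos_Reals_iff)
          then have "Im q = 0 \<Longrightarrow> 0 < Re q * (1 - t) + t / 2"
            using that(3) by (intro add_pos_nonneg) auto
          then show ?thesis using \<open>0 < 1 - t\<close> by (auto simp: complex_nonpos_Reals_iff)
        qed (simp add: complex_nonpos_Reals_iff)
      qed
      show "connected (?f ` {0..1})"
        by (intro connected_continuous_image continuous_intros) auto
      show "?f ` {0..1} \<subseteq> T"
      proof
        fix y assume "y \<in> ?f ` {0..1}"
        then obtain t where t: "y = ?f t" "t \<in> {0..1}" by blast
        have "0 < u * (1 - t) + t / 2"
          using t p(6) by (cases "t = 0") (auto intro!: add_nonneg_pos)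
        moreover have "u * (1 - t) + t / 2 < 1"
        proof (cases "t = 1")
          case False
          then have "u * (1 - t) < 1 * (1 - t)" using t p(7) by (intro mult_strict_right_mono) auto
          then show ?thesis using t by simp
        qed simp
        ultimately show "y \<in> T"
          unfolding t(1) using g[OF q(1,3) t(2)] g[OF q(2,4) t(2)] by (intro small) auto
      qed
      show "(q1, q2, u) \<in> ?f ` {0..1}" by (intro image_eqI[of _ _ 0]) auto
      show "c \<in> ?f ` {0..1}" by (intro image_eqI[of _ _ 1]) (auto simp: c_def)
    qed
    ultimately show ?thesis unfolding x' by (rule connected_component_trans)
  qed
  have "connected T"
    unfolding connected_iff_connected_component
    using to_c connected_component_sym connected_component_trans by meson
  define \<Phi> where "\<Phi> = (\<lambda>(p1, p2, u :: real). ((1 + p1) / (1 - p1), (1 + p2) / (1 - p2), u) :: complex \<times> complex \<times> real)"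
  have "\<Phi> ` T = configs"
  proof (intro equalityI subsetI)
    fix x assume "x \<in> \<Phi> ` T"
    then show "x \<in> configs"
      by (auto simp: \<Phi>_def T_def configs_def admissible_iff inverse_cayley)
  next
    fix x assume "x \<in> configs"
    then obtain z1 z2 u where x: "x = (z1, z2, u)" "(z1, z2) \<in> admissible" "0 < u" "u < 1"
      by (auto simp: configs_def)
    then have z: "z1 \<in> cut_plane" "z2 \<in> cut_plane" by (auto simp: admissible_def)
    have "(cayley z1, cayley z2, u) \<in> T"
      using x cayley_facts(5,7)[OF z(1)] cayley_facts(5,7)[OF z(2)] admissible_iff[OF z] by (simp add: T_def)
    moreover have "x = \<Phi> (cayley z1, cayley z2, u)"
      using cayley_facts(3)[OF z(1)] cayley_facts(3)[OF z(2)] by (simp add: \<Phi>_def x(1))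
    ultimately show "x \<in> \<Phi> ` T" by blast
  qed
  moreover have "continuous_on T \<Phi>"
    unfolding \<Phi>_def split_def
    by (intro continuous_intros) (auto simp: T_def slit_plane_iff)
  ultimately show ?thesis using \<open>connected T\<close> connected_continuous_image by metis
qed

lemma cayley_of_real:
  assumes "x > 1"
  obtains y where "cayley (of_real x) = of_real y" "0 < y" "y < 1"
proof
  show "cayley (of_real x) = of_real ((x - 1) / (x + 1))"
    by (simp add: cayley_def)
qed (use assms in auto)

lemma of_real_cut_plane: "x > 1 \<Longrightarrow> of_real x \<in> cut_plane"
  by (simp add: cut_plane_iff complex_nonpos_Reals_iff)

lemma real_configsE:
  assumes "x \<in> real_configs"
  obtains z1 z2 u y1 y2 where "x = (z1, z2, u)" "x \<in> configs" "0 < u" "u < 1"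
    "cayley z1 = of_real y1" "0 < y1" "y1 < 1" "cayley z2 = of_real y2" "0 < y2" "y2 < 1"
proof -
  obtain a1 a2 u where x: "x = (of_real a1, of_real a2, u)" "a1 > 1" "a2 > 1" "0 < u" "u < 1"
    using assms by (auto simp: real_configs_def)
  obtain y1 where y1: "cayley (of_real a1) = of_real y1" "0 < y1" "y1 < 1"
    using cayley_of_real[OF x(2)] .
  obtain y2 where y2: "cayley (of_real a2) = of_real y2" "0 < y2" "y2 < 1"
    using cayley_of_real[OF x(3)] .
  have "y1 * y2 < 1 * 1" using y1 y2 by (intro mult_strict_mono) auto
  then have "cayley (of_real a1) * cayley (of_real a2) \<in> slit_plane"
    unfolding y1 y2 by (simp add: slit_plane_iff complex_nonpos_Reals_iff)
  then have "x \<in> configs"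
    using x admissible_iff of_real_cut_plane by (simp add: configs_def)
  then show ?thesis using that x y1 y2 by blast
qed

text \<open>Two candidates differ by a continuous D with exp D = 1. Its values are multiples of 2 pi
  i, at mutual distance at least 2 pi, so D is constant on the connected set and is 0 because it
  vanishes at a real configuration. On \<open>real_configs\<close> a real logarithm is automatically
  the principal one.\<close>

lemma continued_log_eq:
  fixes L0 :: "complex \<times> complex \<times> real \<Rightarrow> complex"
  assumes cont: "continuous_on configs L0"
    and ex: "\<And>x. x \<in> configs \<Longrightarrow> f x \<noteq> 0 \<Longrightarrow> exp (L0 x) = f x"
    and real: "\<And>x. x \<in> real_configs \<Longrightarrow> f x \<noteq> 0 \<and> Im (L0 x) = 0"
    and isolated: "\<And>z1 z2 u. (z1, z2, u) \<in> configs \<Longrightarrow> f (z1, z2, u) = 0 \<Longrightarrow>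
      \<forall>\<^sub>F t in at u. f (z1, z2, t) \<noteq> 0"
    and x: "x \<in> configs"
  shows "continued_log f x = L0 x"
  unfolding continued_log_def
proof (rule the_equality)
  have "L0 y = Ln (f y)" if "y \<in> real_configs" for y
  proof -
    have "y \<in> configs" using that by (rule real_configsE)
    then have "exp (L0 y) = f y" using ex real[OF that] by blast
    moreover have "Ln (exp (L0 y)) = L0 y" using real[OF that] by (intro Ln_exp) auto
    ultimately show ?thesis by simp
  qed
  note real_Ln = this
  then show "\<exists>L. continuous_on configs L \<and> (\<forall>x\<in>configs. f x \<noteq> 0 \<longrightarrow> exp (L x) = f x) \<and>
      (\<forall>x\<in>real_configs. L x = Ln (f x)) \<and> L0 x = L x"
    using cont ex by blast
  fix w assume "\<exists>L. continuous_on configs L \<and> (\<forall>x\<in>configs. f x \<noteq> 0 \<longrightarrow> exp (L x) = f x) \<and>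
      (\<forall>x\<in>real_configs. L x = Ln (f x)) \<and> w = L x"
  then obtain L where L: "continuous_on configs L" "\<forall>x\<in>configs. f x \<noteq> 0 \<longrightarrow> exp (L x) = f x"
      "\<forall>x\<in>real_configs. L x = Ln (f x)" "w = L x" by blast
  define D where "D y = L y - L0 y" for y
  have contD: "continuous_on configs D"
    unfolding D_def by (intro continuous_intros L cont)
  have expD: "exp (D y) = 1" if y: "y \<in> configs" for y
  proof (cases "f y = 0")
    case False
    then show ?thesis using L(2) ex y by (simp add: D_def exp_diff)
  next
    case True
    obtain z1 z2 u where y': "y = (z1, z2, u)" by (metis prod_cases3)
    have line: "(z1, z2, t) \<in> configs" if "t \<in> {0<..<1}" for t
      using y that by (simp add: y' configs_def)
    have u: "u \<in> {0<..<1}" using y by (simp add: y' configs_def)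
    \<comment> \<open>At a zero of f the exponential relation is missing; it is recovered as a limit
      along the arc, on which the zeros are isolated.\<close>
    have "continuous_on {0<..<1} (\<lambda>t. D (z1, z2, t))"
      by (rule continuous_on_compose2[OF contD]) (use line in \<open>auto intro!: continuous_intros\<close>)
    then have "((\<lambda>t. exp (D (z1, z2, t))) \<longlongrightarrow> exp (D (z1, z2, u))) (at u)"
      using u by (intro tendsto_exp) (auto simp: continuous_on_eq_continuous_at isCont_def)
    moreover have "\<forall>\<^sub>F t in at u. exp (D (z1, z2, t)) = 1"
    proof -
      have "\<forall>\<^sub>F t in at u. t \<in> {0<..<1}"
        using u by (intro eventually_at_in_open') auto
      moreover have "\<forall>\<^sub>F t in at u. f (z1, z2, t) \<noteq> 0"
        using isolated y True unfolding y' by blast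
      ultimately show ?thesis
        by eventually_elim (use L(2) ex line in \<open>simp add: D_def exp_diff\<close>)
    qed
    then have "((\<lambda>t. exp (D (z1, z2, t))) \<longlongrightarrow> 1) (at u)"
      by (rule tendsto_eventually)
    ultimately show ?thesis
      unfolding y' by (intro tendsto_unique[of "at u"]) auto
  qed
  have "D constant_on configs"
  proof (rule continuous_discrete_range_constant[OF connected_configs contD])
    fix y assume y: "y \<in> configs"
    have "2 * pi \<le> norm (D y' - D y)" if y': "y' \<in> configs" "D y' \<noteq> D y" for y'
    proof -
      have "exp (D y' - D y) = 1" using expD y y' by (simp add: exp_diff)
      then obtain n :: int where n: "Re (D y' - D y) = 0" "Im (D y' - D y) = of_int (2 * n) * pi"
        unfolding exp_eq_1 by blast
      have "n \<noteq> 0" using n y' by (auto simp: complex_eq_iff)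
      then have "1 \<le> \<bar>real_of_int n\<bar>" by linarith
      then have "2 * pi \<le> \<bar>Im (D y' - D y)\<bar>"
        unfolding n(2) by (simp add: abs_mult)
      then show ?thesis using abs_Im_le_cmod order_trans by blast
    qed
    then show "\<exists>e>0. \<forall>y'. y' \<in> configs \<and> D y' \<noteq> D y \<longrightarrow> e \<le> norm (D y' - D y)"
      by (intro exI[of _ "2 * pi"]) auto
  qed
  then obtain k where k: "\<And>y. y \<in> configs \<Longrightarrow> D y = k"
    unfolding constant_on_def by blast
  \<comment> \<open>Any real configuration would do; it fixes the constant.\<close>
  have "(2, 2, 1/2) \<in> real_configs"
    by (auto simp: real_configs_def intro!: image_eqI[of _ _ 2])
  then have "D (2, 2, 1/2) = 0" "(2, 2, 1/2) \<in> configs"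
    using L(3) real_Ln by (auto simp: D_def elim: real_configsE)
  then have "D x = 0" using k x by metis
  then show "w = L0 x" using L by (simp add: D_def)
qed

section \<open>Explicit forms of the two continued logarithms\<close>

lemma configsD:
  assumes "(z1, z2, u) \<in> configs"
  shows "z1 \<in> cut_plane" "z2 \<in> cut_plane" "cayley z1 * cayley z2 \<in> slit_plane" "0 < u" "u < 1"
proof -
  show z: "z1 \<in> cut_plane" "z2 \<in> cut_plane" "0 < u" "u < 1"
    using assms by (auto simp: configs_def admissible_def)
  show "cayley z1 * cayley z2 \<in> slit_plane"
    using assms admissible_iff[OF z(1,2)] by (simp add: configs_def)
qed

lemma arc3_eq:
  "arc3 z1 z2 u = (1 + cayley z1 * cayley z2 * of_real u) / (1 - cayley z1 * cayley z2 * of_real u)"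
  by (simp add: arc3_def Let_def cayley_def mult_ac)

lemma continuous_on_cayley:
  assumes "continuous_on A f" "\<And>x. x \<in> A \<Longrightarrow> f x \<in> cut_plane"
  shows "continuous_on A (\<lambda>x. cayley (f x))"
  unfolding cayley_def
  by (intro continuous_intros assms) (use assms cut_plane_nonpos in blast)

lemma continuous_on_Ln_compose:
  assumes "continuous_on A f" "\<And>x. x \<in> A \<Longrightarrow> f x \<notin> \<real>\<^sub>\<le>\<^sub>0"
  shows "continuous_on A (\<lambda>x. Ln (f x))"
  using assms by (intro continuous_intros) auto

lemma Im_Ln_pos_real: "x > 0 \<Longrightarrow> Im (Ln (of_real x)) = 0"
  by (simp add: Ln_of_real)

lemma exp_Ln_of_real: "x > 0 \<Longrightarrow> exp (complex_of_real (ln x)) = of_real x"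
  by (simp add: exp_of_real)

lemma log_sq1_eq:
  assumes "(z1, z2, u) \<in> configs"
  shows "log_sq1 (z1, z2, u) = of_real (ln 4) + of_real (ln u) + Ln (cayley z1) + Ln (cayley z2)
     - 2 * Ln (1 - cayley z1 * cayley z2 * of_real u)"
proof -
  define L0 where "L0 = (\<lambda>(z1, z2, u). complex_of_real (ln 4) + of_real (ln u) + Ln (cayley z1) + Ln (cayley z2)
     - 2 * Ln (1 - cayley z1 * cayley z2 * of_real u))"
  have nonpos: "1 - cayley z1 * cayley z2 * of_real u \<notin> \<real>\<^sub>\<le>\<^sub>0" if "(z1, z2, u) \<in> configs" for z1 z2 u
    using configsD[OF that] by (intro slit_plane_scale') auto
  have cont: "continuous_on configs L0"
    unfolding L0_def split_def
    by (intro continuous_on_diff continuous_on_add continuous_on_mult continuous_on_const continuous_on_Ln_compose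
         continuous_on_cayley continuous_on_of_real continuous_on_ln continuous_on_fst continuous_on_snd continuous_on_id)
       (auto simp: nonpos cayley_facts(5) dest: configsD)
  have ex: "exp (L0 (z1, z2, u)) = (arc3 z1 z2 u)\<^sup>2 - 1" if c: "(z1, z2, u) \<in> configs" for z1 z2 u
  proof -
    note d = configsD[OF c]
    define q where "q = cayley z1 * cayley z2 * of_real u"
    have q: "1 - q \<noteq> 0" using nonpos[OF c] by (auto simp: q_def)
    have "exp (L0 (z1, z2, u)) = 4 * of_real u * cayley z1 * cayley z2 / (1 - q)^2"
      using cayley_facts(4)[OF d(1)] cayley_facts(4)[OF d(2)] d(4) q exp_Ln_of_real[of 4] exp_Ln_of_real[of u]
      by (simp add: L0_def exp_add exp_diff exp_double q_def)
    also have "\<dots> = 4 * q / (1 - q)^2" by (simp add: q_def mult_ac)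
    also have "\<dots> = ((1 + q) / (1 - q))\<^sup>2 - 1"
      using q by (simp add: power_divide divide_simps) (simp add: power2_eq_square algebra_simps)
    finally show ?thesis unfolding arc3_eq q_def .
  qed
  have "continued_log (\<lambda>(z1, z2, u). (arc3 z1 z2 u)\<^sup>2 - 1) (z1, z2, u) = L0 (z1, z2, u)"
  proof (rule continued_log_eq[OF cont _ _ _ assms])
    show "exp (L0 x) = (case x of (z1, z2, u) \<Rightarrow> (arc3 z1 z2 u)\<^sup>2 - 1)" if "x \<in> configs" for x
      using ex that by (cases x) auto
    \<comment> \<open>The base is an exponential throughout \<open>configs\<close>, so it has no
      zeros and the case is void.\<close>
    show "\<forall>\<^sub>F t in at u. (case (z1, z2, t) of (z1, z2, u) \<Rightarrow> (arc3 z1 z2 u)\<^sup>2 - 1) \<noteq> 0"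
      if "(z1, z2, u) \<in> configs" "(case (z1, z2, u) of (z1, z2, u) \<Rightarrow> (arc3 z1 z2 u)\<^sup>2 - 1) = 0" for z1 z2 u
      using ex[OF that(1)] that(2) exp_not_eq_zero by (metis case_prod_conv)
    fix x assume "x \<in> real_configs"
    then obtain z1 z2 u y1 y2 where x: "x = (z1, z2, u)" "x \<in> configs" "0 < u" "u < 1"
      "cayley z1 = of_real y1" "0 < y1" "y1 < 1" "cayley z2 = of_real y2" "0 < y2" "y2 < 1"
      by (rule real_configsE)
    have y: "y1 * y2 * u < 1"
      using x by (smt (verit) mult_le_one mult_less_cancel_left2 mult_pos_pos)
    have "1 - complex_of_real y1 * of_real y2 * of_real u = of_real (1 - y1 * y2 * u)" by simp
    then have "Im (L0 x) = 0"
      using x y Im_Ln_pos_real[of "1 - y1 * y2 * u"] Im_Ln_pos_real[of y1] Im_Ln_pos_real[of y2]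
      by (simp add: L0_def)
    then show "(case x of (z1, z2, u) \<Rightarrow> (arc3 z1 z2 u)\<^sup>2 - 1) \<noteq> 0 \<and> Im (L0 x) = 0"
      using ex x(1,2) exp_not_eq_zero by (metis case_prod_conv)
  qed
  then show ?thesis by (simp add: log_sq1_def L0_def)
qed

lemma sq1_sqrt_eq:
  assumes "z \<in> cut_plane"
  shows "sq1_sqrt z = 2 * exp (Ln (cayley z) / 2) / (1 - cayley z)"
proof -
  note ne = cut_plane_nonpos[OF assms]
  have "sq1_sqrt z = exp (Ln (z - 1) / 2 + Ln (z + 1) / 2)"
    using ne by (simp add: sq1_sqrt_def csqrt_exp_Ln exp_add)
  also have "Ln (z - 1) / 2 + Ln (z + 1) / 2 = Ln (cayley z) / 2 + Ln (z + 1)"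
    by (simp add: cayley_facts(8)[OF assms] field_simps)
  also have "exp \<dots> = exp (Ln (cayley z) / 2) * (z + 1)"
    using ne by (simp add: exp_add)
  also have "z + 1 = 2 / (1 - cayley z)"
    using ne by (simp add: cayley_facts(1)[OF assms])
  finally show ?thesis by simp
qed

text \<open>S is the product of the three roots 2 sqrt p_i / (1 - p_i), where p3 = p1 p2 s^2 has the
  root s sqrt p1 sqrt p2. The roots of p1 and p2 then occur squared, so the identity is rational in
  p1, p2 and s.\<close>

lemma C_fun_identity:
  fixes p1 p2 s :: complex
  assumes ne: "p1 \<noteq> 0" "p2 \<noteq> 0" "s \<noteq> 0" "1 + p1 \<noteq> 0" "1 + p2 \<noteq> 0" "1 - p1 \<noteq> 0" "1 - p2 \<noteq> 0"
    "1 - p1 * p2 * s\<^sup>2 \<noteq> 0" "1 + p1 * p2 * s\<^sup>2 \<noteq> 0"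
  defines "z1 \<equiv> (1 + p1) / (1 - p1)" and "z2 \<equiv> (1 + p2) / (1 - p2)"
    and "z3 \<equiv> (1 + p1 * p2 * s\<^sup>2) / (1 - p1 * p2 * s\<^sup>2)"
    and "S \<equiv> 8 * s * p1 * p2 / ((1 - p1) * (1 - p2) * (1 - p1 * p2 * s\<^sup>2))"
  shows "z3 * ((1 - z1^2 * z2^2 - z1^2 * z3^2 - z2^2 * z3^2 + 2 * z1^2 * z2^2 * z3^2) / (2 * z1 * z2 * z3 * S) - 1)
    = (1 - s) * (1 - p1 * p2 * s) * (1 - p1 * s) * (1 - p2 * s)
      / (s * (1 - p1 * p2 * s\<^sup>2) * (1 + p1) * (1 + p2))"
proof -
  define A1 A2 A3 B1 B2 B3 where "A1 = 1 + p1" and "A2 = 1 + p2" and "A3 = 1 + p1 * p2 * s\<^sup>2"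
    and "B1 = 1 - p1" and "B2 = 1 - p2" and "B3 = 1 - p1 * p2 * s\<^sup>2"
  note AB = A1_def A2_def A3_def B1_def B2_def B3_def
  have ne': "A1 \<noteq> 0" "A2 \<noteq> 0" "A3 \<noteq> 0" "B1 \<noteq> 0" "B2 \<noteq> 0" "B3 \<noteq> 0"
    using ne by (simp_all add: AB)
  define N where "N = B1^2 * B2^2 * B3^2 - A1^2 * A2^2 * B3^2 - A1^2 * A3^2 * B2^2 - A2^2 * A3^2 * B1^2 + 2 * A1^2 * A2^2 * A3^2"
  have num: "1 - z1^2 * z2^2 - z1^2 * z3^2 - z2^2 * z3^2 + 2 * z1^2 * z2^2 * z3^2 = N / (B1^2 * B2^2 * B3^2)"
    unfolding z1_def z2_def z3_def N_def AB[symmetric]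
    using ne' by (simp add: power_divide divide_simps) (simp add: algebra_simps)
  have den: "2 * z1 * z2 * z3 * S = 16 * A1 * A2 * A3 * s * p1 * p2 / (B1^2 * B2^2 * B3^2)"
    unfolding z1_def z2_def z3_def S_def AB[symmetric]
    using ne' by (simp add: power2_eq_square mult_ac)
  \<comment> \<open>The decisive factorization: over the common denominator, the numerator of C - 1
    splits into four factors linear in s.\<close>
  have key: "N - 16 * A1 * A2 * A3 * s * p1 * p2
      = 16 * p1 * p2 * ((1 - s) * (1 - p1 * p2 * s) * (1 - p1 * s) * (1 - p2 * s))"
    unfolding N_def AB by algebra
  have "z3 * ((1 - z1^2 * z2^2 - z1^2 * z3^2 - z2^2 * z3^2 + 2 * z1^2 * z2^2 * z3^2) / (2 * z1 * z2 * z3 * S) - 1)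
     = A3 / B3 * (N / (16 * A1 * A2 * A3 * s * p1 * p2) - 1)"
    unfolding num den unfolding z3_def AB[symmetric] using ne' by simp
  also have "\<dots> = (N - 16 * A1 * A2 * A3 * s * p1 * p2) / (16 * A1 * A2 * B3 * s * p1 * p2)"
    using ne' ne(1-3) by (simp add: divide_simps)
  also have "\<dots> = (1 - s) * (1 - p1 * p2 * s) * (1 - p1 * s) * (1 - p2 * s) / (s * B3 * A1 * A2)"
    unfolding key using ne' ne(1-3) by (simp add: divide_simps)
  finally show ?thesis by (simp add: AB)
qed

lemma log_z3C_eq:
  assumes "(z1, z2, u) \<in> configs"
  shows "log_z3C (z1, z2, u) = of_real (ln (1 - sqrt u)) + Ln (1 - cayley z1 * cayley z2 * of_real (sqrt u))
     + Ln (1 - cayley z1 * of_real (sqrt u)) + Ln (1 - cayley z2 * of_real (sqrt u))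
     - of_real (ln (sqrt u)) - Ln (1 - cayley z1 * cayley z2 * of_real u) - Ln (1 + cayley z1) - Ln (1 + cayley z2)"
proof -
  define L0 where "L0 = (\<lambda>(z1, z2, u). complex_of_real (ln (1 - sqrt u)) + Ln (1 - cayley z1 * cayley z2 * of_real (sqrt u))
     + Ln (1 - cayley z1 * of_real (sqrt u)) + Ln (1 - cayley z2 * of_real (sqrt u))
     - of_real (ln (sqrt u)) - Ln (1 - cayley z1 * cayley z2 * of_real u) - Ln (1 + cayley z1) - Ln (1 + cayley z2))"
  define f where "f = (\<lambda>(z1, z2, u). arc3 z1 z2 u * (C_fun (z1, z2, u) - 1))"
  have nonpos: "1 - cayley z1 * cayley z2 * of_real u \<notin> \<real>\<^sub>\<le>\<^sub>0"
    "1 - cayley z1 * cayley z2 * of_real (sqrt u) \<notin> \<real>\<^sub>\<le>\<^sub>0"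
    "1 - cayley z1 * of_real (sqrt u) \<notin> \<real>\<^sub>\<le>\<^sub>0" "1 - cayley z2 * of_real (sqrt u) \<notin> \<real>\<^sub>\<le>\<^sub>0"
    "1 + cayley z1 \<notin> \<real>\<^sub>\<le>\<^sub>0" "1 + cayley z2 \<notin> \<real>\<^sub>\<le>\<^sub>0"
    if "(z1, z2, u) \<in> configs" for z1 z2 u
  proof -
    note d = configsD[OF that]
    have "u \<in> {0..1}" "sqrt u \<in> {0..1}" using d by auto
    then show "1 - cayley z1 * cayley z2 * of_real u \<notin> \<real>\<^sub>\<le>\<^sub>0"
      "1 - cayley z1 * cayley z2 * of_real (sqrt u) \<notin> \<real>\<^sub>\<le>\<^sub>0"
      "1 - cayley z1 * of_real (sqrt u) \<notin> \<real>\<^sub>\<le>\<^sub>0" "1 - cayley z2 * of_real (sqrt u) \<notin> \<real>\<^sub>\<le>\<^sub>0"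
      using d(3) cayley_facts(7)[OF d(1)] cayley_facts(7)[OF d(2)] by (auto simp only: slit_plane_scale'(1))
    show "1 + cayley z1 \<notin> \<real>\<^sub>\<le>\<^sub>0" "1 + cayley z2 \<notin> \<real>\<^sub>\<le>\<^sub>0"
      using cayley_facts(6) d by auto
  qed
  have cont: "continuous_on configs L0"
    unfolding L0_def split_def
    by (intro continuous_on_diff continuous_on_add continuous_on_mult continuous_on_const continuous_on_Ln_compose
         continuous_on_cayley continuous_on_of_real continuous_on_ln continuous_on_real_sqrt
         continuous_on_fst continuous_on_snd continuous_on_id)
       (auto simp: nonpos dest: configsD)
  \<comment> \<open>Where z3 = 0, division by zero gives C the value 0 and hence f the value 0,
    whereas the explicit expression stays nonzero; so this point is left out here.\<close>
  have ex: "exp (L0 (z1, z2, u)) = f (z1, z2, u)"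
    if c: "(z1, z2, u) \<in> configs" and nz: "arc3 z1 z2 u \<noteq> 0" for z1 z2 u
  proof -
    note d = configsD[OF c]
    note n = nonpos[OF c]
    define s where "s = complex_of_real (sqrt u)"
    define p1 where "p1 = cayley z1"
    define p2 where "p2 = cayley z2"
    have su: "complex_of_real u = s\<^sup>2" using d by (simp add: s_def flip: of_real_power)
    have s: "s \<noteq> 0" "exp (complex_of_real (ln (sqrt u))) = s" "exp (complex_of_real (ln (1 - sqrt u))) = 1 - s"
      using d exp_Ln_of_real[of "sqrt u"] exp_Ln_of_real[of "1 - sqrt u"] by (auto simp: s_def)
    have p: "p1 \<noteq> 0" "p2 \<noteq> 0" "1 + p1 \<noteq> 0" "1 + p2 \<noteq> 0"
      using n cayley_facts(4)[OF d(1)] cayley_facts(4)[OF d(2)] by (auto simp: p1_def p2_def)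
    have p': "1 - p1 \<noteq> 0" "1 - p2 \<noteq> 0"
      using cayley_facts(7)[OF d(1)] cayley_facts(7)[OF d(2)] by (auto simp: p1_def p2_def slit_plane_iff)
    have q: "1 - p1 * p2 * s\<^sup>2 \<noteq> 0" "1 - p1 * p2 * s \<noteq> 0" "1 - p1 * s \<noteq> 0" "1 - p2 * s \<noteq> 0"
      using n unfolding su p1_def[symmetric] p2_def[symmetric] s_def[symmetric] by auto
    have z3: "arc3 z1 z2 u = (1 + p1 * p2 * s\<^sup>2) / (1 - p1 * p2 * s\<^sup>2)"
      by (simp add: arc3_eq su p1_def p2_def)
    have q': "1 + p1 * p2 * s\<^sup>2 \<noteq> 0" using nz unfolding z3 by auto
    have "exp (log_sq1 (z1, z2, u) / 2) = 2 * s * exp (Ln p1 / 2) * exp (Ln p2 / 2) / (1 - p1 * p2 * s\<^sup>2)"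
    proof -
      have "ln u / 2 = ln (sqrt u)" "ln 4 / 2 = ln (2 :: real)"
        using d ln_sqrt[of u] ln_sqrt[of 4] by auto
      then have e: "log_sq1 (z1, z2, u) / 2 = of_real (ln 2) + of_real (ln (sqrt u)) + Ln p1 / 2 + Ln p2 / 2
        - Ln (1 - p1 * p2 * s\<^sup>2)"
        unfolding log_sq1_eq[OF c] su p1_def[symmetric] p2_def[symmetric]
        by (simp add: add_divide_distrib diff_divide_distrib flip: of_real_divide)
      show ?thesis
        unfolding e using s(2) q exp_Ln_of_real[of 2] by (simp add: exp_add exp_diff)
    qed
    moreover have "exp (Ln p1 / 2) * exp (Ln p1 / 2) = p1" "exp (Ln p2 / 2) * exp (Ln p2 / 2) = p2"
      using p by (simp_all flip: exp_add)
    ultimately have S: "sq1_sqrt z1 * sq1_sqrt z2 * exp (log_sq1 (z1, z2, u) / 2)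
        = 8 * s * p1 * p2 / ((1 - p1) * (1 - p2) * (1 - p1 * p2 * s\<^sup>2))"
      unfolding sq1_sqrt_eq[OF d(1)] sq1_sqrt_eq[OF d(2)] p1_def[symmetric] p2_def[symmetric]
      by (simp add: mult_ac)
    have z: "z1 = (1 + p1) / (1 - p1)" "z2 = (1 + p2) / (1 - p2)"
      using cayley_facts(3) d by (auto simp: p1_def p2_def)
    have "f (z1, z2, u) = (1 - s) * (1 - p1 * p2 * s) * (1 - p1 * s) * (1 - p2 * s)
      / (s * (1 - p1 * p2 * s\<^sup>2) * (1 + p1) * (1 + p2))"
      unfolding f_def C_fun_def Let_def prod.case S z3
      using C_fun_identity[OF p(1,2) s(1) p(3,4) p' q(1) q'] unfolding z[symmetric] .
    also have "\<dots> = exp (L0 (z1, z2, u))"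
      unfolding L0_def prod.case su p1_def[symmetric] p2_def[symmetric] s_def[symmetric]
      using s p q by (simp add: exp_add exp_diff)
    finally show ?thesis by simp
  qed
  have f0: "f (z1, z2, u) = 0 \<Longrightarrow> arc3 z1 z2 u = 0" if "(z1, z2, u) \<in> configs" for z1 z2 u
    using ex[OF that] exp_not_eq_zero by metis
  have "continued_log f (z1, z2, u) = L0 (z1, z2, u)"
  proof (rule continued_log_eq[OF cont _ _ _ assms])
    show "exp (L0 x) = f x" if "x \<in> configs" "f x \<noteq> 0" for x
      using ex that by (cases x) (auto simp: f_def)
    show "\<forall>\<^sub>F t in at u. f (z1, z2, t) \<noteq> 0"
      if c: "(z1, z2, u) \<in> configs" and "f (z1, z2, u) = 0" for z1 z2 u
    proof -
      \<comment> \<open>A zero of f requires 1 + w u = 0, and w determines u, so there is at most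
        one zero on each arc.\<close>
      define w where "w = cayley z1 * cayley z2"
      have "1 - w * of_real u \<noteq> 0" using nonpos[OF c] by (auto simp: w_def)
      then have wu: "1 + w * of_real u = 0"
        using f0[OF that] by (simp add: arc3_eq w_def)
      have "\<forall>\<^sub>F t in at u. t \<in> {0<..<1} - {u}"
        using configsD[OF c] by (intro eventually_at_in_open) auto
      then show ?thesis
      proof eventually_elim
        case (elim t)
        then have ct: "(z1, z2, t) \<in> configs" using c by (simp add: configs_def)
        have "w \<noteq> 0" using wu by auto
        have "1 + w * of_real t \<noteq> 0"
        proof
          assume "1 + w * of_real t = 0"
          then have "w * of_real t = w * of_real u" using wu by (metis add_left_cancel)
          then show False using \<open>w \<noteq> 0\<close> elim by simp
        qed
        moreover have "1 - w * of_real t \<noteq> 0" using nonpos[OF ct] by (auto simp: w_def)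
        ultimately have "arc3 z1 z2 t \<noteq> 0" by (simp add: arc3_eq w_def)
        then show ?case using f0[OF ct] by blast
      qed
    qed
    fix x assume "x \<in> real_configs"
    then obtain z1 z2 u y1 y2 where x: "x = (z1, z2, u)" "x \<in> configs" "0 < u" "u < 1"
      "cayley z1 = of_real y1" "0 < y1" "y1 < 1" "cayley z2 = of_real y2" "0 < y2" "y2 < 1"
      by (rule real_configsE)
    have su: "0 < sqrt u" "sqrt u < 1" using x by auto
    have less: "a * b < 1" if "0 < a" "a < 1" "0 < b" "b < 1" for a b :: real
      using mult_strict_mono[of a 1 b 1] that by simp
    have y: "y1 * y2 * u < 1" "y1 * y2 * sqrt u < 1" "y1 * sqrt u < 1" "y2 * sqrt u < 1"
      using x su by (auto intro!: less)
    have "1 - complex_of_real y1 * of_real y2 * of_real u = of_real (1 - y1 * y2 * u)"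
      "1 - complex_of_real y1 * of_real y2 * of_real (sqrt u) = of_real (1 - y1 * y2 * sqrt u)"
      "1 - complex_of_real y1 * of_real (sqrt u) = of_real (1 - y1 * sqrt u)"
      "1 - complex_of_real y2 * of_real (sqrt u) = of_real (1 - y2 * sqrt u)"
      "1 + complex_of_real y1 = of_real (1 + y1)" "1 + complex_of_real y2 = of_real (1 + y2)" by simp_all
    note r = this
    have "Im (L0 x) = 0"
      unfolding L0_def x(1) prod.case x(5) x(8) r
      using x y su by (simp add: Im_Ln_pos_real del: of_real_diff of_real_add)
    moreover have "arc3 z1 z2 u \<noteq> 0"
    proof -
      have "1 + complex_of_real y1 * of_real y2 * of_real u = of_real (1 + y1 * y2 * u)" by simp
      moreover have "1 + y1 * y2 * u \<noteq> 0" "1 - y1 * y2 * u \<noteq> 0"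
        using x y by (auto simp: add_pos_pos order.strict_implies_not_eq[symmetric])
      ultimately show ?thesis
        unfolding arc3_eq x(5) x(8) r by (metis divide_eq_0_iff of_real_eq_0_iff)
    qed
    ultimately show "f x \<noteq> 0 \<and> Im (L0 x) = 0"
      using f0 x(1,2) by blast
  qed
  then show ?thesis by (simp add: log_z3C_def L0_def f_def)
qed

section \<open>The product formula\<close>

lemma vector_derivative_arc3:
  assumes "1 - cayley z1 * cayley z2 * of_real u \<noteq> 0"
  shows "vector_derivative (arc3 z1 z2) (at u)
    = 2 * (cayley z1 * cayley z2) / (1 - cayley z1 * cayley z2 * of_real u)\<^sup>2"
proof -
  define w where "w = cayley z1 * cayley z2"
  have "((\<lambda>V. (1 + w * V) / (1 - w * V)) has_field_derivative 2 * w / (1 - w * of_real u)\<^sup>2) (at (of_real u))"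
    using assms unfolding w_def[symmetric]
    by (auto intro!: derivative_eq_intros simp: power2_eq_square divide_simps) (simp add: algebra_simps)
  then have "((\<lambda>u. (1 + w * of_real u) / (1 - w * of_real u)) has_vector_derivative
      2 * w / (1 - w * of_real u)\<^sup>2) (at u)"
    by (rule has_vector_derivative_real_field)
  then show ?thesis
    unfolding w_def arc3_eq[symmetric, abs_def] by (simp add: vector_derivative_at arc3_eq[abs_def])
qed

text \<open>The reflection formula, since the cosine is sin (pi kappa). It yields the factor 1 /
  Gamma (1 - kappa) that the second Gegenbauer function needs; the pole condition of
  \<open>rhs_defined\<close> enters here.\<close>

lemma cos_mult_Gamma:
  fixes l a :: complex
  assumes "l + a + 1/2 \<notin> \<int>\<^sub>\<le>\<^sub>0"
  shows "cos (of_real pi * (l + a)) * Gamma (l + a + 1/2) = of_real pi * rGamma (1 - (l + a + 1/2))"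
proof -
  define k where "k = l + a + 1/2"
  have "of_real pi * k = of_real pi * (l + a) + of_real pi / 2"
    by (simp add: k_def algebra_simps)
  then have "cos (of_real pi * (l + a)) = sin (of_real pi * k)"
    by (simp add: sin_add cos_of_real_pi_half sin_of_real_pi_half)
  also have "\<dots> = of_real pi * (rGamma k * rGamma (1 - k))"
    using rGamma_reflection_complex[of k] by simp
  finally have "cos (of_real pi * (l + a)) * Gamma k = of_real pi * rGamma (1 - k) * (rGamma k * Gamma k)"
    by (simp only: mult_ac)
  moreover have "rGamma k * Gamma k = 1"
    using assms by (simp add: k_def Gamma_def rGamma_eq_zero_iff)
  ultimately show ?thesis
    unfolding k_def[symmetric] by (simp only: mult_1_right)
qed

text \<open>\<kappa> and \<beta> are variables with defining equations, not abbreviations, so that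
  long exponents stay folded; outside, the equations are discharged by reflexivity.\<close>

context
  fixes l a z1 z2 \<kappa> \<beta> :: complex
  assumes \<kappa>_def: "\<kappa> = l + a + 1/2" and \<beta>_def: "\<beta> = l + 2 * a"
begin

definition "sub_integrand v = beta_weight \<beta> (1 - \<kappa>) v *
   (product_kernel \<kappa> (cayley z1) (cayley z2) (of_real v)
    * euler_integral \<kappa> \<beta> (1 - \<kappa>) (cayley z1 * cayley z2 * (of_real v)\<^sup>2))"
text \<open>The constant in C = \<open>geg_const\<close> (1 - p)^\<beta> E (p).\<close>

definition "geg_const = of_real (sqrt pi) / 2 powr (2 * a - 1) * rGamma a * rGamma (l + 1) * rGamma (1 - \<kappa>)"
text \<open>Everything in the integrand that does not depend on u. The 4 is the 2 of the derivative
  of the arc times another 2 that compensates the Jacobian 1 / (2 sqrt u).\<close>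

definition "integrand_const = geg_const * 4 * exp ((a/2 - 5/4) * of_real (ln 4))
   * exp ((a/2 - 1/4) * (Ln (cayley z1) + Ln (cayley z2))) * exp (\<kappa> * (Ln (1 + cayley z1) + Ln (1 + cayley z2)))"

lemma product_integrand_eq:
  assumes adm: "(z1, z2) \<in> admissible" and b: "Re (l + 2 * a) > 0" and k: "Re (l + a) < 1/2"
    and u: "0 < u" "u < 1"
  shows "product_integrand l a z1 z2 u
    = integrand_const * (sub_integrand (sqrt u) / of_real (2 * sqrt u))"
proof -
  have c: "(z1, z2, u) \<in> configs" using adm u by (simp add: configs_def)
  note d = configsD[OF c]
  define s where "s = sqrt u"
  have s: "0 < s" "s < 1" "u = s\<^sup>2" using u by (auto simp: s_def)
  define p1 where "p1 = cayley z1"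
  define p2 where "p2 = cayley z2"
  define q where "q = p1 * p2 * of_real u"
  have qS: "q \<in> slit_plane" unfolding q_def p1_def p2_def using d u by (intro slit_plane_scale) auto
  define E where "E = euler_integral \<kappa> \<beta> (1 - \<kappa>) q"
  define S where "S = complex_of_real (ln s)"
  define T where "T = complex_of_real (ln (1 - s))"
  define W where "W = Ln (1 - p1 * p2 * of_real s)"
  define Q1 where "Q1 = Ln (1 - p1 * of_real s)"
  define Q2 where "Q2 = Ln (1 - p2 * of_real s)"
  define Q where "Q = Ln (1 - q)"
  define l4 where "l4 = complex_of_real (ln 4)"
  define P1 where "P1 = Ln p1"
  define P2 where "P2 = Ln p2"
  define M1 where "M1 = Ln (1 + p1)"
  define M2 where "M2 = Ln (1 + p2)"
  have sI: "s \<in> {0..1}" using s by simp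
  have ne: "1 - q \<noteq> 0" "1 - p1 * p2 * of_real s \<noteq> 0" "1 - p1 * of_real s \<noteq> 0" "1 - p2 * of_real s \<noteq> 0"
    using qS slit_plane_scale'(2)[OF d(3) sI] slit_plane_scale'(2)[OF cayley_facts(7)[OF d(1)] sI]
      slit_plane_scale'(2)[OF cayley_facts(7)[OF d(2)] sI]
    by (auto simp: slit_plane_iff p1_def p2_def)
  have lnu: "complex_of_real (ln u) = 2 * S"
    using s by (simp add: S_def ln_realpow)
  have sq: "log_sq1 (z1, z2, u) = l4 + 2 * S + P1 + P2 - 2 * Q"
    unfolding log_sq1_eq[OF c] lnu by (simp add: l4_def P1_def P2_def Q_def q_def p1_def p2_def)
  have lC: "log_z3C (z1, z2, u) = T + W + Q1 + Q2 - S - Q - M1 - M2"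
    unfolding log_z3C_eq[OF c] s_def[symmetric]
    by (simp add: T_def W_def Q1_def Q2_def S_def Q_def M1_def M2_def q_def p1_def p2_def)
  have geg: "gegenbauer l a (arc3 z1 z2 u) = geg_const * (exp (\<beta> * Q) * E)"
    unfolding arc3_eq p1_def[symmetric] p2_def[symmetric] q_def[symmetric]
    unfolding gegenbauer_eq_euler_integral[OF b k qS, folded \<kappa>_def \<beta>_def, folded geg_const_def]
    using ne(1) by (simp add: E_def Q_def powr_def)
  \<comment> \<open>Writing the derivative of the arc as an exponential, too, reduces the lemma to
    comparing exponents.\<close>
  have "exp (P1 + P2 - 2 * Q) = p1 * p2 / (1 - q)\<^sup>2"
    using ne(1) cayley_facts(4)[OF d(1)] cayley_facts(4)[OF d(2)]
    by (simp add: exp_add exp_diff exp_double P1_def P2_def Q_def p1_def p2_def)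
  then have vd: "vector_derivative (arc3 z1 z2) (at u) = 2 * exp (P1 + P2 - 2 * Q)"
    using vector_derivative_arc3[of z1 z2 u] ne(1) by (simp add: q_def p1_def p2_def)
  have exp4: "exp (w + x + y + z) = exp w * exp x * exp y * exp z" for w x y z :: complex
    by (simp add: exp_add)
  have "product_integrand l a z1 z2 u = 2 * geg_const * E *
     exp (\<beta> * Q + (a/2 - 5/4) * (l4 + 2 * S + P1 + P2 - 2 * Q)
       + (- l - a - 1/2) * (T + W + Q1 + Q2 - S - Q - M1 - M2) + (P1 + P2 - 2 * Q))"
    unfolding product_integrand_def sq lC geg vd exp4
    by (simp only: mult_ac)
  \<comment> \<open>The coefficients of Q add up to 2 \<kappa>. Those of S give \<beta> - 2, split
    into \<beta> - 1 for the beta weight and -1 for the Jacobian.\<close>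
  also have "\<beta> * Q + (a/2 - 5/4) * (l4 + 2 * S + P1 + P2 - 2 * Q)
       + (- l - a - 1/2) * (T + W + Q1 + Q2 - S - Q - M1 - M2) + (P1 + P2 - 2 * Q)
     = (a/2 - 5/4) * l4 + (a/2 - 1/4) * (P1 + P2) + \<kappa> * (M1 + M2) + (\<beta> - 1) * S + (- \<kappa>) * T
       + (- \<kappa>) * Q1 + (- \<kappa>) * Q2 + (- \<kappa>) * W + 2 * \<kappa> * Q + (- S)"
    unfolding \<kappa>_def \<beta>_def by (simp add: field_simps)
  also have "2 * geg_const * E * exp \<dots> = integrand_const * (exp ((\<beta> - 1) * S) * exp ((- \<kappa>) * T) *
      (exp ((- \<kappa>) * Q1) * exp ((- \<kappa>) * Q2) * exp ((- \<kappa>) * W) * exp (2 * \<kappa> * Q) * E) / (2 * exp S))"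
    unfolding integrand_const_def exp_add exp_minus[of S]
    by (simp add: field_simps l4_def P1_def P2_def M1_def M2_def p1_def p2_def exp_add)
  also have "exp ((\<beta> - 1) * S) * exp ((- \<kappa>) * T) *
      (exp ((- \<kappa>) * Q1) * exp ((- \<kappa>) * Q2) * exp ((- \<kappa>) * W) * exp (2 * \<kappa> * Q) * E) = sub_integrand s"
  proof -
    have "of_real s \<noteq> (0::complex)" "of_real (1 - s) \<noteq> (0::complex)"
      using s by (simp_all del: of_real_diff)
    then have "beta_weight \<beta> (1 - \<kappa>) s = exp ((\<beta> - 1) * S) * exp ((- \<kappa>) * T)"
      using s by (simp add: beta_weight_def powr_def S_def T_def Ln_of_real del: of_real_diff)
    moreover have "product_kernel \<kappa> p1 p2 (of_real s) =
        exp ((- \<kappa>) * Q1) * exp ((- \<kappa>) * Q2) * exp ((- \<kappa>) * W) * exp (2 * \<kappa> * Q)"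
      using ne s by (simp add: product_kernel_def powr_def Q1_def Q2_def W_def Q_def q_def)
    moreover have "p1 * p2 * (of_real s)\<^sup>2 = q" using s by (simp add: q_def)
    ultimately show ?thesis
      unfolding sub_integrand_def p1_def[symmetric] p2_def[symmetric] by (simp add: E_def)
  qed
  also have "2 * exp S = of_real (2 * s)"
    using s by (simp add: S_def exp_of_real)
  finally show ?thesis by (simp add: s_def)
qed

lemma product_integrand_has_integral:
  assumes adm: "(z1, z2) \<in> admissible" and b: "Re (l + 2 * a) > 0" and k: "Re (l + a) < 1/2"
  shows "(product_integrand l a z1 z2 has_integral integrand_const *
    (euler_integral \<kappa> \<beta> (1 - \<kappa>) (cayley z1) * euler_integral \<kappa> \<beta> (1 - \<kappa>) (cayley z2))) {0..1}"
proof -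
  have z: "z1 \<in> cut_plane" "z2 \<in> cut_plane" using adm by (auto simp: admissible_def)
  have mem: "cayley z1 \<in> slit_plane" "cayley z2 \<in> slit_plane" "cayley z1 * cayley z2 \<in> slit_plane"
    using z cayley_facts(7) adm admissible_iff by auto
  have b': "Re \<beta> > 0" and k': "Re \<kappa> < 1" using b k by (simp_all add: \<beta>_def \<kappa>_def)
  have abs: "sub_integrand absolutely_integrable_on {0..1}"
    unfolding sub_integrand_def by (rule product_integrand_absolutely_integrable[OF b' k' mem])
  have "integral {0..1} sub_integrand
     = euler_integral \<kappa> \<beta> (1 - \<kappa>) (cayley z1) * euler_integral \<kappa> \<beta> (1 - \<kappa>) (cayley z2)"
    using product_integral_eq[OF b' k' mem] by (simp add: product_integral_def sub_integrand_def[abs_def])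
  with integral_sqrt_substitution[OF abs]
  have "((\<lambda>u. integrand_const * (sub_integrand (sqrt u) / of_real (2 * sqrt u))) has_integral integrand_const *
    (euler_integral \<kappa> \<beta> (1 - \<kappa>) (cayley z1) * euler_integral \<kappa> \<beta> (1 - \<kappa>) (cayley z2))) {0..1}"
    by (intro has_integral_mult_right) simp
  then show ?thesis
    by (rule has_integral_spike[of "{0, 1}", rotated 2])
       (use product_integrand_eq[OF adm b k] in auto)
qed

lemma product_formula:
  assumes def: "rhs_defined l a z1 z2" and b: "Re (l + 2 * a) > 0"
  shows "product_integrand l a z1 z2 integrable_on {0..1}"
    and "gegenbauer l a z1 * gegenbauer l a z2 = product_rhs l a z1 z2"
proof -
  have adm: "(z1, z2) \<in> admissible" and k: "Re (l + a) < 1/2" and nonpole: "l + a + 1/2 \<notin> \<int>\<^sub>\<le>\<^sub>0"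
    using def by (auto simp: rhs_defined_def)
  have z: "z1 \<in> cut_plane" "z2 \<in> cut_plane" using adm by (auto simp: admissible_def)
  note I = product_integrand_has_integral[OF adm b k]
  show "product_integrand l a z1 z2 integrable_on {0..1}"
    using I by blast
  define P1 where "P1 = Ln (cayley z1)"
  define P2 where "P2 = Ln (cayley z2)"
  define M1 where "M1 = Ln (1 + cayley z1)"
  define M2 where "M2 = Ln (1 + cayley z2)"
  define N1 where "N1 = Ln (1 - cayley z1)"
  define N2 where "N2 = Ln (1 - cayley z2)"
  define l2 where "l2 = complex_of_real (ln 2)"
  define e where "e = a/2 - 1/4"
  have powr2: "2 powr x = exp (x * l2)" for x :: complex
    using Ln_of_real[of 2] by (simp add: powr_def l2_def)
  have ln4: "complex_of_real (ln 4) = 2 * l2"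
    using ln_realpow[of 2 2] by (simp add: l2_def)
  have zk: "z1 powr (l + a + 1/2) = exp (\<kappa> * (M1 - N1))" "z2 powr (l + a + 1/2) = exp (\<kappa> * (M2 - N2))"
    using cut_plane_nonpos(4) z
    by (simp_all add: powr_def \<kappa>_def M1_def N1_def M2_def N2_def cayley_facts(9,10))
  have sq: "sq1_powr z1 (a/2 - 1/4) = exp (e * (P1 + 2 * l2 - 2 * N1))"
    "sq1_powr z2 (a/2 - 1/4) = exp (e * (P2 + 2 * l2 - 2 * N2))"
    using cut_plane_nonpos(5,6) z
    by (simp_all add: sq1_powr_def powr_def P1_def N1_def P2_def N2_def cayley_facts(8,9) l2_def e_def
         flip: exp_add) (simp_all add: algebra_simps)
  have g: "gegenbauer l a z = geg_const * (exp (\<beta> * Ln (1 - cayley z)) * euler_integral \<kappa> \<beta> (1 - \<kappa>) (cayley z))"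
    if "z \<in> cut_plane" for z
  proof -
    have "1 - cayley z \<noteq> 0" using cayley_facts(7)[OF that] by (auto simp: slit_plane_iff)
    then show ?thesis
      using gegenbauer_eq_euler_integral[OF b k cayley_facts(7)[OF that], folded \<kappa>_def \<beta>_def, folded geg_const_def]
        cayley_facts(3)[OF that]
      by (simp add: powr_def)
  qed
  define R where "R = rGamma a * rGamma (l + 1) * rGamma (1 - \<kappa>)"
  have K: "geg_const = of_real (sqrt pi) * R * exp (- (2 * a - 1) * l2)"
    unfolding geg_const_def R_def powr2 mult_minus_left exp_minus divide_inverse by (simp only: mult_ac)
  \<comment> \<open>As a power of 2 this constant joins the same exponent as all others.\<close>
  have four: "4 = exp (2 * l2)"
    using exp_Ln_of_real[of 2] by (simp add: exp_double l2_def)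
  have "cos (of_real pi * (l + a)) * Gamma (l + a + 1/2) * rGamma (l + 1) * rGamma a
     / (2 powr (a - 1/2) * of_real (sqrt pi)
        * (z1 powr (l + a + 1/2) * z2 powr (l + a + 1/2))
        * sq1_powr z1 (a/2 - 1/4) * sq1_powr z2 (a/2 - 1/4)) * integrand_const
    = geg_const * (of_real (sqrt pi) * R *
       exp (- ((a - 1/2) * l2) + - (\<kappa> * (M1 - N1)) + - (\<kappa> * (M2 - N2))
        + - (e * (P1 + 2 * l2 - 2 * N1)) + - (e * (P2 + 2 * l2 - 2 * N2))
        + 2 * l2 + (a/2 - 5/4) * (2 * l2) + e * (P1 + P2) + \<kappa> * (M1 + M2)))"
  proof -
    have "complex_of_real pi = of_real (sqrt pi) * of_real (sqrt pi)"
      by (simp flip: of_real_mult)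
    then have pi: "cos (of_real pi * (l + a)) * Gamma (l + a + 1/2) * rGamma (l + 1) * rGamma a
      = of_real (sqrt pi) * (of_real (sqrt pi) * R)"
      unfolding cos_mult_Gamma[OF nonpole] R_def \<kappa>_def by simp
    have sp: "complex_of_real (sqrt pi) \<noteq> 0" by simp
    have rearrange: "sp * (sp * R) / (x * sp * (y1 * y2) * s1 * s2) * (K * c * e1 * e2 * e3)
      = K * (sp * R * (inverse x * inverse y1 * inverse y2 * inverse s1 * inverse s2 * c * e1 * e2 * e3))"
      if "sp \<noteq> 0" for sp R x y1 y2 s1 s2 K c e1 e2 e3 :: complex
      using that by (simp add: divide_inverse)
    show ?thesis
      unfolding pi zk sq powr2 integrand_const_def ln4
      unfolding P1_def[symmetric] P2_def[symmetric]
        M1_def[symmetric] M2_def[symmetric] e_def[symmetric] exp_add exp_minus four[symmetric]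
      by (rule rearrange[OF sp])
  qed
  \<comment> \<open>The terms with P and M cancel; N1 and N2 keep the coefficient \<kappa> + 2 e =
    \<beta>, which is the exponent of 1 - p in each Gegenbauer function.\<close>
  also have "- ((a - 1/2) * l2) + - (\<kappa> * (M1 - N1)) + - (\<kappa> * (M2 - N2))
        + - (e * (P1 + 2 * l2 - 2 * N1)) + - (e * (P2 + 2 * l2 - 2 * N2))
        + 2 * l2 + (a/2 - 5/4) * (2 * l2) + e * (P1 + P2) + \<kappa> * (M1 + M2)
     = - (2 * a - 1) * l2 + \<beta> * N1 + \<beta> * N2"
    by (simp add: e_def \<kappa>_def \<beta>_def field_simps)
  also have "geg_const * (of_real (sqrt pi) * R * exp (- (2 * a - 1) * l2 + \<beta> * N1 + \<beta> * N2))
     = geg_const * exp (\<beta> * N1) * (geg_const * exp (\<beta> * N2))"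
    unfolding exp_add K by (simp only: mult_ac)
  finally have const: "cos (of_real pi * (l + a)) * Gamma (l + a + 1/2) * rGamma (l + 1) * rGamma a
     / (2 powr (a - 1/2) * of_real (sqrt pi)
        * (z1 powr (l + a + 1/2) * z2 powr (l + a + 1/2))
        * sq1_powr z1 (a/2 - 1/4) * sq1_powr z2 (a/2 - 1/4)) * integrand_const
    = geg_const * exp (\<beta> * N1) * (geg_const * exp (\<beta> * N2))" .
  show "gegenbauer l a z1 * gegenbauer l a z2 = product_rhs l a z1 z2"
    unfolding product_rhs_def integral_unique[OF I] g[OF z(1)] g[OF z(2)] N1_def[symmetric] N2_def[symmetric]
      mult.assoc[of _ integrand_const, symmetric] const
    by (simp only: mult_ac)
qed

end

theorem theorem41:
  fixes z1 z2 l a :: complex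
  assumes "z1 \<in> cut_plane" and "z2 \<in> cut_plane"
    and "l \<noteq> 0" and "a \<noteq> 0"
    and "Re (l + 2 * a) > 0"
  shows "(rhs_defined l a z1 z2 \<longrightarrow>
            product_integrand l a z1 z2 integrable_on {0..1} \<and>
            gegenbauer l a z1 * gegenbauer l a z2 = product_rhs l a z1 z2) \<and>
         (\<exists>R. continues_rhs R \<and> gegenbauer l a z1 * gegenbauer l a z2 = R l a z1 z2)"
proof (intro conjI exI impI)
  show "continues_rhs (\<lambda>l a z1 z2. gegenbauer l a z1 * gegenbauer l a z2)"
    unfolding continues_rhs_def
  proof (intro conjI allI impI)
    fix a z1 z2 :: complex assume "z1 \<in> cut_plane" "z2 \<in> cut_plane"
    moreover have "open {l. l \<noteq> 0 \<and> Re (l + 2 * a) > 0}"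
      by (intro open_Collect_conj open_Collect_neq open_Collect_less continuous_intros)
    ultimately show "(\<lambda>l. gegenbauer l a z1 * gegenbauer l a z2) holomorphic_on {l. l \<noteq> 0 \<and> Re (l + 2 * a) > 0}"
      by (intro holomorphic_on_mult holomorphic_on_gegenbauer holomorphic_on_const holomorphic_on_ident) auto
  next
    fix l z1 z2 :: complex assume "z1 \<in> cut_plane" "z2 \<in> cut_plane"
    moreover have "open {a. a \<noteq> 0 \<and> Re (l + 2 * a) > 0}"
      by (intro open_Collect_conj open_Collect_neq open_Collect_less continuous_intros)
    ultimately show "(\<lambda>a. gegenbauer l a z1 * gegenbauer l a z2) holomorphic_on {a. a \<noteq> 0 \<and> Re (l + 2 * a) > 0}"
      by (intro holomorphic_on_mult holomorphic_on_gegenbauer holomorphic_on_const holomorphic_on_ident) auto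
  next
    \<comment> \<open>The clauses for z1 and for z2 follow from the same holomorphy, with the other
      factor constant.\<close>
    fix l a z :: complex assume "Re (l + 2 * a) > 0"
    then have "(\<lambda>w. gegenbauer l a w) holomorphic_on cut_plane"
      by (intro holomorphic_on_gegenbauer holomorphic_on_const holomorphic_on_ident open_cut_plane) auto
    then show "(\<lambda>w. gegenbauer l a w * gegenbauer l a z) holomorphic_on cut_plane"
      "(\<lambda>w. gegenbauer l a z * gegenbauer l a w) holomorphic_on cut_plane"
      by (intro holomorphic_on_mult holomorphic_on_const; assumption)+
  next
    fix l a z1 z2 :: complex assume "Re (l + 2 * a) > 0" "rhs_defined l a z1 z2"
    then show "gegenbauer l a z1 * gegenbauer l a z2 = product_rhs l a z1 z2"
      by (intro product_formula[OF refl refl])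
  qed
qed (use product_formula[OF refl refl] assms in auto)

end
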